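(* Let $M$ be an oriented closed connected manifold with fundamental group $\Gamma$ and let $\Gamma_* = (\Gamma_k)_{k \in \mathbb{N}}$ be a (descending) chain of finite index subgroups of $\Gamma$. Then $$ \operatorname{rg}(\Gamma, \Gamma_* ) \leq \|M\|_{\mathbb{Z}}^{\Gamma_*}. $$ In particular, $\operatorname{rg} \Gamma \leq \|M\|_{\mathbb{Z}}^{\infty}$.
   Context: Rank gradient: For a finitely generated group $G$, let $d(G)$ denote the minimal size of a generating set of $G$. Let $F(G)$ denote the set of all finite index subgroups of $G$. For a finitely generated group $\Gamma$ and a descending chain $\Gamma_* = (\Gamma_k)_{k\in\mathbb{N}}$ of finite index subgroups of $\Gamma$, the rank gradient of $\Gamma$ with respect to $\Gamma_*$ is $$\operatorname{rg}(\Gamma,\Gamma_* ) := \inf_{k\in\mathbb{N}} \frac{d(\Gamma_k)-1}{[\Gamma:\Gamma_k]},$$ and the absolute rank gradient of $\Gamma$ is $$\operatorname{rg}\Gamma := \inf_{H\in F(\Gamma)} \frac{d(H)-1}{[\Gamma:H]}.$$ Integral simplicial volume: For an oriented closed connected $n$-manifold $N$, let $[N]_{\mathbb{Z}} \in H_n(N;\mathbb{Z})$ be its integral fundamental class. A fundamental cycle of $N$ is a singular cycle in $C_n(N;\mathbb{Z})$ representing $[N]_{\mathbb{Z}}$. The integral simplicial volume of $N$ is $$\|N\|_{\mathbb{Z}} := \min\Bigl\{ \sum_{j=1}^m |a_j| \Bigm| \sum_{j=1}^m a_j\cdot\sigma_j \in C_n(N;\mathbb{Z}) \text{ is a fundamental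 cycle of } N\Bigr\},$$ where such sums are written in reduced form (pairwise distinct singular simplices $\sigma_j$). Stable integral simplicial volume: Let $M$ be an oriented closed connected $n$-manifold with fundamental group $\Gamma$ and universal covering $\widetilde M$, on which $\Gamma$ acts by deck transformations. For a finite index subgroup $H \subset \Gamma$, $\widetilde M/H$ is the finite covering manifold of $M$ associated with $H$, with the orientation induced from $M$. For a descending chain $\Gamma_* = (\Gamma_k)_{k\in\mathbb{N}}$ of finite index subgroups of $\Gamma$, the stable integral simplicial volume of $M$ with respect to $\Gamma_*$ is $$\|M\|_{\mathbb{Z}}^{\Gamma_*} := \inf_{k\in\mathbb{N}} \frac{\|\widetilde M/\Gamma_k\|_{\mathbb{Z}}}{[\Gamma:\Gamma_k]},$$ and the stable integral simplicial volume of $M$ is $$\|M\|_{\mathbb{Z}}^{\infty} := \inf_{H\in F(\Gamma)} \frac{\|\widetilde M/H\|_{\mathbb{Z}}}{[\Gamma:H]}.$$ *)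

theory Defs
  imports "HOL-Analysis.Analysis" "HOL-Homology.Homology"
begin

section \<open>Rank gradient\<close>

text \<open>The minimal size of a generating set; it is \<open>\<infinity>\<close> exactly if the group is not finitely
  generated, and it is \<open>0\<close> for the trivial group.\<close>

definition group_rank :: "('a, 'b) monoid_scheme \<Rightarrow> enat" where
  "group_rank G =
     (INF S \<in> {S. finite S \<and> S \<subseteq> carrier G \<and> generate G S = carrier G}. enat (card S))"

definition group_index :: "('a, 'b) monoid_scheme \<Rightarrow> 'a set \<Rightarrow> nat" where
  "group_index G H = card (rcosets\<^bsub>G\<^esub> H)"

definition finite_index_subgroups :: "('a, 'b) monoid_scheme \<Rightarrow> 'a set set" where
  "finite_index_subgroups G = {H. subgroup H G \<and> finite (rcosets\<^bsub>G\<^esub> H)}"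

definition finite_index_chain :: "('a, 'b) monoid_scheme \<Rightarrow> (nat \<Rightarrow> 'a set) \<Rightarrow> bool" where
  "finite_index_chain G Hs \<longleftrightarrow> (\<forall>k. Hs k \<in> finite_index_subgroups G) \<and> decseq Hs"

definition rank_quotient :: "('a, 'b) monoid_scheme \<Rightarrow> 'a set \<Rightarrow> ereal" where
  "rank_quotient G H =
     (ereal_of_enat (group_rank (G\<lparr>carrier := H\<rparr>)) - 1) / ereal (real (group_index G H))"

definition rank_gradient_wrt :: "('a, 'b) monoid_scheme \<Rightarrow> (nat \<Rightarrow> 'a set) \<Rightarrow> ereal" where
  "rank_gradient_wrt G Hs = (INF k. rank_quotient G (Hs k))"

definition rank_gradient :: "('a, 'b) monoid_scheme \<Rightarrow> ereal" where
  "rank_gradient G = (INF H \<in> finite_index_subgroups G. rank_quotient G H)"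


section \<open>Fundamental group, universal covering and its quotients\<close>

text \<open>The library develops path homotopies only for subsets of a type of class
  \<open>topological_space\<close>; here we need them for arbitrary topologies, because the universal covering
  is a topology on a set of path classes. A class contains every real function whose restriction
  to the unit interval is homotopic to that of the given path, relative to the end points.\<close>

definition path_homotopic :: "'a topology \<Rightarrow> (real \<Rightarrow> 'a) \<Rightarrow> (real \<Rightarrow> 'a) \<Rightarrow> bool" where
  "path_homotopic X p q \<longleftrightarrow>
     homotopic_with (\<lambda>r. r 0 = p 0 \<and> r 1 = p 1) (top_of_set {0..1}) X p q"

definition path_class :: "'a topology \<Rightarrow> (real \<Rightarrow> 'a) \<Rightarrow> (real \<Rightarrow> 'a) set" where
  "path_class X p = {q. path_homotopic X p q}"

definition path_join :: "(real \<Rightarrow> 'a) \<Rightarrow> (real \<Rightarrow> 'a) \<Rightarrow> real \<Rightarrow> 'a" where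
  "path_join p q = (\<lambda>t. if t \<le> 1/2 then p (2 * t) else q (2 * t - 1))"

text \<open>If \<open>a\<close> and \<open>b\<close> are the classes of composable paths \<open>p\<close> and \<open>q\<close>, this is the class
  of \<open>path_join p q\<close>.\<close>

definition class_join ::
  "'a topology \<Rightarrow> (real \<Rightarrow> 'a) set \<Rightarrow> (real \<Rightarrow> 'a) set \<Rightarrow> (real \<Rightarrow> 'a) set" where
  "class_join X a b = (\<Union>p\<in>a. \<Union>q\<in>b. path_class X (path_join p q))"

definition fundamental_group :: "'a topology \<Rightarrow> 'a \<Rightarrow> (real \<Rightarrow> 'a) set monoid" where
  "fundamental_group X x0 =
     \<lparr>carrier = {path_class X p | p. pathin X p \<and> p 0 = x0 \<and> p 1 = x0},
      mult = class_join X,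
      one = path_class X (\<lambda>_. x0)\<rparr>"

text \<open>The standard model of the universal covering: homotopy classes of paths starting at the
  base point. The basic open sets consist of the classes of all prolongations, inside an open set
  \<open>U\<close>, of a path \<open>p\<close> that ends in \<open>U\<close>.\<close>

definition universal_cover :: "'a topology \<Rightarrow> 'a \<Rightarrow> (real \<Rightarrow> 'a) set topology" where
  "universal_cover X x0 = topology_generated_by
     {{path_class X (path_join p d) | d. pathin (subtopology X U) d \<and> d 0 = p 1} | p U.
        pathin X p \<and> p 0 = x0 \<and> openin X U \<and> p 1 \<in> U}"

text \<open>The fundamental group acts from the left by deck transformations
  \<open>\<xi> \<mapsto> class_join X h \<xi>\<close>. For a subgroup \<open>H\<close>, the points of the associated covering
  are the \<open>H\<close>-orbits, and it carries the quotient topology.\<close>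

definition deck_orbit ::
  "'a topology \<Rightarrow> (real \<Rightarrow> 'a) set set \<Rightarrow> (real \<Rightarrow> 'a) set \<Rightarrow> (real \<Rightarrow> 'a) set set" where
  "deck_orbit X H \<xi> = (\<lambda>h. class_join X h \<xi>) ` H"

definition quotient_topology :: "'a topology \<Rightarrow> ('a \<Rightarrow> 'b) \<Rightarrow> 'b topology" where
  "quotient_topology X q =
     topology (\<lambda>U. U \<subseteq> q ` topspace X \<and> openin X {x \<in> topspace X. q x \<in> U})"

lemma openin_quotient_topology:
  "openin (quotient_topology X q) U \<longleftrightarrow>
     U \<subseteq> q ` topspace X \<and> openin X {x \<in> topspace X. q x \<in> U}"
proof -
  have "istopology (\<lambda>U. U \<subseteq> q ` topspace X \<and> openin X {x \<in> topspace X. q x \<in> U})"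
    unfolding istopology_def
  proof (rule conjI; intro allI impI)
    fix S T
    assume "S \<subseteq> q ` topspace X \<and> openin X {x \<in> topspace X. q x \<in> S}"
      and "T \<subseteq> q ` topspace X \<and> openin X {x \<in> topspace X. q x \<in> T}"
    moreover have "{x \<in> topspace X. q x \<in> S \<inter> T}
        = {x \<in> topspace X. q x \<in> S} \<inter> {x \<in> topspace X. q x \<in> T}"
      by blast
    ultimately show "S \<inter> T \<subseteq> q ` topspace X \<and> openin X {x \<in> topspace X. q x \<in> S \<inter> T}"
      by auto
  next
    fix K
    assume K: "\<forall>S\<in>K. S \<subseteq> q ` topspace X \<and> openin X {x \<in> topspace X. q x \<in> S}"
    have "{x \<in> topspace X. q x \<in> \<Union> K} = (\<Union>S\<in>K. {x \<in> topspace X. q x \<in> S})"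
      by blast
    with K show "\<Union> K \<subseteq> q ` topspace X \<and> openin X {x \<in> topspace X. q x \<in> \<Union> K}"
      by auto
  qed
  then show ?thesis
    by (simp add: quotient_topology_def)
qed

lemma quotient_map_quotient_topology: "quotient_map X (quotient_topology X q) q"
proof -
  have "{x \<in> topspace X. q x \<in> q ` topspace X} = topspace X"
    by blast
  then have "openin (quotient_topology X q) (q ` topspace X)"
    by (simp add: openin_quotient_topology)
  then have "topspace (quotient_topology X q) = q ` topspace X"
    by (metis openin_quotient_topology openin_subset openin_topspace subset_antisym)
  then show ?thesis
    by (simp add: quotient_map_def openin_quotient_topology)
qed

definition covering_of_subgroup ::
  "'a topology \<Rightarrow> 'a \<Rightarrow> (real \<Rightarrow> 'a) set set \<Rightarrow> (real \<Rightarrow> 'a) set set topology" where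
  "covering_of_subgroup X x0 H = quotient_topology (universal_cover X x0) (deck_orbit X H)"

text \<open>The covering map sends the orbit of a path class to the common end point of its paths.\<close>

definition covering_projection :: "(real \<Rightarrow> 'a) set set \<Rightarrow> 'a" where
  "covering_projection orb = (THE z. \<exists>\<xi>\<in>orb. \<exists>p\<in>\<xi>. p 1 = z)"


section \<open>Closed manifolds and orientations\<close>

definition topological_manifold :: "nat \<Rightarrow> 'a topology \<Rightarrow> bool" where
  "topological_manifold n X \<longleftrightarrow>
     Hausdorff_space X \<and> second_countable X \<and>
     (\<forall>x\<in>topspace X. \<exists>U V. openin X U \<and> x \<in> U \<and> openin (Euclidean_space n) V \<and>
        subtopology X U homeomorphic_space subtopology (Euclidean_space n) V)"

definition closed_connected_manifold :: "nat \<Rightarrow> 'a topology \<Rightarrow> bool" where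
  "closed_connected_manifold n X \<longleftrightarrow>
     topological_manifold n X \<and> compact_space X \<and> connected_space X \<and> topspace X \<noteq> {}"

abbreviation local_homology :: "nat \<Rightarrow> 'a topology \<Rightarrow> 'a \<Rightarrow> 'a chain set monoid" where
  "local_homology n X x \<equiv> relative_homology_group (int n) X (topspace X - {x})"

text \<open>An orientation is a choice of generators \<open>\<mu> x\<close> of the local homology groups
  \<open>H_n(X, X - {x})\<close> that is locally induced by a single class in \<open>H_n(X, X - U)\<close>.\<close>

definition orientation :: "nat \<Rightarrow> 'a topology \<Rightarrow> ('a \<Rightarrow> 'a chain set) \<Rightarrow> bool" where
  "orientation n X \<mu> \<longleftrightarrow>
     (\<forall>x\<in>topspace X. \<mu> x \<in> carrier (local_homology n X x) \<and>
        generate (local_homology n X x) {\<mu> x} = carrier (local_homology n X x)) \<and>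
     (\<forall>x\<in>topspace X. \<exists>U a. openin X U \<and> x \<in> U \<and>
        a \<in> carrier (relative_homology_group (int n) X (topspace X - U)) \<and>
        (\<forall>y\<in>U. hom_induced (int n) X (topspace X - U) X (topspace X - {y}) id a = \<mu> y))"

text \<open>The orientation of the total space \<open>Y\<close> of a covering (or local homeomorphism) \<open>p\<close> induced
  by an orientation of the base \<open>X\<close>: at \<open>y\<close> it corresponds to \<open>\<mu> (p y)\<close> under
  \<open>H_n(Y, Y - {y}) \<cong> H_n(U, U - {y}) \<cong> H_n(X, X - {p y})\<close>, where \<open>U\<close> is an open
  neighbourhood of \<open>y\<close> mapped homeomorphically onto an open set. The first isomorphism is
  excision, so the class does not depend on \<open>U\<close>.\<close>

definition induced_orientation ::
  "nat \<Rightarrow> 'b topology \<Rightarrow> 'a topology \<Rightarrow> ('b \<Rightarrow> 'a) \<Rightarrow> ('a \<Rightarrow> 'a chain set) \<Rightarrow> 'b \<Rightarrow> 'b chain set"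
where
  "induced_orientation n Y X p \<mu> y =
     (THE \<nu>. \<exists>U a. openin Y U \<and> y \<in> U \<and> openin X (p ` U) \<and>
        homeomorphic_map (subtopology Y U) (subtopology X (p ` U)) p \<and>
        a \<in> carrier (relative_homology_group (int n) (subtopology Y U) (U - {y})) \<and>
        hom_induced (int n) (subtopology Y U) (U - {y}) Y (topspace Y - {y}) id a = \<nu> \<and>
        hom_induced (int n) (subtopology Y U) (U - {y}) X (topspace X - {p y}) p a = \<mu> (p y))"


section \<open>Integral simplicial volume\<close>

text \<open>On a closed connected oriented manifold there is exactly one such class.\<close>

definition is_fundamental_class ::
  "nat \<Rightarrow> 'a topology \<Rightarrow> ('a \<Rightarrow> 'a chain set) \<Rightarrow> 'a chain set \<Rightarrow> bool" where
  "is_fundamental_class n X \<mu> c \<longleftrightarrow>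
     c \<in> carrier (homology_group (int n) X) \<and>
     (\<forall>x\<in>topspace X. hom_induced (int n) X {} X (topspace X - {x}) id c = \<mu> x)"

definition fundamental_cycle ::
  "nat \<Rightarrow> 'a topology \<Rightarrow> ('a \<Rightarrow> 'a chain set) \<Rightarrow> 'a chain \<Rightarrow> bool" where
  "fundamental_cycle n X \<mu> z \<longleftrightarrow>
     singular_relcycle n X {} z \<and> is_fundamental_class n X \<mu> (homologous_rel_set n X {} z)"

definition chain_norm :: "'a chain \<Rightarrow> nat" where
  "chain_norm z = (\<Sum>\<sigma>\<in>Poly_Mapping.keys z. nat \<bar>Poly_Mapping.lookup z \<sigma>\<bar>)"

text \<open>As \<open>enat\<close> is well-ordered, the infimum of the (non-empty) set of norms is a minimum.\<close>

definition integral_simplicial_volume ::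
  "nat \<Rightarrow> 'a topology \<Rightarrow> ('a \<Rightarrow> 'a chain set) \<Rightarrow> enat" where
  "integral_simplicial_volume n X \<mu> = (INF z \<in> {z. fundamental_cycle n X \<mu> z}. enat (chain_norm z))"

definition volume_quotient ::
  "nat \<Rightarrow> 'a topology \<Rightarrow> ('a \<Rightarrow> 'a chain set) \<Rightarrow> 'a \<Rightarrow> (real \<Rightarrow> 'a) set set \<Rightarrow> ereal" where
  "volume_quotient n M \<mu> x0 H =
     ereal_of_enat (integral_simplicial_volume n (covering_of_subgroup M x0 H)
       (induced_orientation n (covering_of_subgroup M x0 H) M covering_projection \<mu>))
     / ereal (real (group_index (fundamental_group M x0) H))"

definition stable_integral_simplicial_volume_wrt ::
  "nat \<Rightarrow> 'a topology \<Rightarrow> ('a \<Rightarrow> 'a chain set) \<Rightarrow> 'a \<Rightarrow> (nat \<Rightarrow> (real \<Rightarrow> 'a) set set) \<Rightarrow> ereal" where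
  "stable_integral_simplicial_volume_wrt n M \<mu> x0 Hs = (INF k. volume_quotient n M \<mu> x0 (Hs k))"

definition stable_integral_simplicial_volume ::
  "nat \<Rightarrow> 'a topology \<Rightarrow> ('a \<Rightarrow> 'a chain set) \<Rightarrow> 'a \<Rightarrow> ereal" where
  "stable_integral_simplicial_volume n M \<mu> x0 =
     (INF H \<in> finite_index_subgroups (fundamental_group M x0). volume_quotient n M \<mu> x0 H)"

end

theory Submission
  imports Defs
begin

text \<open>
  The covering \<open>N\<close> of \<open>M\<close> that belongs to a finite index subgroup \<open>H\<close> of \<open>\<Gamma>\<close> is again a manifold,
  and the theorem follows from \<open>d(H) \<le> \<parallel>N\<parallel>\<close> by division by the index. More precisely, if \<open>z\<close> is a
  fundamental cycle of \<open>N\<close>, then one element of \<open>H\<close> for each simplex of \<open>z\<close> suffices to generate \<open>H\<close>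
  (\<open>group_rank_le_card_keys_fundamental_cycle\<close>).

  Choose, for every point \<open>y\<close> of \<open>N\<close>, a path from \<open>x0\<close> whose class belongs to the orbit \<open>y\<close>. For a
  simplex \<open>\<sigma>\<close> of dimension \<open>n\<close>, the edge from its vertex \<open>n\<close> to its vertex \<open>n - 1\<close> closes up with the paths
  chosen at its ends to a loop in \<open>M\<close>, the class \<open>g \<sigma>\<close> of which belongs to \<open>H\<close>. Let \<open>K\<close> be generated by the
  \<open>g \<sigma>\<close> for \<open>\<sigma>\<close> in \<open>z\<close>, and let \<open>q : E \<rightarrow> N\<close> be the covering that belongs to \<open>K\<close>. Every simplex of \<open>N\<close>
  has a lift to \<open>E\<close> that sends the last vertex to the \<open>K\<close>-orbit of the path chosen there.
  This choice of lifts is compatible with all faces of \<open>\<sigma>\<close>: the faces that contain the last vertex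
  inherit the lift, and for the opposite face the start moves along the last edge, from one chosen
  path to another, up to \<open>g \<sigma> \<in> K\<close> (\<open>lift_simplex_face\<close>). So the lifts of the simplices of \<open>z\<close> form a
  cycle \<open>w\<close> of \<open>E\<close> that is mapped to \<open>z\<close> (\<open>lift_fundamental_cycle\<close>).

  Now \<open>q\<close> is injective by a degree argument (\<open>covering_map_inj_on_if_fundamental_cycle_lifts\<close>). As
  \<open>E\<close> is connected, \<open>w\<close> has the same local degree \<open>d\<close> at all points. By excision, \<open>w\<close> is, near the fibre
  over a point \<open>b\<close>, a finite sum of chains inside single sheets, each of which contributes \<open>d\<close> times the
  orientation to the class of \<open>z\<close> at \<open>b\<close>. Hence \<open>k * d = 1\<close>, where \<open>k\<close> is the number of elements of any
  finite set of sheets that contains the ones met by \<open>w\<close>, and there can only be one sheet. This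
  includes the case of infinitely many sheets. Finally, \<open>K = H\<close> as \<open>q\<close> maps the \<open>K\<close>-orbits of all elements
  of \<open>H\<close> to the same point.

  The homological input of the degree argument is that chains have compact support, so that an equation
  between local classes at a point persists nearby (\<open>singular_chain_avoids_nbhd\<close>), and that the local
  homology groups of a manifold are infinite cyclic. The coverings are treated in the model of path classes, over
  spaces in which every neighbourhood contains a path-connected one whose loops are
  null-homotopic in the whole space (\<open>locally_simple\<close>).
\<close>

section \<open>Paths up to homotopy\<close>

lemma path_homotopic_refl: "pathin X p \<Longrightarrow> path_homotopic X p p"
  by (simp add: path_homotopic_def pathin_def)

lemma path_homotopic_imp_pathin:
  assumes "path_homotopic X p q"
  shows "pathin X p" "pathin X q" "q 0 = p 0" "q 1 = p 1"
  using homotopic_with_imp_continuous_maps[OF assms[unfolded path_homotopic_def]]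
    homotopic_with_imp_property[OF assms[unfolded path_homotopic_def]]
  by (auto simp: pathin_def)

lemma path_homotopic_sym: "path_homotopic X p q \<Longrightarrow> path_homotopic X q p"
  using path_homotopic_imp_pathin[of X p q]
  by (simp add: path_homotopic_def homotopic_with_sym)

lemma path_homotopic_trans:
  assumes "path_homotopic X p q" "path_homotopic X q r"
  shows "path_homotopic X p r"
proof -
  have e: "q 0 = p 0" "q 1 = p 1"
    using path_homotopic_imp_pathin[OF assms(1)] by auto
  show ?thesis
    using homotopic_with_trans[OF assms(1)[unfolded path_homotopic_def]]
      assms(2)[unfolded path_homotopic_def e] by (simp add: path_homotopic_def)
qed

lemma path_homotopic_eqI:
  assumes "pathin X p" "\<And>t. 0 \<le> t \<Longrightarrow> t \<le> 1 \<Longrightarrow> q t = p t"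
  shows "path_homotopic X p q"
  unfolding path_homotopic_def
  by (rule homotopic_with_equal) (use assms in \<open>auto simp: pathin_def\<close>)

lemma path_homotopic_image:
  assumes "continuous_map X Y f" "path_homotopic X p q"
  shows "path_homotopic Y (f \<circ> p) (f \<circ> q)"
  using assms(2) unfolding path_homotopic_def
  by (rule homotopic_with_compose_continuous_map_left[OF _ assms(1)]) auto

lemma pathin_image: "pathin X p \<Longrightarrow> continuous_map X Y f \<Longrightarrow> pathin Y (f \<circ> p)"
  by (simp add: pathin_def continuous_map_compose)

text \<open>Paths in the unit interval with the same ends are homotopic along straight lines.\<close>

lemma path_homotopic_reparam:
  assumes "pathin X p" "continuous_on {0..1} a" "a ` {0..1} \<subseteq> {0..1}"
    "continuous_on {0..1} b" "b ` {0..1} \<subseteq> {0..1}" "a 0 = b 0" "a 1 = b 1"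
  shows "path_homotopic X (p \<circ> a) (p \<circ> b)"
proof -
  have "homotopic_paths {0..1} a b"
  proof (rule homotopic_paths_linear)
    show "closed_segment (a t) (b t) \<subseteq> {0..1}" if "t \<in> {0..1}" for t
      using that assms(3,5) by (intro closed_segment_subset) (simp_all add: image_subset_iff)
  qed (use assms in \<open>simp_all add: path_def pathstart_def pathfinish_def\<close>)
  then have "path_homotopic (top_of_set {0..1}) a b"
    by (simp add: path_homotopic_def homotopic_paths_def pathstart_def pathfinish_def)
  then show ?thesis
    using assms(1) by (intro path_homotopic_image) (auto simp: pathin_def)
qed

lemma path_join_0 [simp]: "path_join p q 0 = p 0"
  and path_join_1 [simp]: "path_join p q 1 = q 1"
  by (simp_all add: path_join_def)

lemma path_join_comp: "f \<circ> path_join p q = path_join (f \<circ> p) (f \<circ> q)"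
  by (auto simp: path_join_def)

lemma pathin_path_join:
  assumes "pathin X p" "pathin X q" "p 1 = q 0"
  shows "pathin X (path_join p q)"
proof -
  let ?I = "top_of_set {0..1::real}"
  have *: "continuous_map ?I X (\<lambda>t. if t \<le> 1/2 then p (2*t) else q (2*t-1))"
  proof (rule continuous_map_cases_le)
    show "continuous_map ?I euclideanreal (\<lambda>t. t)" "continuous_map ?I euclideanreal (\<lambda>t. 1/2)"
      by auto
    show "continuous_map (subtopology ?I {x \<in> topspace ?I. x \<le> 1/2}) X (\<lambda>t. p (2*t))"
      by (rule continuous_map_compose[of _ ?I "\<lambda>t. 2*t", unfolded o_def, OF _ assms(1)[unfolded pathin_def]])
        (auto simp: subtopology_subtopology intro!: continuous_intros)
    show "continuous_map (subtopology ?I {x \<in> topspace ?I. 1/2 \<le> x}) X (\<lambda>t. q (2*t-1))"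
      by (rule continuous_map_compose[of _ ?I "\<lambda>t. 2*t-1", unfolded o_def, OF _ assms(2)[unfolded pathin_def]])
        (auto simp: subtopology_subtopology intro!: continuous_intros)
    show "p (2 * x) = q (2 * x - 1)" if "x = 1/2" for x
      unfolding that using assms(3) by simp
  qed
  then show ?thesis
    by (simp add: pathin_def path_join_def)
qed

lemma path_homotopic_join:
  assumes "path_homotopic X p p'" "path_homotopic X q q'" "p 1 = q 0"
  shows "path_homotopic X (path_join p q) (path_join p' q')"
proof -
  let ?I = "top_of_set {0..1::real}"
  let ?II = "prod_topology ?I ?I"
  obtain h where h: "continuous_map ?II X h" "\<And>t. h (0,t) = p t" "\<And>t. h (1,t) = p' t"
    "\<And>s. s \<in> {0..1} \<Longrightarrow> h (s,0) = p 0 \<and> h (s,1) = p 1"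
    using assms(1) unfolding path_homotopic_def homotopic_with_def by auto
  obtain k where k: "continuous_map ?II X k" "\<And>t. k (0,t) = q t" "\<And>t. k (1,t) = q' t"
    "\<And>s. s \<in> {0..1} \<Longrightarrow> k (s,0) = q 0 \<and> k (s,1) = q 1"
    using assms(2) unfolding path_homotopic_def homotopic_with_def by auto
  let ?g = "\<lambda>z. if snd z \<le> 1/2 then h (fst z, 2 * snd z) else k (fst z, 2 * snd z - 1)"
  have "continuous_map ?II X ?g"
  proof (rule continuous_map_cases_le)
    show "continuous_map ?II euclideanreal snd"
      by (metis continuous_map_into_fulltopology continuous_map_snd)
    show "continuous_map ?II euclideanreal (\<lambda>t. 1/2)"
      by auto
    show "continuous_map (subtopology ?II {x \<in> topspace ?II. snd x \<le> 1/2}) X (\<lambda>z. h (fst z, 2 * snd z))"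
      by (rule continuous_map_compose[of _ ?II "\<lambda>z. (fst z, 2 * snd z)", unfolded o_def, OF _ h(1)])
        (auto simp: subtopology_subtopology intro!: continuous_intros)
    show "continuous_map (subtopology ?II {x \<in> topspace ?II. 1/2 \<le> snd x}) X (\<lambda>z. k (fst z, 2 * snd z - 1))"
      by (rule continuous_map_compose[of _ ?II "\<lambda>z. (fst z, 2 * snd z - 1)", unfolded o_def, OF _ k(1)])
        (auto simp: subtopology_subtopology intro!: continuous_intros)
    show "h (fst x, 2 * snd x) = k (fst x, 2 * snd x - 1)"
      if "x \<in> topspace ?II" "snd x = 1/2" for x
      using that(1) h(4)[of "fst x"] k(4)[of "fst x"] assms(3) unfolding that(2) by (cases x) simp
  qed
  then show ?thesis
    unfolding path_homotopic_def homotopic_with_def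
    apply (intro exI[of _ ?g])
    using h k by (auto simp: path_join_def)
qed

text \<open>The laws for joins of paths have this form: both sides run through the same path, with different
  parametrisations.\<close>

lemma path_homotopic_reparamI:
  assumes p: "pathin X p"
    and a: "continuous_on {0..1} a" "\<And>t. 0 \<le> t \<Longrightarrow> t \<le> 1 \<Longrightarrow> 0 \<le> a t \<and> a t \<le> 1"
    and b: "continuous_on {0..1} b" "\<And>t. 0 \<le> t \<Longrightarrow> t \<le> 1 \<Longrightarrow> 0 \<le> b t \<and> b t \<le> 1"
    and ends: "a 0 = b 0" "a 1 = b 1"
    and q: "\<And>t. 0 \<le> t \<Longrightarrow> t \<le> 1 \<Longrightarrow> q t = p (a t)"
    and r: "\<And>t. 0 \<le> t \<Longrightarrow> t \<le> 1 \<Longrightarrow> r t = p (b t)"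
  shows "path_homotopic X q r"
proof -
  have 1: "path_homotopic X (p \<circ> a) (p \<circ> b)"
    by (rule path_homotopic_reparam[OF p]) (use a b ends in auto)
  have 2: "path_homotopic X (p \<circ> a) q"
    by (rule path_homotopic_eqI[OF path_homotopic_imp_pathin(1)[OF 1]]) (simp add: q)
  have 3: "path_homotopic X (p \<circ> b) r"
    by (rule path_homotopic_eqI[OF path_homotopic_imp_pathin(2)[OF 1]]) (simp add: r)
  show ?thesis
    by (rule path_homotopic_trans[OF path_homotopic_sym[OF 2] path_homotopic_trans[OF 1 3]])
qed

lemma path_homotopic_join_assoc:
  assumes "pathin X p" "pathin X q" "pathin X r" "p 1 = q 0" "q 1 = r 0"
  shows "path_homotopic X (path_join (path_join p q) r) (path_join p (path_join q r))"
proof (rule path_homotopic_reparamI)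
  let ?F = "path_join (path_join p q) r"
  \<comment> \<open>piecewise linear with increasing slopes, hence the maximum of its pieces\<close>
  let ?a = "\<lambda>t::real. max (t/2) (max (t - 1/4) (2*t-1))"
  show "pathin X ?F"
    using assms by (intro pathin_path_join) auto
  show "continuous_on {0..1} (\<lambda>t::real. t)" "continuous_on {0..1} ?a"
    by (intro continuous_intros; simp)+
  show "0 \<le> ?a t \<and> ?a t \<le> 1" if "0 \<le> t" "t \<le> 1" for t
    using that by (auto simp: le_max_iff_disj)
  show "path_join p (path_join q r) t = ?F (?a t)" if t: "0 \<le> t" "t \<le> 1" for t
  proof -
    consider "t \<le> 1/2" | "1/2 < t" "t \<le> 3/4" | "3/4 < t" by linarith
    then show ?thesis
    proof cases
      case 1
      then have "?a t = t/2" using \<open>0 \<le> t\<close> by (simp add: max_def)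
      with 1 show ?thesis by (simp add: path_join_def)
    next
      case 2
      then have "?a t = t - 1/4" by (simp add: max_def)
      with 2 show ?thesis by (simp add: path_join_def algebra_simps)
    next
      case 3
      then have "?a t = 2*t-1" by (simp add: max_def)
      with 3 show ?thesis by (simp add: path_join_def algebra_simps)
    qed
  qed
qed auto

lemma path_homotopic_join_const_right:
  assumes "pathin X p" "p 1 = x"
  shows "path_homotopic X (path_join p (\<lambda>_. x)) p"
proof (rule path_homotopic_reparamI[OF assms(1), where a = "\<lambda>t. min (2*t) 1" and b = "\<lambda>t. t"])
  show "continuous_on {0..1} (\<lambda>t::real. t)" "continuous_on {0..1} (\<lambda>t::real. min (2*t) 1)"
    by (intro continuous_intros; simp)+
  show "path_join p (\<lambda>_. x) t = p (min (2*t) 1)" if "0 \<le> t" "t \<le> 1" for t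
    using assms(2) by (simp add: path_join_def)
qed auto

lemma path_homotopic_join_const_left:
  assumes "pathin X p" "p 0 = x"
  shows "path_homotopic X (path_join (\<lambda>_. x) p) p"
proof (rule path_homotopic_reparamI[OF assms(1), where a = "\<lambda>t. max 0 (2*t-1)" and b = "\<lambda>t. t"])
  show "continuous_on {0..1} (\<lambda>t::real. t)" "continuous_on {0..1} (\<lambda>t::real. max 0 (2*t-1))"
    by (intro continuous_intros; simp)+
  show "path_join (\<lambda>_. x) p t = p (max 0 (2*t-1))" if "0 \<le> t" "t \<le> 1" for t
  proof (cases "t \<le> 1/2")
    case True
    then have "max 0 (2*t-1) = 0" by linarith
    with True assms(2) show ?thesis by (simp add: path_join_def)
  next
    case False
    then have "max 0 (2*t-1) = 2*t-1" by linarith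
    with False show ?thesis by (simp add: path_join_def)
  qed
qed auto

definition path_rev :: "(real \<Rightarrow> 'a) \<Rightarrow> real \<Rightarrow> 'a" where
  "path_rev p = (\<lambda>t. p (1 - t))"

lemma path_rev_ends [simp]: "path_rev p 0 = p 1" "path_rev p 1 = p 0"
  and path_rev_path_rev [simp]: "path_rev (path_rev p) = p"
  by (auto simp: path_rev_def)

lemma path_homotopic_join_rev:
  assumes "pathin X p" shows "path_homotopic X (path_join p (path_rev p)) (\<lambda>_. p 0)"
proof (rule path_homotopic_reparamI[OF assms(1), where a = "\<lambda>t. min (2*t) (2-2*t)" and b = "\<lambda>t. 0"])
  show "continuous_on {0..1} (\<lambda>t::real. 0::real)" "continuous_on {0..1} (\<lambda>t::real. min (2*t) (2-2*t))"
    by (intro continuous_intros; simp)+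
  show "path_join p (path_rev p) t = p (min (2*t) (2-2*t))" if "0 \<le> t" "t \<le> 1" for t
  proof (cases "t \<le> 1/2")
    case True
    then have "min (2*t) (2-2*t) = 2*t" by linarith
    with True show ?thesis by (simp add: path_join_def)
  next
    case False
    then have "min (2*t) (2-2*t) = 2-2*t" by linarith
    with False show ?thesis by (simp add: path_join_def path_rev_def)
  qed
qed auto

lemma pathin_path_rev: "pathin X p \<Longrightarrow> pathin X (path_rev p)"
proof -
  assume "pathin X p"
  then have "pathin X (p \<circ> (\<lambda>t. 1 - t))"
    unfolding pathin_def 
    by (rule continuous_map_compose[rotated]) (auto intro!: continuous_intros)
  then show ?thesis by (simp add: path_rev_def o_def)
qed

lemma path_homotopic_rev_join:
  assumes "pathin X p" shows "path_homotopic X (path_join (path_rev p) p) (\<lambda>_. p 1)"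
  using path_homotopic_join_rev[OF pathin_path_rev[OF assms]] by simp

lemma path_class_eq_iff:
  assumes "pathin X p"
  shows "path_class X p = path_class X q \<longleftrightarrow> path_homotopic X p q"
proof
  assume "path_class X p = path_class X q"
  then have "path_homotopic X q p"
    using path_homotopic_refl[OF assms] by (auto simp: path_class_def)
  then show "path_homotopic X p q" by (rule path_homotopic_sym)
next
  assume "path_homotopic X p q"
  then show "path_class X p = path_class X q"
    unfolding path_class_def using path_homotopic_sym path_homotopic_trans by blast
qed

lemmas path_class_eqI = path_class_eq_iff[THEN iffD2]

lemma path_class_self: "pathin X p \<Longrightarrow> p \<in> path_class X p"
  by (simp add: path_class_def path_homotopic_refl)

lemma path_class_eqD:
  assumes "pathin X p" "path_class X p = path_class X q"
  shows "path_homotopic X p q" "pathin X q" "q 0 = p 0" "q 1 = p 1"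
  using assms path_class_eq_iff path_homotopic_imp_pathin by blast+

lemma class_join_path_class:
  assumes "pathin X p" "pathin X q" "p 1 = q 0"
  shows "class_join X (path_class X p) (path_class X q) = path_class X (path_join p q)"
proof -
  have "path_class X (path_join p' q') = path_class X (path_join p q)"
    if "p' \<in> path_class X p" "q' \<in> path_class X q" for p' q'
  proof -
    have "path_homotopic X (path_join p q) (path_join p' q')"
      using that assms(3) by (intro path_homotopic_join) (auto simp: path_class_def)
    then show ?thesis
      using path_class_eq_iff path_homotopic_imp_pathin(1) by metis
  qed
  then show ?thesis
    unfolding class_join_def using path_class_self assms by blast
qed

lemma pathin_const: "x \<in> topspace X \<Longrightarrow> pathin X (\<lambda>_. x)"
  by (simp add: pathin_def)

lemma pathin_in_topspace: "pathin X p \<Longrightarrow> 0 \<le> t \<Longrightarrow> t \<le> 1 \<Longrightarrow> p t \<in> topspace X"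
  using continuous_map_image_subset_topspace[of "top_of_set {0..1}" X p] by (auto simp: pathin_def)

lemma pathin_ends: "pathin X p \<Longrightarrow> p 0 \<in> topspace X" "pathin X p \<Longrightarrow> p 1 \<in> topspace X"
  by (simp_all add: pathin_in_topspace)

lemma pathin_subtopology_imp_pathin: "pathin (subtopology X U) p \<Longrightarrow> pathin X p"
  by (simp add: pathin_def continuous_map_in_subtopology)

lemma path_class_join_cong:
  assumes "pathin X p" "pathin X q" "p 1 = q 0" "path_class X p = path_class X p'" "path_class X q = path_class X q'"
  shows "path_class X (path_join p q) = path_class X (path_join p' q')"
  using assms path_homotopic_join[of X p p' q q']
  by (simp add: path_class_eq_iff pathin_path_join)

lemma path_class_join_assoc:
  assumes "pathin X p" "pathin X q" "pathin X r" "p 1 = q 0" "q 1 = r 0"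
  shows "path_class X (path_join (path_join p q) r) = path_class X (path_join p (path_join q r))"
  using path_homotopic_join_assoc[OF assms] assms
  by (simp add: path_class_eq_iff pathin_path_join)

lemma path_class_join_const_right:
  "pathin X p \<Longrightarrow> p 1 = x \<Longrightarrow> path_class X (path_join p (\<lambda>_. x)) = path_class X p"
  using path_homotopic_join_const_right[of X p x] pathin_ends[of X p]
  by (intro path_class_eqI pathin_path_join) (auto intro: pathin_const)

lemma path_class_join_const_left:
  "pathin X p \<Longrightarrow> p 0 = x \<Longrightarrow> path_class X (path_join (\<lambda>_. x) p) = path_class X p"
  using path_homotopic_join_const_left[of X p x] pathin_ends[of X p]
  by (intro path_class_eqI pathin_path_join) (auto intro: pathin_const)

lemma path_class_join_rev:
  "pathin X p \<Longrightarrow> path_class X (path_join p (path_rev p)) = path_class X (\<lambda>_. p 0)"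
  by (intro path_class_eqI pathin_path_join path_homotopic_join_rev) (auto intro: pathin_path_rev)

lemma path_class_rev_join:
  "pathin X p \<Longrightarrow> path_class X (path_join (path_rev p) p) = path_class X (\<lambda>_. p 1)"
  by (intro path_class_eqI pathin_path_join path_homotopic_rev_join) (auto intro: pathin_path_rev)

text \<open>In the fundamental groupoid, \<open>p\<^sup>- p q = q\<close>.\<close>

lemma path_class_cancel_left:
  assumes p: "pathin X p" and q: "pathin X q" and e: "p 1 = q 0"
  shows "path_class X (path_join (path_rev p) (path_join p q)) = path_class X q"
proof -
  have r: "pathin X (path_rev p)" by (rule pathin_path_rev[OF p])
  have "path_class X (path_join (path_rev p) (path_join p q)) = path_class X (path_join (path_join (path_rev p) p) q)"
    using path_class_join_assoc[OF r p q] e by simp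
  also have "\<dots> = path_class X (path_join (\<lambda>_. p 1) q)"
    by (intro path_class_join_cong pathin_path_join path_class_rev_join) (use p q r e in auto)
  also have "\<dots> = path_class X q"
    by (intro path_class_join_const_left) (use q e in auto)
  finally show ?thesis .
qed

lemma path_class_cancel_right:
  assumes p: "pathin X p" and q: "pathin X q" and e: "q 1 = p 0"
  shows "path_class X (path_join (path_join q p) (path_rev p)) = path_class X q"
proof -
  have r: "pathin X (path_rev p)" by (rule pathin_path_rev[OF p])
  have "path_class X (path_join (path_join q p) (path_rev p)) = path_class X (path_join q (path_join p (path_rev p)))"
    using path_class_join_assoc[OF q p r] e by simp
  also have "\<dots> = path_class X (path_join q (\<lambda>_. p 0))"
    by (intro path_class_join_cong pathin_path_join path_class_join_rev) (use p q r e in auto)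
  also have "\<dots> = path_class X q"
    by (intro path_class_join_const_right) (use q e in auto)
  finally show ?thesis .
qed

section \<open>The fundamental group\<close>

abbreviation loopin :: "'a topology \<Rightarrow> 'a \<Rightarrow> (real \<Rightarrow> 'a) \<Rightarrow> bool" where
  "loopin X x0 l \<equiv> pathin X l \<and> l 0 = x0 \<and> l 1 = x0"

lemma carrier_fundamental_group:
  "carrier (fundamental_group X x0) = {path_class X l | l. loopin X x0 l}"
  by (simp add: fundamental_group_def)

lemma mult_fundamental_group:
  assumes "loopin X x0 l" "loopin X x0 m"
  shows "path_class X l \<otimes>\<^bsub>fundamental_group X x0\<^esub> path_class X m = path_class X (path_join l m)"
  using assms class_join_path_class[of X l m] by (simp add: fundamental_group_def)

lemma one_fundamental_group: "\<one>\<^bsub>fundamental_group X x0\<^esub> = path_class X (\<lambda>_. x0)"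
  by (simp add: fundamental_group_def)

lemma path_class_in_fundamental_group:
  "loopin X x0 l \<Longrightarrow> path_class X l \<in> carrier (fundamental_group X x0)"
  by (auto simp: carrier_fundamental_group)

lemma group_fundamental_group:
  assumes x0: "x0 \<in> topspace X"
  shows "group (fundamental_group X x0)"
proof (rule groupI)
  let ?G = "fundamental_group X x0"
  have const: "loopin X x0 (\<lambda>_. x0)" using x0 by (simp add: pathin_const)
  show "\<one>\<^bsub>?G\<^esub> \<in> carrier ?G"
    unfolding one_fundamental_group by (rule path_class_in_fundamental_group[OF const])
  fix x assume "x \<in> carrier ?G"
  then obtain l where l: "x = path_class X l" "loopin X x0 l" by (auto simp: carrier_fundamental_group)
  show "\<one>\<^bsub>?G\<^esub> \<otimes>\<^bsub>?G\<^esub> x = x"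
    unfolding one_fundamental_group l(1) mult_fundamental_group[OF const l(2)]
    using l by (intro path_class_join_const_left) auto
  have r: "loopin X x0 (path_rev l)" using l by (simp add: pathin_path_rev)
  have "path_class X (path_rev l) \<otimes>\<^bsub>?G\<^esub> x = \<one>\<^bsub>?G\<^esub>"
    unfolding one_fundamental_group l(1) mult_fundamental_group[OF r l(2)]
    using l path_class_rev_join[of X l] by simp
  then show "\<exists>y\<in>carrier ?G. y \<otimes>\<^bsub>?G\<^esub> x = \<one>\<^bsub>?G\<^esub>"
    by (rule bexI[OF _ path_class_in_fundamental_group[OF r]])
  fix y assume "y \<in> carrier ?G"
  then obtain m where m: "y = path_class X m" "loopin X x0 m" by (auto simp: carrier_fundamental_group)
  have lm: "loopin X x0 (path_join l m)" using l m by (simp add: pathin_path_join)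
  show "x \<otimes>\<^bsub>?G\<^esub> y \<in> carrier ?G"
    unfolding l(1) m(1) mult_fundamental_group[OF l(2) m(2)] by (rule path_class_in_fundamental_group[OF lm])
  fix z assume "z \<in> carrier ?G"
  then obtain k where k: "z = path_class X k" "loopin X x0 k" by (auto simp: carrier_fundamental_group)
  have mk: "loopin X x0 (path_join m k)" using k m by (simp add: pathin_path_join)
  show "x \<otimes>\<^bsub>?G\<^esub> y \<otimes>\<^bsub>?G\<^esub> z = x \<otimes>\<^bsub>?G\<^esub> (y \<otimes>\<^bsub>?G\<^esub> z)"
    unfolding l(1) m(1) k(1) mult_fundamental_group[OF l(2) m(2)] mult_fundamental_group[OF m(2) k(2)]
      mult_fundamental_group[OF lm k(2)] mult_fundamental_group[OF l(2) mk]
    using l m k by (intro path_class_join_assoc) auto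
qed

lemma inv_fundamental_group:
  assumes x0: "x0 \<in> topspace X" and l: "loopin X x0 l"
  shows "inv\<^bsub>fundamental_group X x0\<^esub> (path_class X l) = path_class X (path_rev l)"
proof (rule group.inv_equality[OF group_fundamental_group[OF x0]])
  have r: "loopin X x0 (path_rev l)" using l by (simp add: pathin_path_rev)
  show "path_class X (path_rev l) \<otimes>\<^bsub>fundamental_group X x0\<^esub> path_class X l = \<one>\<^bsub>fundamental_group X x0\<^esub>"
    unfolding one_fundamental_group mult_fundamental_group[OF r l]
    using l path_class_rev_join[of X l] by simp
  show "path_class X l \<in> carrier (fundamental_group X x0)"
    "path_class X (path_rev l) \<in> carrier (fundamental_group X x0)"
    using l r by (auto intro: path_class_in_fundamental_group)
qed

section \<open>Charts and induced orientations\<close>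

lemma homologous_rel_set_mult:
  assumes "singular_relcycle n X S a" "singular_relcycle n X S b"
  shows "homologous_rel_set n X S a \<otimes>\<^bsub>relative_homology_group (int n) X S\<^esub> homologous_rel_set n X S b
           = homologous_rel_set n X S (a + b)"
proof -
  let ?N = "singular_relboundary_set n X S"
  have r: "homologous_rel_set n X S c = ?N #>\<^bsub>relcycle_group n X S\<^esub> c" for c
    by (simp add: right_coset_singular_relboundary)
  show ?thesis
    using normal.rcos_sum[OF normal_subgroup_singular_relboundary_relcycle, of a n X S b] assms
    by (simp add: relative_homology_group_def FactGroup_def r)
qed

lemma homologous_rel_set_in_carrier:
  "singular_relcycle n X S c \<Longrightarrow>
     homologous_rel_set n X S c \<in> carrier (relative_homology_group (int n) X S)"
  by (auto simp: carrier_relative_homology_group)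

lemma homologous_rel_set_int_pow:
  assumes c: "singular_relcycle n X S c"
  shows "homologous_rel_set n X S c [^]\<^bsub>relative_homology_group (int n) X S\<^esub> (k::int)
           = homologous_rel_set n X S (frag_cmul k c)"
proof -
  let ?G = "relative_homology_group (int n) X S"
  have nat: "homologous_rel_set n X S c [^]\<^bsub>?G\<^esub> (j::nat) = homologous_rel_set n X S (frag_cmul (int j) c)" for j
  proof (induction j)
    case 0
    show ?case
      by (simp add: homologous_rel_set_eq_relboundary[THEN iffD2])
  next
    case (Suc j)
    then show ?case
      using homologous_rel_set_mult[OF singular_relcycle_cmul[OF c] c, of "int j"]
      by (simp add: frag_cmul_distrib add.commute)
  qed
  have inv: "inv\<^bsub>?G\<^esub> (homologous_rel_set n X S d) = homologous_rel_set n X S (- d)"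
    if d: "singular_relcycle n X S d" for d
  proof (rule group.inv_equality)
    show "homologous_rel_set n X S (- d) \<otimes>\<^bsub>?G\<^esub> homologous_rel_set n X S d = \<one>\<^bsub>?G\<^esub>"
      using homologous_rel_set_mult[of n X S "- d" d] d
      by (simp add: singular_relcycle_minus homologous_rel_set_eq_relboundary[THEN iffD2])
  qed (use d in \<open>simp_all add: homologous_rel_set_in_carrier singular_relcycle_minus\<close>)
  show ?thesis
  proof (cases "k \<ge> 0")
    case True
    then obtain j where "k = int j" using nonneg_int_cases by blast
    then show ?thesis by (simp add: nat int_pow_int)
  next
    case False
    then obtain j where j: "k = - int j" by (metis int_cases2 of_nat_0_le_iff)
    then show ?thesis
      using homologous_rel_set_in_carrier[OF c] inv[OF singular_relcycle_cmul[OF c]]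
      by (simp add: group.int_pow_neg_int nat)
  qed
qed

lemma hom_induced_inclusion:
  assumes c: "singular_relcycle n (subtopology X U) S c" and ST: "S \<subseteq> T"
  shows "hom_induced n (subtopology X U) S X T id (homologous_rel_set n (subtopology X U) S c)
           = homologous_rel_set n X T c"
proof -
  have "chain_map n id c = c"
    using c chain_map_ident[of n X c] by (simp add: singular_relcycle singular_chain_subtopology)
  then show ?thesis
    using hom_induced_chain_map[OF _ _ c, of X id T] ST by (simp add: Pi_iff subset_iff)
qed

lemma hom_induced_enlarge_subspace:
  "singular_relcycle n X S c \<Longrightarrow> S \<subseteq> T \<Longrightarrow>
     hom_induced n X S X T id (homologous_rel_set n X S c) = homologous_rel_set n X T c"
  using hom_induced_inclusion[of n X UNIV S c T] by simp

text \<open>The complement of \<open>U\<close> is closed and contained in the open set \<open>X - A\<close>, so it can be excised.\<close>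

lemma hom_induced_excision_open:
  assumes U: "openin X U" and A: "closedin X A" "A \<subseteq> U"
  shows "hom_induced p (subtopology X U) (U - A) X (topspace X - A) id
           \<in> iso (relative_homology_group p (subtopology X U) (U - A))
                 (relative_homology_group p X (topspace X - A))"
proof -
  let ?C = "topspace X - U"
  have "X closure_of ?C = ?C"
    using U by (simp add: closure_of_eq closedin_diff)
  moreover have "X interior_of (topspace X - A) = topspace X - A"
    using A by (simp add: interior_of_openin openin_diff)
  ultimately have "X closure_of ?C \<subseteq> X interior_of (topspace X - A)"
    using A by auto
  from homology_excision_axiom[OF this, of "topspace X" p]
  have "hom_induced p (subtopology X (topspace X - ?C)) (topspace X - A - ?C) X (topspace X - A) id
           \<in> iso (relative_homology_group p (subtopology X (topspace X - ?C)) (topspace X - A - ?C))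
                 (relative_homology_group p X (topspace X - A))"
    by simp
  moreover have "topspace X - ?C = U" "topspace X - A - ?C = U - A"
    using openin_subset[OF U] by auto
  ultimately show ?thesis by simp
qed

abbreviation patch_homology :: "int \<Rightarrow> 'b topology \<Rightarrow> 'b set \<Rightarrow> 'b \<Rightarrow> 'b chain set monoid" where
  "patch_homology k Y U y \<equiv> relative_homology_group k (subtopology Y U) (U - {y})"

abbreviation incl_hom :: "int \<Rightarrow> 'b topology \<Rightarrow> 'b set \<Rightarrow> 'b \<Rightarrow> 'b chain set \<Rightarrow> 'b chain set" where
  "incl_hom k Y U y \<equiv> hom_induced k (subtopology Y U) (U - {y}) Y (topspace Y - {y}) id"

abbreviation chart_hom ::
  "int \<Rightarrow> 'b topology \<Rightarrow> 'b set \<Rightarrow> 'b \<Rightarrow> 'a topology \<Rightarrow> ('b \<Rightarrow> 'a) \<Rightarrow> 'b chain set \<Rightarrow> 'a chain set" where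
  "chart_hom k Y U y X p \<equiv> hom_induced k (subtopology Y U) (U - {y}) X (topspace X - {p y}) p"

abbreviation local_class :: "nat \<Rightarrow> 'a topology \<Rightarrow> 'a \<Rightarrow> 'a chain \<Rightarrow> 'a chain set" where
  "local_class n X x c \<equiv> homologous_rel_set n X (topspace X - {x}) c"

text \<open>These are the neighbourhoods that occur in the definition of the induced orientation.\<close>

definition chart :: "'b topology \<Rightarrow> 'a topology \<Rightarrow> ('b \<Rightarrow> 'a) \<Rightarrow> 'b set \<Rightarrow> bool" where
  "chart Y X p U \<longleftrightarrow> openin Y U \<and> openin X (p ` U) \<and>
     homeomorphic_map (subtopology Y U) (subtopology X (p ` U)) p"

definition local_homeomorphism :: "'b topology \<Rightarrow> 'a topology \<Rightarrow> ('b \<Rightarrow> 'a) \<Rightarrow> bool" where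
  "local_homeomorphism Y X p \<longleftrightarrow> (\<forall>y\<in>topspace Y. \<exists>U. y \<in> U \<and> chart Y X p U)"

lemma chart_inj: "chart Y X p U \<Longrightarrow> inj_on p U"
  unfolding chart_def using homeomorphic_imp_injective_map[of "subtopology Y U"]
  by (auto simp: inf.absorb2 openin_subset)

lemma chart_subset:
  assumes "chart Y X p U" "openin Y V" "V \<subseteq> U"
  shows "chart Y X p V"
proof -
  have o: "openin (subtopology Y U) V" "openin Y U" "openin X (p ` U)"
    and h: "homeomorphic_map (subtopology Y U) (subtopology X (p ` U)) p"
    using assms by (auto simp: chart_def openin_open_subtopology)
  have "openin (subtopology X (p ` U)) (p ` V)"
    using h o(1) homeomorphic_imp_open_map open_map_def by blast
  then have "openin X (p ` V)"
    using o(3) openin_trans_full by blast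
  moreover have "homeomorphic_map (subtopology (subtopology Y U) V) (subtopology (subtopology X (p ` U)) (p ` V)) p"
    by (rule homeomorphic_map_subtopologies_alt[OF h])
      (use chart_inj[OF assms(1)] assms(3) in \<open>auto simp: inj_on_image_mem_iff\<close>)
  ultimately show ?thesis
    using assms by (simp add: chart_def subtopology_subtopology inf.absorb2 image_mono)
qed

lemma chart_continuous_map:
  assumes "chart Y X p U" shows "continuous_map (subtopology Y U) X p"
  using assms homeomorphic_imp_continuous_map[of "subtopology Y U" "subtopology X (p ` U)" p]
  by (simp add: chart_def continuous_map_in_subtopology)

lemma hom_induced_chart_iso:
  assumes c: "chart Y X p U" and y: "y \<in> U" and T1: "t1_space X"
  shows "chart_hom k Y U y X p
           \<in> iso (patch_homology k Y U y)
                 (relative_homology_group k X (topspace X - {p y}))"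
proof -
  have o: "openin Y U" "openin X (p ` U)"
    and h: "homeomorphic_map (subtopology Y U) (subtopology X (p ` U)) p"
    using c by (auto simp: chart_def)
  have im: "p ` (U - {y}) = p ` U - {p y}"
    using chart_inj[OF c] y by (auto simp: inj_on_def)
  have 1: "hom_induced k (subtopology Y U) (U - {y}) (subtopology X (p ` U)) (p ` U - {p y}) p
      \<in> iso (patch_homology k Y U y)
            (relative_homology_group k (subtopology X (p ` U)) (p ` U - {p y}))"
    by (rule homeomorphic_map_relative_homology_iso[OF h]) (use im openin_subset[OF o(1)] in auto)
  have py: "p y \<in> topspace X"
    using y o(2) openin_subset by blast
  have 2: "hom_induced k (subtopology X (p ` U)) (p ` U - {p y}) X (topspace X - {p y}) id
      \<in> iso (relative_homology_group k (subtopology X (p ` U)) (p ` U - {p y}))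
            (relative_homology_group k X (topspace X - {p y}))"
    using o(2) y py T1 by (intro hom_induced_excision_open) (auto simp: t1_space_closedin_singleton)
  have "hom_induced k (subtopology Y U) (U - {y}) X (topspace X - {p y}) (id \<circ> p)
     = hom_induced k (subtopology X (p ` U)) (p ` U - {p y}) X (topspace X - {p y}) id \<circ>
       hom_induced k (subtopology Y U) (U - {y}) (subtopology X (p ` U)) (p ` U - {p y}) p"
    using h im openin_subset[OF o(2)] py
    by (intro hom_induced_compose) (auto simp: homeomorphic_imp_continuous_map)
  with iso_set_trans[OF 1 2] show ?thesis
    by (simp add: o_def)
qed

lemma hom_induced_id_trans:
  assumes "openin Y U" "openin Y V" "V \<subseteq> U"
  shows "incl_hom k Y U y
           (hom_induced k (subtopology Y V) (V - {y}) (subtopology Y U) (U - {y}) id b)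
         = incl_hom k Y V y b"
proof -
  have "U \<subseteq> topspace Y" "continuous_map (subtopology Y V) (subtopology Y U) id"
    using assms openin_subset by (auto simp: continuous_map_in_subtopology)
  then show ?thesis
    using assms by (subst hom_induced_compose') auto
qed

text \<open>The choice of the chart does not matter: two charts at \<open>y\<close> contain a common smaller one. A class over
  the latter that is mapped to \<open>\<mu> (p y)\<close> is mapped to the given classes over both charts, because
  the maps from there to the local homology at \<open>p y\<close> are injective.\<close>

lemma induced_orientation_eqI:
  assumes T1: "t1_space X" and c: "chart Y X p U" and y: "y \<in> U"
    and a: "a \<in> carrier (patch_homology (int n) Y U y)"
    and pa: "chart_hom (int n) Y U y X p a = \<mu> (p y)"
  shows "induced_orientation n Y X p \<mu> y = incl_hom (int n) Y U y a"
  unfolding induced_orientation_def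
proof (rule the_equality)
  show "\<exists>V b. openin Y V \<and> y \<in> V \<and> openin X (p ` V) \<and>
      homeomorphic_map (subtopology Y V) (subtopology X (p ` V)) p \<and>
      b \<in> carrier (patch_homology (int n) Y V y) \<and>
      incl_hom (int n) Y V y b
        = incl_hom (int n) Y U y a \<and>
      chart_hom (int n) Y V y X p b = \<mu> (p y)"
    using c y a pa unfolding chart_def by blast
next
  fix \<nu>
  assume "\<exists>V b. openin Y V \<and> y \<in> V \<and> openin X (p ` V) \<and>
      homeomorphic_map (subtopology Y V) (subtopology X (p ` V)) p \<and>
      b \<in> carrier (patch_homology (int n) Y V y) \<and>
      incl_hom (int n) Y V y b = \<nu> \<and>
      chart_hom (int n) Y V y X p b = \<mu> (p y)"
  then obtain V b where V: "chart Y X p V" "y \<in> V"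
    and b: "b \<in> carrier (patch_homology (int n) Y V y)"
    and \<nu>: "incl_hom (int n) Y V y b = \<nu>"
    and pb: "chart_hom (int n) Y V y X p b = \<mu> (p y)"
    unfolding chart_def by blast
  let ?W = "U \<inter> V"
  have oUV: "openin Y U" "openin Y V" using c V unfolding chart_def by auto
  have W: "chart Y X p ?W" "openin Y ?W" using chart_subset[OF c, of ?W] oUV by auto
  have "\<mu> (p y) \<in> carrier (local_homology n X (p y))"
    using pa hom_in_carrier[OF hom_induced_hom a] by metis
  moreover have *: "chart_hom (int n) Y ?W y X p `
      carrier (patch_homology (int n) Y ?W y)
      = carrier (local_homology n X (p y))"
    using hom_induced_chart_iso[OF W(1) _ T1, of y "int n"] y V(2) by (simp add: iso_iff)
  ultimately have "\<mu> (p y) \<in> chart_hom (int n) Y ?W y X p `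
      carrier (patch_homology (int n) Y ?W y)"
    unfolding * by simp
  then obtain d where d: "d \<in> carrier (patch_homology (int n) Y ?W y)"
    and pd: "\<mu> (p y) = chart_hom (int n) Y ?W y X p d"
    by (rule imageE)
  have eq: "hom_induced (int n) (subtopology Y ?W) (?W - {y}) (subtopology Y U') (U' - {y}) id d = a'"
    if c': "chart Y X p U'" "y \<in> U'" "?W \<subseteq> U'"
      and a': "a' \<in> carrier (patch_homology (int n) Y U' y)"
        "chart_hom (int n) Y U' y X p a' = \<mu> (p y)"
    for U' a'
  proof -
    have I: "inj_on (chart_hom (int n) Y U' y X p)
       (carrier (patch_homology (int n) Y U' y))"
      using hom_induced_chart_iso[OF c'(1,2) T1] by (simp add: iso_iff)
    have J: "chart_hom (int n) Y U' y X p
       (hom_induced (int n) (subtopology Y ?W) (?W - {y}) (subtopology Y U') (U' - {y}) id d) = \<mu> (p y)"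
    proof -
      have "p \<in> (U' - {y}) \<rightarrow> (topspace X - {p y})"
        using chart_inj[OF c'(1)] c' openin_subset[of X "p ` U'"] by (auto simp: chart_def inj_on_def)
      moreover have "continuous_map (subtopology Y ?W) (subtopology Y U') id"
        using c'(3) by (auto simp: continuous_map_in_subtopology)
      ultimately show ?thesis
        using pd c'(3) chart_continuous_map[OF c'(1)] by (subst hom_induced_compose') auto
    qed
    show ?thesis
      by (rule inj_onD[OF I]) (simp_all add: J a' hom_in_carrier[OF hom_induced_hom d])
  qed
  show "\<nu> = incl_hom (int n) Y U y a"
    using eq[OF c y _ a pa] eq[OF V(1,2) _ b pb] hom_induced_id_trans[OF oUV(1) W(2), of "int n" y d]
      hom_induced_id_trans[OF oUV(2) W(2), of "int n" y d] \<nu> by simp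
qed

lemma singular_chain_subtopology_subtopology:
  assumes "singular_chain k (subtopology (subtopology X U) S) c" "S \<subseteq> T"
  shows "singular_chain k (subtopology X T) c"
  using assms singular_chain_mono[of k X "U \<inter> S" c T] by (auto simp: subtopology_subtopology)

text \<open>The images of the simplices of a chain are compact, hence closed in a Hausdorff space. Hence
  an equation between local classes at a point, which amounts to a boundary and such a chain, persists
  at all nearby points.\<close>

lemma singular_chain_avoids_nbhd:
  assumes "Hausdorff_space X" "x \<in> topspace X" "singular_chain k (subtopology X (topspace X - {x})) c"
  obtains V where "openin X V" "x \<in> V" "singular_chain k (subtopology X (topspace X - V)) c"
proof -
  let ?C = "\<Union>f\<in>Poly_Mapping.keys c. f ` standard_simplex k"
  have f: "singular_simplex k X f" "f ` standard_simplex k \<subseteq> topspace X - {x}" if "f \<in> Poly_Mapping.keys c" for f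
    using that assms(3) unfolding singular_chain_def
    by (auto simp: singular_simplex_subtopology dest!: subsetD)
  have "closedin X ?C"
  proof (intro closedin_Union ballI)
    fix T assume "T \<in> (\<lambda>f. f ` standard_simplex k) ` Poly_Mapping.keys c"
    then obtain g where g: "g \<in> Poly_Mapping.keys c" "T = g ` standard_simplex k" by blast
    then have "compactin X T"
      using f(1)[OF g(1)] unfolding singular_simplex_def
      by (auto intro!: image_compactin simp: compactin_subtopology compactin_standard_simplex)
    then show "closedin X T"
      using assms(1) compactin_imp_closedin by blast
  qed auto
  then have 1: "openin X (topspace X - ?C)" by blast
  have 2: "x \<in> topspace X - ?C"
    using f(2) assms(2) by blast
  have 3: "singular_chain k (subtopology X (topspace X - (topspace X - ?C))) c"
  proof -
    have "g ` standard_simplex k \<subseteq> topspace X - (topspace X - ?C)" if "g \<in> Poly_Mapping.keys c" for g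
    proof -
      have "g ` standard_simplex k \<subseteq> ?C" "g ` standard_simplex k \<subseteq> topspace X"
        using f(2)[OF that] UN_upper[OF that, of "\<lambda>f. f ` standard_simplex k"] by (meson Diff_subset subset_trans)+
      then show ?thesis
        by (simp only: Diff_Diff_Int le_inf_iff)
    qed
    then show ?thesis
      using assms(3) unfolding singular_chain_subtopology by meson
  qed
  show thesis
    by (rule that[OF 1 2 3])
qed

lemma orientation_local_chain:
  assumes "orientation n X \<mu>" "x \<in> topspace X"
  obtains U m where "openin X U" "x \<in> U" "singular_relcycle n X (topspace X - U) m"
    "\<And>y. y \<in> U \<Longrightarrow> \<mu> y = local_class n X y m"
proof -
  have "\<exists>U a. openin X U \<and> x \<in> U \<and> a \<in> carrier (relative_homology_group (int n) X (topspace X - U)) \<and>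
      (\<forall>y\<in>U. hom_induced (int n) X (topspace X - U) X (topspace X - {y}) id a = \<mu> y)"
    using assms by (simp add: orientation_def)
  then obtain U a where U: "openin X U" "x \<in> U"
    "a \<in> carrier (relative_homology_group (int n) X (topspace X - U))"
    "\<And>y. y \<in> U \<Longrightarrow> hom_induced (int n) X (topspace X - U) X (topspace X - {y}) id a = \<mu> y"
    by auto
  then obtain m where m: "singular_relcycle n X (topspace X - U) m" "a = homologous_rel_set n X (topspace X - U) m"
    by (auto simp: carrier_relative_homology_group)
  have "\<mu> y = local_class n X y m" if "y \<in> U" for y
    using U(4)[OF that] hom_induced_enlarge_subspace[OF m(1), of "topspace X - {y}"] that m(2) by auto
  then show thesis
    using that U m by blast
qed

text \<open>A relative cycle \<open>u\<close> that represents the induced orientation at \<open>y0\<close> also does so at nearby points: its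
  image differs from a chain \<open>m\<close> that represents \<open>\<mu>\<close> near \<open>p y0\<close> by a boundary and a chain \<open>e\<close>, and
  both \<open>e\<close> and the boundary of \<open>u\<close> avoid a neighbourhood.\<close>

lemma induced_orientation_local_chain:
  assumes H: "Hausdorff_space X" and \<mu>: "orientation n X \<mu>"
    and c: "chart Y X p U" and y0: "y0 \<in> U"
  obtains V u where "openin Y V" "y0 \<in> V" "singular_relcycle n Y (topspace Y - V) u"
    "\<And>y. y \<in> V \<Longrightarrow> induced_orientation n Y X p \<mu> y = local_class n Y y u"
proof -
  let ?x0 = "p y0"
  have T1: "t1_space X" using H Hausdorff_imp_t1_space by blast
  have oU: "openin Y U" "openin X (p ` U)" "U \<subseteq> topspace Y" using c openin_subset unfolding chart_def by blast+
  have x0: "?x0 \<in> topspace X" using oU(2) y0 openin_subset by blast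
  obtain U1 m where m: "openin X U1" "?x0 \<in> U1" "singular_relcycle n X (topspace X - U1) m"
    "\<And>x. x \<in> U1 \<Longrightarrow> \<mu> x = local_class n X x m"
    using orientation_local_chain[OF \<mu> x0] by blast
  have iso: "chart_hom n Y U y0 X p `
       carrier (patch_homology n Y U y0)
     = carrier (local_homology n X (p y0))"
    using hom_induced_chart_iso[OF c y0 T1] by (simp add: iso_iff)
  have "\<mu> ?x0 \<in> carrier (local_homology n X (p y0))"
    using \<mu> x0 by (simp add: orientation_def)
  then obtain a where a: "\<mu> ?x0 = chart_hom n Y U y0 X p a"
      "a \<in> carrier (patch_homology n Y U y0)"
    unfolding iso[symmetric] by (rule imageE)
  then obtain u where u: "singular_relcycle n (subtopology Y U) (U - {y0}) u"
    "a = homologous_rel_set n (subtopology Y U) (U - {y0}) u"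
    by (auto simp: carrier_relative_homology_group)
  have cp: "continuous_map (subtopology Y U) X p"
    by (rule chart_continuous_map[OF c])
  have pU: "p \<in> U - {y} \<rightarrow> topspace X - {p y}" if "y \<in> U" for y
    using chart_inj[OF c] that oU openin_subset[OF oU(2)] by (auto simp: inj_on_def)
  have "local_class n X ?x0 (chain_map n p u)
      = local_class n X ?x0 m"
    using a(1) m(2,4) unfolding u(2) hom_induced_chain_map[OF cp pU[OF y0] u(1)] by simp
  then have "homologous_rel n X (topspace X - {?x0}) (chain_map n p u) m"
    by (rule homologous_rel_set_eq[THEN iffD1])
  then have "singular_relboundary n X (topspace X - {?x0}) (chain_map n p u - m)"
    by (simp add: homologous_rel_def)
  then obtain d e where de: "singular_chain (Suc n) X d"
      "singular_chain n (subtopology X (topspace X - {?x0})) e"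
      "chain_boundary (Suc n) d + e = chain_map n p u - m"
    by (auto simp: singular_relboundary)
  obtain V1 where V1: "openin X V1" "?x0 \<in> V1" "singular_chain n (subtopology X (topspace X - V1)) e"
    using singular_chain_avoids_nbhd[OF H x0 de(2)] by blast
  have HU: "Hausdorff_space (subtopology Y U)"
  proof -
    have "subtopology Y U homeomorphic_space subtopology X (p ` U)"
      using c homeomorphic_map_imp_homeomorphic_space unfolding chart_def by blast
    then show ?thesis
      using H Hausdorff_space_subtopology homeomorphic_Hausdorff_space by blast
  qed
  have tU: "topspace (subtopology Y U) = U" using oU by auto
  have "singular_chain (n-1) (subtopology (subtopology Y U) (topspace (subtopology Y U) - {y0})) (chain_boundary n u)"
    using u(1) unfolding tU by (simp add: singular_relcycle)
  then obtain V2 where V2: "openin (subtopology Y U) V2" "y0 \<in> V2"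
      "singular_chain (n-1) (subtopology (subtopology Y U) (U - V2)) (chain_boundary n u)"
    using singular_chain_avoids_nbhd[OF HU, unfolded tU, OF y0] tU by auto
  define V where "V = V2 \<inter> {y \<in> topspace (subtopology Y U). p y \<in> U1 \<inter> V1}"
  have "openin (subtopology Y U) {y \<in> topspace (subtopology Y U). p y \<in> U1 \<inter> V1}"
    by (intro openin_continuous_map_preimage[OF cp] openin_Int m(1) V1(1))
  then have oV: "openin Y V" "V \<subseteq> U"
    using V2(1) oU(1) unfolding V_def by (auto simp: openin_open_subtopology)
  have u': "singular_chain n Y u"
    using u(1) by (simp add: singular_relcycle singular_chain_subtopology)
  show thesis
  proof (rule that[OF oV(1)])
    show "y0 \<in> V"
      using V2 m V1 y0 tU by (simp add: V_def)
    have "U - V2 \<subseteq> topspace Y - V" using oU V_def by auto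
    then show "singular_relcycle n Y (topspace Y - V) u"
      using u' singular_chain_subtopology_subtopology[OF V2(3)] by (simp add: singular_relcycle)
    show "induced_orientation n Y X p \<mu> y = local_class n Y y u"
      if y: "y \<in> V" for y
    proof -
      have yU: "y \<in> U" "y \<in> V2" "p y \<in> U1" "p y \<in> V1" using y oV V_def by auto
      have uy: "singular_relcycle n (subtopology Y U) (U - {y}) u"
        using u(1) singular_chain_mono[OF V2(3), of "U - {y}"] yU by (auto simp: singular_relcycle)
      let ?a = "homologous_rel_set n (subtopology Y U) (U - {y}) u"
      have "local_class n X (p y) (chain_map n p u)
          = local_class n X (p y) m"
      proof -
        have "singular_chain n (subtopology X (topspace X - {p y})) e"
          using singular_chain_mono[OF V1(3), of "topspace X - {p y}"] yU by auto
        then have "homologous_rel n X (topspace X - {p y}) (chain_map n p u) m"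
          using de(1,3) by (auto simp: homologous_rel_def singular_relboundary)
        then show ?thesis
          by (rule homologous_rel_set_eq[THEN iffD2])
      qed
      then have "chart_hom n Y U y X p ?a = \<mu> (p y)"
        unfolding hom_induced_chain_map[OF cp pU[OF yU(1)] uy] using m(4) yU by simp
      then have "induced_orientation n Y X p \<mu> y = incl_hom n Y U y ?a"
        by (intro induced_orientation_eqI[OF T1 c yU(1)]) (use uy homologous_rel_set_in_carrier in auto)
      also have "\<dots> = local_class n Y y u"
        by (rule hom_induced_inclusion[OF uy]) (use oU in auto)
      finally show ?thesis .
    qed
  qed
qed

lemma local_homology_iso_chart:
  assumes H: "Hausdorff_space Y" "Hausdorff_space X" and c: "chart Y X p U" and y: "y \<in> U"
  shows "local_homology n Y y \<cong> local_homology n X (p y)"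
proof -
  have T: "t1_space X" "t1_space Y" using H Hausdorff_imp_t1_space by blast+
  have oU: "openin Y U" using c by (simp add: chart_def)
  have yY: "y \<in> topspace Y" using oU y openin_subset by blast
  have "patch_homology n Y U y \<cong> local_homology n Y y"
    using hom_induced_excision_open[OF oU, of "{y}" "int n"] y yY T(2)
    by (auto simp: t1_space_closedin_singleton is_iso_def)
  moreover have "patch_homology n Y U y \<cong> local_homology n X (p y)"
    using hom_induced_chart_iso[OF c y T(1), of "int n"] by (auto simp: is_iso_def)
  ultimately show ?thesis
    using iso_trans group.iso_sym group_relative_homology_group by metis
qed

lemma infinite_local_homology_local_homeomorphism:
  assumes H: "Hausdorff_space Y" "Hausdorff_space X" and lh: "local_homeomorphism Y X p"
    and inf: "\<And>x. x \<in> topspace X \<Longrightarrow> infinite (carrier (local_homology n X x))"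
    and y: "y \<in> topspace Y"
  shows "infinite (carrier (local_homology n Y y))"
proof -
  obtain U where U: "y \<in> U" "chart Y X p U"
    using lh y by (auto simp: local_homeomorphism_def)
  then have "p y \<in> topspace X"
    using openin_subset[of X "p ` U"] by (auto simp: chart_def)
  then show ?thesis
    using iso_finite[OF local_homology_iso_chart[OF H U(2,1), of n]] inf by simp
qed

text \<open>Generators correspond to generators under the isomorphisms between \<open>H_n(Y, Y - {y})\<close>,
  \<open>H_n(U, U - {y})\<close> and \<open>H_n(X, X - {p y})\<close>, and \<open>induced_orientation_local_chain\<close> gives
  the local classes.\<close>

lemma orientation_induced_orientation:
  assumes H: "Hausdorff_space Y" "Hausdorff_space X" and \<mu>: "orientation n X \<mu>"
    and lh: "local_homeomorphism Y X p"
  shows "orientation n Y (induced_orientation n Y X p \<mu>)"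
proof -
  let ?\<nu> = "induced_orientation n Y X p \<mu>"
  have T: "t1_space X" "t1_space Y" using H Hausdorff_imp_t1_space by blast+
  have gen: "?\<nu> y \<in> carrier (local_homology n Y y) \<and>
     generate (local_homology n Y y) {?\<nu> y} = carrier (local_homology n Y y)" if y: "y \<in> topspace Y" for y
  proof -
    obtain U where U: "y \<in> U" "chart Y X p U"
      using lh y unfolding local_homeomorphism_def by auto
    have oU: "openin Y U" "openin X (p ` U)" using U(2) by (auto simp: chart_def)
    have py: "p y \<in> topspace X" using oU(2) U(1) openin_subset by blast
    let ?G = "patch_homology n Y U y"
    let ?i = "incl_hom n Y U y"
    let ?p = "chart_hom n Y U y X p"
    have i: "?i \<in> iso ?G (local_homology n Y y)"
      using U(1) y T(2) by (intro hom_induced_excision_open[OF oU(1)]) (auto simp: t1_space_closedin_singleton)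
    have p: "?p \<in> iso ?G (local_homology n X (p y))"
      by (rule hom_induced_chart_iso[OF U(2,1) T(1)])
    have \<mu>y: "\<mu> (p y) \<in> carrier (local_homology n X (p y))"
      "generate (local_homology n X (p y)) {\<mu> (p y)} = carrier (local_homology n X (p y))"
      using \<mu> py by (auto simp: orientation_def)
    from \<mu>y(1) have "\<mu> (p y) \<in> ?p ` carrier ?G" using p by (simp add: iso_iff)
    then obtain a where a: "\<mu> (p y) = ?p a" "a \<in> carrier ?G" by (rule imageE)
    have \<nu>: "?\<nu> y = ?i a"
      by (rule induced_orientation_eqI[where \<mu> = \<mu>, OF T(1) U(2,1) a(2) a(1)[symmetric]])
    have ghi: "group_hom ?G (local_homology n Y y) ?i" and ghp: "group_hom ?G (local_homology n X (p y)) ?p"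
      by (auto simp: group_hom_def group_hom_axioms_def hom_induced_hom)
    have ga: "generate ?G {a} \<subseteq> carrier ?G"
      using a(2) by (intro group.generate_incl) auto
    have "?p ` generate ?G {a} = ?p ` carrier ?G"
      using group_hom.generate_img[OF ghp, of "{a}"] a \<mu>y(2) p by (simp add: iso_iff)
    then have eq: "generate ?G {a} = carrier ?G"
      using inj_on_image_eq_iff[of ?p "carrier ?G" "generate ?G {a}" "carrier ?G"] p ga by (simp add: iso_iff)
    have "generate (local_homology n Y y) {?i a} = ?i ` generate ?G {a}"
      using group_hom.generate_img[OF ghi, of "{a}"] a(2) by simp
    also have "\<dots> = carrier (local_homology n Y y)"
      using i by (simp add: eq iso_iff)
    finally show ?thesis
      using hom_in_carrier[OF hom_induced_hom a(2), of Y "topspace Y - {y}" id] by (simp add: \<nu>)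
  qed
  have loc: "\<exists>V a. openin Y V \<and> y0 \<in> V \<and> a \<in> carrier (relative_homology_group n Y (topspace Y - V)) \<and>
      (\<forall>y\<in>V. hom_induced n Y (topspace Y - V) Y (topspace Y - {y}) id a = ?\<nu> y)"
    if y0: "y0 \<in> topspace Y" for y0
  proof -
    obtain U where U: "y0 \<in> U" "chart Y X p U"
      using lh y0 unfolding local_homeomorphism_def by auto
    obtain V u where V: "openin Y V" "y0 \<in> V" "singular_relcycle n Y (topspace Y - V) u"
      "\<And>y. y \<in> V \<Longrightarrow> ?\<nu> y = local_class n Y y u"
      by (rule induced_orientation_local_chain[OF H(2) \<mu> U(2,1)]) (rule that; assumption)
    have "hom_induced n Y (topspace Y - V) Y (topspace Y - {y}) id (homologous_rel_set n Y (topspace Y - V) u) = ?\<nu> y"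
      if "y \<in> V" for y
      unfolding V(4)[OF that] by (rule hom_induced_enlarge_subspace[OF V(3)]) (use that in auto)
    then show ?thesis
      using V(1,2) homologous_rel_set_in_carrier[OF V(3)]
      by (intro exI[of _ V] exI[of _ "homologous_rel_set n Y (topspace Y - V) u"]) simp
  qed
  show ?thesis
    unfolding orientation_def using gen loc by simp
qed

section \<open>The degree of a cycle\<close>

lemma homologous_rel_mono:
  assumes "homologous_rel n X S a b" "S \<subseteq> T"
  shows "homologous_rel n X T a b"
  using assms singular_chain_mono[of n X S _ T]
  by (auto simp: homologous_rel_def singular_relboundary)

lemma singular_relcycle_mono:
  assumes "singular_relcycle n X S c" "S \<subseteq> T"
  shows "singular_relcycle n X T c"
  using assms singular_chain_mono[of "n-1" X S _ T] by (auto simp: singular_relcycle)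

text \<open>If \<open>m\<close> represents the orientation near \<open>x\<close>, then \<open>w\<close> and \<open>d * m\<close> differ by a boundary and a chain that
  avoids \<open>x\<close>, and therefore a neighbourhood of \<open>x\<close>.\<close>

lemma local_degree_locally_constant:
  assumes H: "Hausdorff_space X" and \<mu>: "orientation n X \<mu>" and w: "singular_relcycle n X {} w"
    and x: "x \<in> topspace X"
    and d: "local_class n X x w = \<mu> x [^]\<^bsub>local_homology n X x\<^esub> (d::int)"
  obtains V where "openin X V" "x \<in> V"
    "\<And>y. y \<in> V \<Longrightarrow> local_class n X y w = \<mu> y [^]\<^bsub>local_homology n X y\<^esub> d"
proof -
  obtain U m where U: "openin X U" "x \<in> U" "singular_relcycle n X (topspace X - U) m"
    and m: "\<And>y. y \<in> U \<Longrightarrow> \<mu> y = local_class n X y m"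
    by (rule orientation_local_chain[OF \<mu> x]) (rule that; assumption)
  have my: "singular_relcycle n X (topspace X - {y}) m" if "y \<in> U" for y
    by (rule singular_relcycle_mono[OF U(3)]) (use that in auto)
  have pw: "\<mu> y [^]\<^bsub>local_homology n X y\<^esub> d = local_class n X y (frag_cmul d m)"
    if "y \<in> U" for y
    unfolding m[OF that] by (rule homologous_rel_set_int_pow[OF my[OF that]])
  have "homologous_rel n X (topspace X - {x}) w (frag_cmul d m)"
    using d unfolding pw[OF U(2)] by (rule homologous_rel_set_eq[THEN iffD1])
  then obtain c e where ce: "singular_chain (Suc n) X c" "singular_chain n (subtopology X (topspace X - {x})) e"
    "chain_boundary (Suc n) c + e = w - frag_cmul d m"
    by (auto simp: homologous_rel_def singular_relboundary)
  obtain V where V: "openin X V" "x \<in> V" "singular_chain n (subtopology X (topspace X - V)) e"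
    by (rule singular_chain_avoids_nbhd[OF H x ce(2)])
  show thesis
  proof (rule that[of "U \<inter> V"])
    fix y assume y: "y \<in> U \<inter> V"
    then have "singular_chain n (subtopology X (topspace X - {y})) e"
      by (intro singular_chain_mono[OF V(3)]) auto
    then have "homologous_rel n X (topspace X - {y}) w (frag_cmul d m)"
      using ce(1,3) by (auto simp: homologous_rel_def singular_relboundary)
    then have "local_class n X y w = local_class n X y (frag_cmul d m)"
      by (rule homologous_rel_set_eq[THEN iffD2])
    then show "local_class n X y w = \<mu> y [^]\<^bsub>local_homology n X y\<^esub> d"
      using y by (simp only: pw IntD1)
  qed (use U V in auto)
qed

lemma orientation_pow_inject:
  assumes \<mu>: "orientation n X \<mu>" and x: "x \<in> topspace X"
    and inf: "infinite (carrier (local_homology n X x))"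
    and eq: "\<mu> x [^]\<^bsub>local_homology n X x\<^esub> (i::int) = \<mu> x [^]\<^bsub>local_homology n X x\<^esub> (j::int)"
  shows "i = j"
proof -
  let ?G = "local_homology n X x"
  have g: "\<mu> x \<in> carrier ?G" "generate ?G {\<mu> x} = carrier ?G"
    using \<mu> x by (auto simp: orientation_def)
  then have "infinite (carrier (subgroup_generated ?G {\<mu> x}))"
    using inf by (simp add: carrier_subgroup_generated)
  then show ?thesis
    using group.infinite_cyclic_subgroup_int[OF group_relative_homology_group g(1)] eq by simp
qed

text \<open>The set of the points with a given degree is open, and degrees are unique as orientations have
  infinite order; so these sets partition the space into open sets.\<close>

lemma global_degree:
  assumes H: "Hausdorff_space X" and \<mu>: "orientation n X \<mu>" and w: "singular_relcycle n X {} w"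
    and conn: "connected_space X"
    and inf: "\<And>x. x \<in> topspace X \<Longrightarrow> infinite (carrier (local_homology n X x))"
  obtains d :: int where
    "\<And>x. x \<in> topspace X \<Longrightarrow> local_class n X x w = \<mu> x [^]\<^bsub>local_homology n X x\<^esub> d"
proof -
  let ?P = "\<lambda>x (d::int). local_class n X x w = \<mu> x [^]\<^bsub>local_homology n X x\<^esub> d"
  have ex: "\<exists>d. ?P x d" if x: "x \<in> topspace X" for x
  proof -
    have g: "\<mu> x \<in> carrier (local_homology n X x)"
      "generate (local_homology n X x) {\<mu> x} = carrier (local_homology n X x)"
      using \<mu> x by (auto simp: orientation_def)
    have "local_class n X x w \<in> carrier (local_homology n X x)"
      by (intro homologous_rel_set_in_carrier singular_relcycle_mono[OF w]) auto
    then show ?thesis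
      using group.generate_pow[OF group_relative_homology_group g(1)] g(2) by auto
  qed
  show thesis
  proof (cases "topspace X = {}")
    case True
    then show ?thesis using that by blast
  next
    case False
    then obtain x0 d where x0: "x0 \<in> topspace X" and d: "?P x0 d" using ex by blast
    define A where "A = {x \<in> topspace X. ?P x d}"
    define B where "B = {x \<in> topspace X. \<not> ?P x d}"
    have "openin X A"
    proof (subst openin_subopen, intro ballI)
      fix x assume "x \<in> A"
      then have x: "x \<in> topspace X" "?P x d" by (auto simp: A_def)
      obtain V where V: "openin X V" "x \<in> V" "\<And>y. y \<in> V \<Longrightarrow> ?P y d"
        by (rule local_degree_locally_constant[OF H \<mu> w x]) (rule that; assumption)
      then have "V \<subseteq> A" using openin_subset[OF V(1)] by (auto simp: A_def)
      with V show "\<exists>T. openin X T \<and> x \<in> T \<and> T \<subseteq> A" by auto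
    qed
    moreover have "openin X B"
    proof (subst openin_subopen, intro ballI)
      fix x assume "x \<in> B"
      then have x: "x \<in> topspace X" "\<not> ?P x d" by (auto simp: B_def)
      obtain d' where d': "?P x d'" using ex[OF x(1)] by auto
      have "\<exists>V. openin X V \<and> x \<in> V \<and> (\<forall>y\<in>V. \<not> ?P y d)"
      proof -
        obtain V where V: "openin X V" "x \<in> V" "\<And>y. y \<in> V \<Longrightarrow> ?P y d'"
          by (rule local_degree_locally_constant[OF H \<mu> w x(1) d']) (rule that; assumption)
        have "\<not> ?P y d" if y: "y \<in> V" for y
        proof
          assume P: "?P y d"
          have "y \<in> topspace X" using y openin_subset[OF V(1)] by auto
          then have "d = d'"
            using orientation_pow_inject[OF \<mu> _ inf, of y d d'] P V(3)[OF y] by simp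
          then show False using x(2) d' by simp
        qed
        then show ?thesis using V by auto
      qed
      then obtain V where V: "openin X V" "x \<in> V" "\<forall>y\<in>V. \<not> ?P y d" by auto
      then have "V \<subseteq> B" using openin_subset[OF V(1)] by (auto simp: B_def)
      with V show "\<exists>T. openin X T \<and> x \<in> T \<and> T \<subseteq> B" by auto
    qed
    moreover have "A \<inter> B = {}" "topspace X \<subseteq> A \<union> B" "A \<noteq> {}"
      using x0 d by (auto simp: A_def B_def)
    ultimately have "B = {}"
      using conn unfolding connected_space_def by blast
    then show ?thesis
      using that[of d] by (auto simp: B_def)
  qed
qed

section \<open>Fundamental cycles that lift to a covering\<close>

definition restrict_chain :: "nat \<Rightarrow> 'a set \<Rightarrow> 'a chain \<Rightarrow> 'a chain" where
  "restrict_chain k V = frag_extend (\<lambda>f. if f ` standard_simplex k \<subseteq> V then frag_of f else 0)"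

lemma restrict_chain_diff: "restrict_chain k V (a - b) = restrict_chain k V a - restrict_chain k V b"
  by (simp add: restrict_chain_def frag_extend_diff)

lemma restrict_chain_0 [simp]: "restrict_chain k V 0 = 0"
  by (simp add: restrict_chain_def)

lemma keys_restrict_chain:
  "Poly_Mapping.keys (restrict_chain k V c) \<subseteq> {f \<in> Poly_Mapping.keys c. f ` standard_simplex k \<subseteq> V}"
proof
  fix f assume "f \<in> Poly_Mapping.keys (restrict_chain k V c)"
  then obtain g where "g \<in> Poly_Mapping.keys c"
    "f \<in> Poly_Mapping.keys (if g ` standard_simplex k \<subseteq> V then frag_of g else 0)"
    using keys_frag_extend[of "\<lambda>f. if f ` standard_simplex k \<subseteq> V then frag_of f else 0" c]
    unfolding restrict_chain_def by auto
  then show "f \<in> {f \<in> Poly_Mapping.keys c. f ` standard_simplex k \<subseteq> V}"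
    by (auto split: if_splits)
qed

lemma keys_diff_restrict_chain:
  "Poly_Mapping.keys (c - restrict_chain k V c) \<subseteq> {f \<in> Poly_Mapping.keys c. \<not> f ` standard_simplex k \<subseteq> V}"
proof -
  let ?g = "\<lambda>f. if f ` standard_simplex k \<subseteq> V then 0 else frag_of f"
  have eq: "c - restrict_chain k V c = frag_extend ?g c"
    using subset_UNIV
  proof (induction c rule: frag_induction)
    case (diff a b)
    then show ?case by (simp add: restrict_chain_diff frag_extend_diff algebra_simps)
  qed (simp_all add: restrict_chain_def)
  have "Poly_Mapping.keys (?g f) \<subseteq> {h. h = f \<and> \<not> h ` standard_simplex k \<subseteq> V}" for f
    by auto
  then show ?thesis
    using keys_frag_extend[of ?g c] unfolding eq by fastforce
qed

lemma singular_chain_restrict_chain: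
  "singular_chain k X c \<Longrightarrow> singular_chain k (subtopology X V) (restrict_chain k V c)"
  unfolding singular_chain_def
  by (intro subset_trans[OF keys_restrict_chain]) (auto simp: singular_simplex_subtopology dest: subsetD)

text \<open>The faces of a simplex inside \<open>V\<close> lie inside \<open>V\<close>, and those of a simplex that is disjoint from \<open>V\<close> are
  non-empty and do not. This is applied to the sheets of a covering.\<close>

lemma chain_boundary_restrict_chain:
  assumes c: "singular_chain k X c"
    and V: "\<And>f. f \<in> Poly_Mapping.keys c \<Longrightarrow> f ` standard_simplex k \<subseteq> V \<or> f ` standard_simplex k \<inter> V = {}"
  shows "chain_boundary k (restrict_chain k V c) = restrict_chain (k - Suc 0) V (chain_boundary k c)"
proof (cases "k = 0")
  case True
  then show ?thesis by (simp add: chain_boundary_def)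
next
  case False
  let ?S = "{f. singular_simplex k X f \<and> (f ` standard_simplex k \<subseteq> V \<or> f ` standard_simplex k \<inter> V = {})}"
  have "Poly_Mapping.keys c \<subseteq> ?S"
    using c V by (auto simp: singular_chain_def)
  then show ?thesis
  proof (induction c rule: frag_induction)
    case zero
    then show ?case by simp
  next
    case (one f)
    have im: "singular_face k i f ` standard_simplex (k - Suc 0) \<subseteq> f ` standard_simplex k" if "i \<le> k" for i
      using that False simplical_face_in_standard_simplex[of k i] by (auto simp: singular_face_def)
    have r: "restrict_chain (k - Suc 0) V (chain_boundary k (frag_of f)) =
        (\<Sum>i\<le>k. frag_cmul ((-1) ^ i) (restrict_chain (k - Suc 0) V (frag_of (singular_face k i f))))"
      using False by (simp add: chain_boundary_of restrict_chain_def frag_extend_sum frag_extend_cmul o_def)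
    show ?case
    proof (cases "f ` standard_simplex k \<subseteq> V")
      case True
      then have "singular_face k i f ` standard_simplex (k - Suc 0) \<subseteq> V" if "i \<le> k" for i
        using im[OF that] by (rule subset_trans[rotated])
      then have "restrict_chain (k - Suc 0) V (chain_boundary k (frag_of f)) = chain_boundary k (frag_of f)"
        unfolding r using False by (simp add: chain_boundary_of restrict_chain_def)
      then show ?thesis using True by (simp add: restrict_chain_def)
    next
      case nV: False
      then have disj: "f ` standard_simplex k \<inter> V = {}" using one by auto
      have "\<not> singular_face k i f ` standard_simplex (k - Suc 0) \<subseteq> V" if "i \<le> k" for i
        using im[OF that] disj nonempty_standard_simplex[of "k - Suc 0"] by blast
      then have "restrict_chain (k - Suc 0) V (chain_boundary k (frag_of f)) = 0"
        unfolding r by (intro sum.neutral) (simp add: restrict_chain_def)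
      then show ?thesis using nV by (simp add: restrict_chain_def)
    qed
  next
    case (diff a b)
    then show ?case by (simp add: restrict_chain_diff chain_boundary_diff)
  qed
qed

lemma sum_restrict_chain:
  assumes "finite \<V>"
    and "\<And>f. f \<in> Poly_Mapping.keys c \<Longrightarrow> \<exists>!V. V \<in> \<V> \<and> f ` standard_simplex k \<subseteq> V"
  shows "(\<Sum>V\<in>\<V>. restrict_chain k V c) = c"
proof -
  let ?S = "{f. \<exists>!V. V \<in> \<V> \<and> f ` standard_simplex k \<subseteq> V}"
  have "Poly_Mapping.keys c \<subseteq> ?S" using assms(2) by (intro subsetI) simp
  then show ?thesis
  proof (induction c rule: frag_induction)
    case (one f)
    then have "\<exists>V. (V \<in> \<V> \<and> f ` standard_simplex k \<subseteq> V) \<and>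
        (\<forall>W. W \<in> \<V> \<and> f ` standard_simplex k \<subseteq> W \<longrightarrow> W = V)"
      unfolding Ex1_def by simp
    then obtain V where V: "(V \<in> \<V> \<and> f ` standard_simplex k \<subseteq> V) \<and>
        (\<forall>W. W \<in> \<V> \<and> f ` standard_simplex k \<subseteq> W \<longrightarrow> W = V)" by (rule exE)
    have "(\<Sum>W\<in>\<V>. restrict_chain k W (frag_of f)) = (\<Sum>W\<in>\<V>. if W = V then frag_of f else 0)"
      using V by (intro sum.cong) (auto simp: restrict_chain_def)
    then show ?case using assms(1) V by simp
  qed (simp_all add: restrict_chain_diff sum_subtractf)
qed

definition evenly_covered :: "'b topology \<Rightarrow> 'a topology \<Rightarrow> ('b \<Rightarrow> 'a) \<Rightarrow> 'a set \<Rightarrow> 'b set set \<Rightarrow> bool" where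
  "evenly_covered E B q U \<V> \<longleftrightarrow> openin B U \<and> pairwise disjnt \<V> \<and>
     \<Union>\<V> = {e \<in> topspace E. q e \<in> U} \<and> (\<forall>V\<in>\<V>. chart E B q V \<and> q ` V = U)"

definition covering_map :: "'b topology \<Rightarrow> 'a topology \<Rightarrow> ('b \<Rightarrow> 'a) \<Rightarrow> bool" where
  "covering_map E B q \<longleftrightarrow> continuous_map E B q \<and>
     (\<forall>b\<in>topspace B. \<exists>U \<V>. b \<in> U \<and> evenly_covered E B q U \<V>)"

lemma covering_map_evenly_covered:
  assumes "covering_map E B q" "b \<in> topspace B"
  obtains U \<V> where "b \<in> U" "evenly_covered E B q U \<V>"
  using assms unfolding covering_map_def by auto

lemma covering_map_local_homeomorphism:
  assumes "covering_map E B q" shows "local_homeomorphism E B q"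
  unfolding local_homeomorphism_def
proof
  fix e assume e: "e \<in> topspace E"
  then have "q e \<in> topspace B"
    using assms continuous_map_image_subset_topspace[of E B q] by (auto simp: covering_map_def)
  then obtain U \<V> where U: "q e \<in> U" "evenly_covered E B q U \<V>"
    by (rule covering_map_evenly_covered[OF assms])
  then have "e \<in> \<Union>\<V>" using e by (auto simp: evenly_covered_def)
  then show "\<exists>V. e \<in> V \<and> chart E B q V"
    using U(2) by (auto simp: evenly_covered_def)
qed

text \<open>Points of the same fibre are separated by their sheets, other points by preimages of open sets.\<close>

lemma covering_map_Hausdorff:
  assumes cov: "covering_map E B q" and H: "Hausdorff_space B"
  shows "Hausdorff_space E"
  unfolding Hausdorff_space_def
proof (intro allI impI, elim conjE)
  fix x y assume x: "x \<in> topspace E" and y: "y \<in> topspace E" and ne: "x \<noteq> y"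
  have cont: "continuous_map E B q" using cov by (simp add: covering_map_def)
  then have qx: "q x \<in> topspace B" and qy: "q y \<in> topspace B"
    using x y continuous_map_image_subset_topspace[OF cont] by auto
  show "\<exists>U V. openin E U \<and> openin E V \<and> x \<in> U \<and> y \<in> V \<and> disjnt U V"
  proof (cases "q x = q y")
    case False
    then obtain U V where UV: "openin B U" "openin B V" "q x \<in> U" "q y \<in> V" "disjnt U V"
      using H qx qy unfolding Hausdorff_space_def by meson
    let ?U = "{e \<in> topspace E. q e \<in> U}" and ?V = "{e \<in> topspace E. q e \<in> V}"
    have "openin E ?U" "openin E ?V"
      by (rule openin_continuous_map_preimage[OF cont]; fact)+
    moreover have "disjnt ?U ?V" using UV(5) by (auto simp: disjnt_iff)
    ultimately show ?thesis using UV x y by blast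
  next
    case True
    obtain U \<V> where U: "q x \<in> U" "evenly_covered E B q U \<V>"
      using qx by (rule covering_map_evenly_covered[OF cov])
    then have "x \<in> \<Union>\<V>" "y \<in> \<Union>\<V>" using x y True by (auto simp: evenly_covered_def)
    then obtain V W where VW: "V \<in> \<V>" "x \<in> V" "W \<in> \<V>" "y \<in> W" by auto
    have ch: "chart E B q V" "chart E B q W" using U(2) VW by (auto simp: evenly_covered_def)
    have "V \<noteq> W"
      using chart_inj[OF ch(1)] VW True ne by (auto dest: inj_onD)
    then have "disjnt V W"
      using U(2) VW by (auto simp: evenly_covered_def pairwise_def)
    then show ?thesis
      using VW ch by (auto simp: chart_def)
  qed
qed

text \<open>Otherwise a sheet that meets \<open>C\<close> and the union of the other ones would disconnect \<open>C\<close>.\<close>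

lemma connectedin_in_unique_sheet:
  assumes C: "connectedin X C" "C \<noteq> {}" "C \<subseteq> \<Union>\<V>"
    and \<V>: "pairwise disjnt \<V>" "\<And>V. V \<in> \<V> \<Longrightarrow> openin X V"
  shows "\<exists>!V. V \<in> \<V> \<and> C \<subseteq> V"
proof -
  obtain x V where x: "x \<in> C" "x \<in> V" "V \<in> \<V>" using C(2,3) by blast
  have CV: "C \<subseteq> V"
  proof (rule ccontr)
    assume "\<not> C \<subseteq> V"
    let ?W = "\<Union>(\<V> - {V})"
    have o: "openin X ?W" using \<V>(2) by (intro openin_Union) auto
    have 1: "V \<inter> ?W \<inter> C = {}" using \<V>(1) x(3) by (auto simp: pairwise_def disjnt_iff)
    have 2: "C \<subseteq> V \<union> ?W" using C(3) by auto
    have 3: "V \<inter> C \<noteq> {}" using x by auto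
    have 4: "?W \<inter> C \<noteq> {}" using \<open>\<not> C \<subseteq> V\<close> C(3) by auto
    have "\<nexists>E1 E2. openin X E1 \<and> openin X E2 \<and> C \<subseteq> E1 \<union> E2 \<and>
        E1 \<inter> E2 \<inter> C = {} \<and> E1 \<inter> C \<noteq> {} \<and> E2 \<inter> C \<noteq> {}"
      using C(1) unfolding connectedin by (rule conjunct2)
    then show False
      by (rule notE) (intro exI[of _ V] exI[of _ ?W] conjI \<V>(2)[OF x(3)] o 1 2 3 4)
  qed
  have uq: "W = V" if "W \<in> \<V>" "C \<subseteq> W" for W
  proof (rule ccontr)
    assume "W \<noteq> V"
    then have "disjnt W V" using \<V>(1) that(1) x(3) by (auto simp: pairwise_def)
    then show False using that(2) x by (auto simp: disjnt_iff)
  qed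
  show ?thesis
  proof (rule ex1I[of _ V])
    show "V \<in> \<V> \<and> C \<subseteq> V" using x(3) CV by (rule conjI)
    show "W = V" if "W \<in> \<V> \<and> C \<subseteq> W" for W
      using that by (elim conjE) (rule uq)
  qed
qed

lemma singular_simplex_connectedin_image:
  assumes "singular_simplex k X f" shows "connectedin X (f ` standard_simplex k)"
proof -
  let ?D = "subtopology (powertop_real UNIV) (standard_simplex k)"
  have "continuous_map ?D X f" using assms by (simp add: singular_simplex_def)
  moreover have "connectedin ?D (standard_simplex k)"
    by (simp add: connectedin_subtopology connectedin_standard_simplex)
  ultimately show ?thesis by (rule connectedin_continuous_map_image)
qed

text \<open>One class \<open>a\<close> in \<open>H_n(V, V - {e})\<close> corresponds both to the induced orientation at \<open>e\<close> and to the orientation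
  at \<open>q e\<close>. So if \<open>u\<close> represents a multiple of the one, its image represents the same multiple of
  the other.\<close>

lemma covering_sheet_degree:
  assumes H: "Hausdorff_space E" "Hausdorff_space B" and \<nu>: "orientation n B \<nu>"
    and c: "chart E B q V" and e: "e \<in> V"
    and u: "singular_relcycle n (subtopology E V) (V - {e}) u"
    and d: "local_class n E e u
              = induced_orientation n E B q \<nu> e [^]\<^bsub>local_homology n E e\<^esub> (d::int)"
  shows "local_class n B (q e) (chain_map n q u) = \<nu> (q e) [^]\<^bsub>local_homology n B (q e)\<^esub> d"
proof -
  have T: "t1_space B" "t1_space E" using H Hausdorff_imp_t1_space by blast+
  have oV: "openin E V" "openin B (q ` V)" using c by (auto simp: chart_def)
  have sV: "V \<subseteq> topspace E" "q ` V \<subseteq> topspace B" using oV openin_subset by auto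
  let ?G = "patch_homology n E V e"
  let ?i = "incl_hom n E V e"
  let ?q = "chart_hom n E V e B q"
  have i: "?i \<in> iso ?G (local_homology n E e)"
    using e sV T(2) by (intro hom_induced_excision_open[OF oV(1)]) (auto simp: t1_space_closedin_singleton)
  have q: "?q \<in> iso ?G (local_homology n B (q e))"
    by (rule hom_induced_chart_iso[OF c e T(1)])
  have "\<nu> (q e) \<in> carrier (local_homology n B (q e))"
    using \<nu> e sV by (auto simp: orientation_def)
  then have "\<nu> (q e) \<in> ?q ` carrier ?G" using q by (simp add: iso_iff)
  then obtain a where a: "\<nu> (q e) = ?q a" "a \<in> carrier ?G" by (rule imageE)
  have ia: "induced_orientation n E B q \<nu> e = ?i a"
    by (rule induced_orientation_eqI[where \<mu> = \<nu>, OF T(1) c e a(2) a(1)[symmetric]])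
  have grp: "group ?G" "group (local_homology n E e)" "group (local_homology n B (q e))" by auto
  let ?u = "homologous_rel_set n (subtopology E V) (V - {e}) u"
  have uc: "?u \<in> carrier ?G" by (rule homologous_rel_set_in_carrier[OF u])
  have iu: "?i ?u = local_class n E e u"
    by (rule hom_induced_inclusion[OF u]) (use sV in auto)
  have "?i ?u = ?i a [^]\<^bsub>local_homology n E e\<^esub> d"
    using iu d ia by simp
  also have "\<dots> = ?i (a [^]\<^bsub>?G\<^esub> d)"
    using hom_int_pow[OF hom_induced_hom a(2) grp(1,2)] by simp
  finally have "?u = a [^]\<^bsub>?G\<^esub> d"
    using i a(2) uc group.int_pow_closed[OF grp(1) a(2)] by (auto simp: iso_iff dest: inj_onD)
  then have "?q ?u = \<nu> (q e) [^]\<^bsub>local_homology n B (q e)\<^esub> d"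
    using hom_int_pow[OF hom_induced_hom a(2) grp(1,3)] a(1) by simp
  moreover have "q \<in> V - {e} \<rightarrow> topspace B - {q e}"
    using chart_inj[OF c] e sV by (auto simp: inj_on_def)
  then have "?q ?u = local_class n B (q e) (chain_map n q u)"
    using hom_induced_chain_map[OF chart_continuous_map[OF c] _ u] by simp
  ultimately show ?thesis by simp
qed

text \<open>This is the fact that a covering of degree one is injective, where the degree is seen on a cycle of
  \<open>E\<close>; \<open>E\<close> may be non-compact. Two points over the same point \<open>b\<close> would
  give rise to a finite set of at least two sheets over \<open>b\<close> that contains all sheets that
  \<open>w\<close> meets near that fibre. As \<open>w\<close> has degree \<open>d\<close> in each of them, this contradicts total degree one.\<close>

theorem covering_map_inj_on_if_fundamental_cycle_lifts:
  assumes cov: "covering_map E B q" and HB: "Hausdorff_space B" and conn: "connected_space E"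
    and \<nu>: "orientation n B \<nu>"
    and inf: "\<And>b. b \<in> topspace B \<Longrightarrow> infinite (carrier (local_homology n B b))"
    and w: "singular_relcycle n E {} w" and fund: "fundamental_cycle n B \<nu> (chain_map n q w)"
  shows "inj_on q (topspace E)"
proof (rule inj_onI, rule ccontr)
  fix e1 e2 assume e1: "e1 \<in> topspace E" and e2: "e2 \<in> topspace E" and qe: "q e1 = q e2" and ne: "e1 \<noteq> e2"
  have HE: "Hausdorff_space E" by (rule covering_map_Hausdorff[OF cov HB])
  have lh: "local_homeomorphism E B q" by (rule covering_map_local_homeomorphism[OF cov])
  have cont: "continuous_map E B q" using cov by (simp add: covering_map_def)
  have qE: "q e \<in> topspace B" if "e \<in> topspace E" for e
    using continuous_map_image_subset_topspace[OF cont] that by auto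
  let ?\<epsilon> = "induced_orientation n E B q \<nu>"
  have \<epsilon>: "orientation n E ?\<epsilon>" by (rule orientation_induced_orientation[OF HE HB \<nu> lh])
  have infE: "infinite (carrier (local_homology n E e))" if e: "e \<in> topspace E" for e
    by (rule infinite_local_homology_local_homeomorphism[OF HE HB lh inf e])
  obtain d :: int where d: "\<And>e. e \<in> topspace E \<Longrightarrow>
      local_class n E e w = ?\<epsilon> e [^]\<^bsub>local_homology n E e\<^esub> d"
    by (rule global_degree[OF HE \<epsilon> w conn infE]) (assumption, (rule that; assumption))
  define b where "b = q e1"
  have b: "b \<in> topspace B" using e1 qE by (simp add: b_def)
  obtain U \<V> where bU: "b \<in> U" and ev: "evenly_covered E B q U \<V>"
    using b by (rule covering_map_evenly_covered[OF cov])
  have disj: "pairwise disjnt \<V>" and U\<V>: "\<Union>\<V> = {e \<in> topspace E. q e \<in> U}"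
    and ch: "\<And>V. V \<in> \<V> \<Longrightarrow> chart E B q V" and qV: "\<And>V. V \<in> \<V> \<Longrightarrow> q ` V = U"
    using ev by (auto simp: evenly_covered_def)
  have oV: "openin E V" if "V \<in> \<V>" for V using ch[OF that] by (simp add: chart_def)
  let ?W = "\<Union>\<V>"
  let ?F = "{e \<in> topspace E. q e = b}"
  have oW: "openin E ?W" by (intro openin_Union oV)
  have clF: "closedin E ?F"
  proof -
    have "closedin B {b}" using Hausdorff_imp_t1_space[OF HB] b by (simp add: t1_space_closedin_singleton)
    then show ?thesis using closedin_continuous_map_preimage[OF cont, of "{b}"] by simp
  qed
  have FW: "?F \<subseteq> ?W" using U\<V> bU by auto
  \<comment> \<open>By excision, \<open>w\<close> is represented, relative to the complement of the fibre, by a chain \<open>u\<close> in the sheets.\<close>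
  have wF: "singular_relcycle n E (topspace E - ?F) w"
    by (rule singular_relcycle_mono[OF w]) auto
  have "hom_induced n (subtopology E ?W) (?W - ?F) E (topspace E - ?F) id `
      carrier (relative_homology_group n (subtopology E ?W) (?W - ?F))
      = carrier (relative_homology_group n E (topspace E - ?F))"
    using hom_induced_excision_open[OF oW clF FW, of "int n"] by (simp add: iso_iff)
  then have "homologous_rel_set n E (topspace E - ?F) w \<in> hom_induced n (subtopology E ?W) (?W - ?F) E (topspace E - ?F) id `
      carrier (relative_homology_group n (subtopology E ?W) (?W - ?F))"
    using homologous_rel_set_in_carrier[OF wF] by simp
  then obtain a where a: "homologous_rel_set n E (topspace E - ?F) w = hom_induced n (subtopology E ?W) (?W - ?F) E (topspace E - ?F) id a"
    "a \<in> carrier (relative_homology_group n (subtopology E ?W) (?W - ?F))" by (rule imageE)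
  then obtain u where u: "singular_relcycle n (subtopology E ?W) (?W - ?F) u"
    "a = homologous_rel_set n (subtopology E ?W) (?W - ?F) u"
    by (auto simp: carrier_relative_homology_group)
  have uE: "singular_chain n E u" and uW: "\<And>f. f \<in> Poly_Mapping.keys u \<Longrightarrow> f ` standard_simplex n \<subseteq> ?W"
    using u(1) by (auto simp: singular_relcycle singular_chain_subtopology)
  have bu: "singular_chain (n - 1) (subtopology E ?W) (chain_boundary n u)"
     "\<And>f. f \<in> Poly_Mapping.keys (chain_boundary n u) \<Longrightarrow> f ` standard_simplex (n - 1) \<subseteq> ?W - ?F"
    using u(1) by (auto simp: singular_relcycle singular_chain_subtopology)
  have wu: "homologous_rel n E (topspace E - ?F) w u"
  proof -
    have "?W - ?F \<subseteq> topspace E - ?F" using openin_subset[OF oW] by auto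
    then have "homologous_rel_set n E (topspace E - ?F) w = homologous_rel_set n E (topspace E - ?F) u"
      using a(1) hom_induced_inclusion[OF u(1)] u(2) by simp
    then show ?thesis by (rule homologous_rel_set_eq[THEN iffD1])
  qed
  have uniq: "\<exists>!V. V \<in> \<V> \<and> f ` standard_simplex n \<subseteq> V" if f: "f \<in> Poly_Mapping.keys u" for f
  proof (rule connectedin_in_unique_sheet[OF _ _ uW[OF f] disj oV])
    show "connectedin E (f ` standard_simplex n)"
      using uE f by (intro singular_simplex_connectedin_image) (auto simp: singular_chain_def)
    show "f ` standard_simplex n \<noteq> {}" using nonempty_standard_simplex by simp
  qed auto
  obtain m where m: "singular_relcycle n B (topspace B - {b}) m" "\<nu> b = local_class n B b m"
  proof -
    have "\<nu> b \<in> carrier (local_homology n B b)" using \<nu> b by (simp add: orientation_def)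
    then show thesis using that by (auto simp: carrier_relative_homology_group)
  qed
  \<comment> \<open>Each sheet contributes \<open>d\<close> times the orientation, even if \<open>u\<close> has no simplices in it.\<close>
  have sheet: "homologous_rel n B (topspace B - {b}) (chain_map n q (restrict_chain n V u)) (frag_cmul d m)"
    if V: "V \<in> \<V>" for V
  proof -
    let ?u = "restrict_chain n V u"
    have "b \<in> q ` V" using qV[OF V] bU by simp
    then obtain e where e: "e \<in> V" "q e = b" by auto
    have eE: "e \<in> topspace E" using e(1) openin_subset[OF oV[OF V]] by auto
    have VF: "V - ?F = V - {e}"
      using chart_inj[OF ch[OF V]] e openin_subset[OF oV[OF V]] by (auto simp: inj_on_def)
    have uV: "singular_chain n (subtopology E V) ?u" by (rule singular_chain_restrict_chain[OF uE])
    have inout: "f ` standard_simplex n \<subseteq> V \<or> f ` standard_simplex n \<inter> V = {}" if f: "f \<in> Poly_Mapping.keys u" for f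
    proof -
      obtain V' where V': "V' \<in> \<V>" "f ` standard_simplex n \<subseteq> V'" using uniq[OF f] by auto
      show ?thesis
      proof (cases "V' = V")
        case False
        then have "V' \<inter> V = {}" using disj V V'(1) by (simp add: pairwise_def disjnt_def)
        then show ?thesis using V'(2) by blast
      qed (use V'(2) in simp)
    qed
    then have bd: "chain_boundary n ?u = restrict_chain (n - 1) V (chain_boundary n u)"
      using chain_boundary_restrict_chain[OF uE] by simp
    have "singular_chain (n - 1) (subtopology (subtopology E V) (V - {e})) (chain_boundary n ?u)"
      unfolding singular_chain_subtopology
    proof (intro conjI ballI)
      show "singular_chain (n - 1) E (chain_boundary n ?u)"
        using singular_chain_boundary[OF uV] by (simp add: singular_chain_subtopology)
      fix f assume "f \<in> Poly_Mapping.keys (chain_boundary n ?u)"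
      then have "f \<in> Poly_Mapping.keys (chain_boundary n u)" "f ` standard_simplex (n - 1) \<subseteq> V"
        using keys_restrict_chain[of "n-1" V "chain_boundary n u"] unfolding bd by auto
      then show "f ` standard_simplex (n - 1) \<subseteq> V" "f ` standard_simplex (n - 1) \<subseteq> V - {e}"
        using bu(2)[of f] VF by auto
    qed
    then have rc: "singular_relcycle n (subtopology E V) (V - {e}) ?u"
      using uV by (simp add: singular_relcycle)
    have "homologous_rel n E (topspace E - {e}) w u"
      by (rule homologous_rel_mono[OF wu]) (use e eE in auto)
    moreover have "homologous_rel n E (topspace E - {e}) u ?u"
    proof -
      have "singular_chain n (subtopology E (topspace E - {e})) (u - ?u)"
        unfolding singular_chain_subtopology
      proof (intro conjI ballI)
        show "singular_chain n E (u - ?u)"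
          using uE uV by (intro singular_chain_diff) (auto simp: singular_chain_subtopology)
        fix f assume "f \<in> Poly_Mapping.keys (u - ?u)"
        then have f: "f \<in> Poly_Mapping.keys u" "\<not> f ` standard_simplex n \<subseteq> V"
          using keys_diff_restrict_chain[of u n V] by auto
        then have "f ` standard_simplex n \<inter> V = {}" using inout by auto
        moreover have "f ` standard_simplex n \<subseteq> topspace E"
          using uW[OF f(1)] openin_subset[OF oW] by (rule subset_trans)
        ultimately show "f ` standard_simplex n \<subseteq> topspace E - {e}" using e(1) by auto
      qed
      then show ?thesis
        unfolding homologous_rel_def by (rule singular_chain_imp_relboundary)
    qed
    ultimately have "homologous_rel n E (topspace E - {e}) w ?u"
      by (rule homologous_rel_trans[rotated])
    then have "local_class n E e w = local_class n E e ?u"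
      by (rule homologous_rel_set_eq[THEN iffD2])
    then have "local_class n E e ?u = ?\<epsilon> e [^]\<^bsub>local_homology n E e\<^esub> d"
      using d[OF eE] by simp
    then have "local_class n B (q e) (chain_map n q ?u) = \<nu> (q e) [^]\<^bsub>local_homology n B (q e)\<^esub> d"
      by (rule covering_sheet_degree[OF HE HB \<nu> ch[OF V] e(1) rc])
    then have "local_class n B b (chain_map n q ?u) = local_class n B b (frag_cmul d m)"
      unfolding e(2) m(2) homologous_rel_set_int_pow[OF m(1)] .
    then show ?thesis by (rule homologous_rel_set_eq[THEN iffD1])
  qed
  have "e1 \<in> ?W" "e2 \<in> ?W" using e1 e2 qe bU U\<V> by (auto simp: b_def)
  then obtain V1 V2 where V12: "V1 \<in> \<V>" "e1 \<in> V1" "V2 \<in> \<V>" "e2 \<in> V2" by auto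
  have V12ne: "V1 \<noteq> V2"
    using chart_inj[OF ch[OF V12(1)]] V12 qe ne by (auto dest: inj_onD)
  define sh where "sh f = (THE V. V \<in> \<V> \<and> f ` standard_simplex n \<subseteq> V)" for f
  have sh: "sh f \<in> \<V> \<and> f ` standard_simplex n \<subseteq> sh f" if "f \<in> Poly_Mapping.keys u" for f
    unfolding sh_def by (rule theI'[OF uniq[OF that]])
  \<comment> \<open>The sheets of \<open>e1\<close> and \<open>e2\<close> are included to have at least two of them.\<close>
  define \<V>0 where "\<V>0 = sh ` Poly_Mapping.keys u \<union> {V1, V2}"
  have fin: "finite \<V>0" by (simp add: \<V>0_def)
  have sub: "\<V>0 \<subseteq> \<V>" using sh V12 by (auto simp: \<V>0_def)
  have "u = (\<Sum>V\<in>\<V>0. restrict_chain n V u)"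
  proof (rule sum_restrict_chain[OF fin, symmetric])
    fix f assume f: "f \<in> Poly_Mapping.keys u"
    show "\<exists>!V. V \<in> \<V>0 \<and> f ` standard_simplex n \<subseteq> V"
    proof (rule ex1I[of _ "sh f"])
      show "sh f \<in> \<V>0 \<and> f ` standard_simplex n \<subseteq> sh f" using sh[OF f] f by (simp add: \<V>0_def)
      show "V = sh f" if "V \<in> \<V>0 \<and> f ` standard_simplex n \<subseteq> V" for V
        using uniq[OF f] sh[OF f] that sub by auto
    qed
  qed
  then have "chain_map n q u = (\<Sum>V\<in>\<V>0. chain_map n q (restrict_chain n V u))"
    using chain_map_sum[OF fin, of n q "\<lambda>V. restrict_chain n V u"] by (simp add: o_def)
  moreover have "homologous_rel n B (topspace B - {b}) (\<Sum>V\<in>\<V>0. chain_map n q (restrict_chain n V u)) (\<Sum>V\<in>\<V>0. frag_cmul d m)"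
    using fin sub sheet by (intro homologous_rel_sum) auto
  moreover have "(\<Sum>V\<in>\<V>0. frag_cmul d m) = frag_cmul (int (card \<V>0) * d) m"
  proof -
    have "(\<Sum>V\<in>S. frag_cmul d m) = frag_cmul (int (card S) * d) m" if "finite S" for S :: "'a set set"
      using that by induction (simp_all add: frag_cmul_distrib[symmetric] algebra_simps)
    then show ?thesis using fin .
  qed
  ultimately have 1: "homologous_rel n B (topspace B - {b}) (chain_map n q u) (frag_cmul (int (card \<V>0) * d) m)"
    by simp
  have "q \<in> topspace E - ?F \<rightarrow> topspace B - {b}" using qE by auto
  then have "singular_relboundary n B (topspace B - {b}) (chain_map n q (w - u))"
    using wu singular_relboundary_chain_map[OF _ cont] by (simp add: homologous_rel_def)
  then have 2: "homologous_rel n B (topspace B - {b}) (chain_map n q w) (chain_map n q u)"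
    by (simp add: homologous_rel_def chain_map_diff)
  have qw: "singular_relcycle n B {} (chain_map n q w)"
    and fc: "is_fundamental_class n B \<nu> (homologous_rel_set n B {} (chain_map n q w))"
    using fund by (auto simp: fundamental_cycle_def)
  have "hom_induced n B {} B (topspace B - {b}) id (homologous_rel_set n B {} (chain_map n q w))
      = local_class n B b (chain_map n q w)"
    by (rule hom_induced_enlarge_subspace[OF qw]) simp
  then have "local_class n B b (chain_map n q w) = local_class n B b m"
    using bspec[OF conjunct2[OF fc[unfolded is_fundamental_class_def]] b] m(2) by (simp only:)
  then have 3: "homologous_rel n B (topspace B - {b}) (chain_map n q w) m"
    by (rule homologous_rel_set_eq[THEN iffD1])
  have "homologous_rel n B (topspace B - {b}) m (frag_cmul (int (card \<V>0) * d) m)"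
    by (rule homologous_rel_trans[OF homologous_rel_trans[OF 1 2] 3[unfolded homologous_rel_sym[of _ _ _ _ m]]])
  then have "local_class n B b (frag_cmul 1 m) = local_class n B b (frag_cmul (int (card \<V>0) * d) m)"
    unfolding frag_cmul_one by (rule homologous_rel_set_eq[THEN iffD2])
  then have "\<nu> b [^]\<^bsub>local_homology n B b\<^esub> (1::int) = \<nu> b [^]\<^bsub>local_homology n B b\<^esub> (int (card \<V>0) * d)"
    unfolding m(2) homologous_rel_set_int_pow[OF m(1)] .
  then have "1 = int (card \<V>0) * d"
    by (rule orientation_pow_inject[OF \<nu> b inf[OF b]])
  then have "card \<V>0 = 1"
    using zmult_eq_1_iff[of "int (card \<V>0)" d] by simp
  moreover have "card {V1, V2} \<le> card \<V>0"
    by (rule card_mono[OF fin]) (simp add: \<V>0_def)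
  ultimately show False
    using V12ne by simp
qed

section \<open>The universal covering\<close>

text \<open>The basic open sets in the definition of the universal covering.\<close>

definition cover_basic :: "'a topology \<Rightarrow> (real \<Rightarrow> 'a) \<Rightarrow> 'a set \<Rightarrow> (real \<Rightarrow> 'a) set set" where
  "cover_basic X p U = {path_class X (path_join p d) | d. pathin (subtopology X U) d \<and> d 0 = p 1}"

lemma cover_basicI:
  "pathin (subtopology X U) d \<Longrightarrow> d 0 = p 1 \<Longrightarrow> path_class X (path_join p d) \<in> cover_basic X p U"
  by (auto simp: cover_basic_def)

lemma cover_basicE:
  assumes "\<xi> \<in> cover_basic X p U"
  obtains d where "pathin (subtopology X U) d" "d 0 = p 1" "\<xi> = path_class X (path_join p d)"
  using assms by (auto simp: cover_basic_def)

lemma cover_basic_self: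
  assumes "pathin X p" "p 1 \<in> U"
  shows "path_class X p \<in> cover_basic X p U"
proof -
  have "pathin (subtopology X U) (\<lambda>_. p 1)"
    using assms pathin_ends by (intro pathin_const) auto
  then have "path_class X (path_join p (\<lambda>_. p 1)) \<in> cover_basic X p U"
    by (rule cover_basicI) simp
  then show ?thesis
    using path_class_join_const_right[OF assms(1)] by simp
qed

lemma cover_basic_mono:
  assumes "U \<subseteq> V" shows "cover_basic X p U \<subseteq> cover_basic X p V"
proof
  fix \<xi> assume "\<xi> \<in> cover_basic X p U"
  then obtain d where d: "pathin (subtopology X U) d" "d 0 = p 1" "\<xi> = path_class X (path_join p d)"
    by (rule cover_basicE)
  have "pathin (subtopology X V) d"
    using d(1) assms by (auto simp: pathin_def continuous_map_in_subtopology)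
  then show "\<xi> \<in> cover_basic X p V"
    unfolding d(3) using d(2) by (rule cover_basicI)
qed

lemma cover_basic_subset:
  assumes p: "pathin X p" and r: "pathin X r" "path_class X r \<in> cover_basic X p U"
  shows "cover_basic X r U \<subseteq> cover_basic X p U"
proof
  obtain d where d: "pathin (subtopology X U) d" "d 0 = p 1" "path_class X r = path_class X (path_join p d)"
    using r(2) by (rule cover_basicE)
  have d': "pathin X d" using d(1) by (rule pathin_subtopology_imp_pathin)
  have r1: "r 1 = d 1" using path_class_eqD(4)[OF r(1) d(3)] by simp
  fix \<xi> assume "\<xi> \<in> cover_basic X r U"
  then obtain c where c: "pathin (subtopology X U) c" "c 0 = r 1" "\<xi> = path_class X (path_join r c)"
    by (rule cover_basicE)
  have c': "pathin X c" using c(1) by (rule pathin_subtopology_imp_pathin)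
  have "\<xi> = path_class X (path_join (path_join p d) c)"
    unfolding c(3) by (intro path_class_join_cong) (use r c' c d in auto)
  also have "\<dots> = path_class X (path_join p (path_join d c))"
    by (intro path_class_join_assoc) (use p d' c' d c r1 in auto)
  also have "\<dots> \<in> cover_basic X p U"
    by (intro cover_basicI pathin_path_join) (use d c r1 in auto)
  finally show "\<xi> \<in> cover_basic X p U" .
qed

text \<open>If \<open>r = p d\<close> with \<open>d\<close> in \<open>U\<close>, then \<open>r c = p (d c)\<close> and \<open>p c = r (d\<^sup>- c)\<close>.\<close>

lemma cover_basic_eq:
  assumes p: "pathin X p" and r: "pathin X r" "path_class X r \<in> cover_basic X p U"
  shows "cover_basic X r U = cover_basic X p U"
proof
  show "cover_basic X r U \<subseteq> cover_basic X p U" by (rule cover_basic_subset[OF assms])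
  obtain d where d: "pathin (subtopology X U) d" "d 0 = p 1" "path_class X r = path_class X (path_join p d)"
    using r(2) by (rule cover_basicE)
  have d': "pathin X d" "pathin X (path_rev d)"
    using pathin_subtopology_imp_pathin[OF d(1)] pathin_path_rev[of X d] by auto
  have r1: "r 1 = d 1" using path_class_eqD(4)[OF r(1) d(3)] by simp
  have "path_class X p = path_class X (path_join (path_join p d) (path_rev d))"
    using path_class_cancel_right[OF d'(1) p] d(2) by simp
  also have "\<dots> = path_class X (path_join r (path_rev d))"
    by (intro path_class_join_cong pathin_path_join) (use p d d' in auto)
  also have "\<dots> \<in> cover_basic X r U"
    by (intro cover_basicI pathin_path_rev) (use d r1 in auto)
  finally show "cover_basic X p U \<subseteq> cover_basic X r U"
    using cover_basic_subset[OF r(1) p] by simp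
qed

lemma cover_basic_cong:
  assumes "pathin X p" "path_class X p = path_class X p'"
  shows "cover_basic X p U = cover_basic X p' U"
proof -
  have "path_class X (path_join p d) = path_class X (path_join p' d)" if "pathin (subtopology X U) d" "d 0 = p 1" for d
    using that assms by (intro path_class_join_cong) (auto intro: pathin_subtopology_imp_pathin)
  then show ?thesis
    unfolding cover_basic_def path_class_eqD(4)[OF assms]
    by (intro Collect_cong ex_cong1) (auto simp only:)
qed

abbreviation pathin_from :: "'a topology \<Rightarrow> 'a \<Rightarrow> (real \<Rightarrow> 'a) \<Rightarrow> bool" where
  "pathin_from X x0 p \<equiv> pathin X p \<and> p 0 = x0"

lemma openin_cover_basic:
  assumes "pathin_from X x0 p" "openin X U" "p 1 \<in> U"
  shows "openin (universal_cover X x0) (cover_basic X p U)"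
proof -
  have "openin (topology_generated_by {cover_basic X p U | p U. pathin X p \<and> p 0 = x0 \<and> openin X U \<and> p 1 \<in> U}) (cover_basic X p U)"
    unfolding openin_topology_generated_by_iff by (rule generate_topology_on.Basis) (use assms in auto)
  then show ?thesis
    by (simp add: universal_cover_def cover_basic_def)
qed

text \<open>The basic sets form a basis, not just a subbasis: since a basic set can be described from
  each of its points, the one of \<open>p\<close> and \<open>U \<inter> U'\<close> lies in the intersection of two basic sets over \<open>U\<close> and \<open>U'\<close>
  that contain \<open>p\<close>.\<close>

lemma openin_universal_cover:
  "openin (universal_cover X x0) A \<longleftrightarrow>
     (\<forall>\<xi>\<in>A. \<exists>p U. pathin_from X x0 p \<and> openin X U \<and> p 1 \<in> U \<and> \<xi> = path_class X p \<and> cover_basic X p U \<subseteq> A)"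
  (is "_ \<longleftrightarrow> ?P A")
proof
  let ?S = "{cover_basic X p U | p U. pathin X p \<and> p 0 = x0 \<and> openin X U \<and> p 1 \<in> U}"
  have UC: "universal_cover X x0 = topology_generated_by ?S"
    by (simp add: universal_cover_def cover_basic_def)
  show "?P A" if "openin (universal_cover X x0) A"
  proof -
    from that have "generate_topology_on ?S A"
      unfolding UC openin_topology_generated_by_iff .
    then show "?P A"
    proof induction
      case Empty
      then show ?case by simp
    next
      case (Int a b)
      show ?case
      proof
        fix \<xi> assume "\<xi> \<in> a \<inter> b"
        then have \<xi>: "\<xi> \<in> a" "\<xi> \<in> b" by auto
        obtain p U where p: "pathin_from X x0 p" "openin X U" "p 1 \<in> U" "\<xi> = path_class X p" "cover_basic X p U \<subseteq> a"
          using bspec[OF Int.IH(1) \<xi>(1)] by (elim exE conjE) (rule that, simp_all)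
        obtain p' U' where p': "pathin_from X x0 p'" "openin X U'" "p' 1 \<in> U'" "\<xi> = path_class X p'" "cover_basic X p' U' \<subseteq> b"
          using bspec[OF Int.IH(2) \<xi>(2)] by (elim exE conjE) (rule that, simp_all)
        have e: "p' 1 = p 1" using path_class_eqD(4)[of X p p'] p p' by simp
        have "cover_basic X p (U \<inter> U') \<subseteq> a" using cover_basic_mono[of "U \<inter> U'" U X p] p(5) by auto
        moreover have "cover_basic X p (U \<inter> U') \<subseteq> b"
          using cover_basic_mono[of "U \<inter> U'" U' X p] p'(5) cover_basic_cong[of X p p' U'] p p' by auto
        ultimately show "\<exists>p U. pathin_from X x0 p \<and> openin X U \<and> p 1 \<in> U \<and> \<xi> = path_class X p \<and> cover_basic X p U \<subseteq> a \<inter> b"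
          using p p' e by (intro exI[of _ p] exI[of _ "U \<inter> U'"]) auto
      qed
    next
      case (UN K)
      show ?case
      proof
        fix \<xi> assume "\<xi> \<in> \<Union>K"
        then obtain k where k: "k \<in> K" "\<xi> \<in> k" by auto
        show "\<exists>p U. pathin_from X x0 p \<and> openin X U \<and> p 1 \<in> U \<and> \<xi> = path_class X p \<and> cover_basic X p U \<subseteq> \<Union>K"
          using bspec[OF UN.IH[OF k(1)] k(2)] Union_upper[OF k(1)]
          by (elim exE conjE, intro exI conjI) (assumption | rule subset_trans)+
      qed
    next
      case (Basis s)
      then obtain p U where p: "pathin X p" "p 0 = x0" "openin X U" "p 1 \<in> U" "s = cover_basic X p U" by auto
      show ?case
      proof
        fix \<xi> assume \<xi>: "\<xi> \<in> s"
        then obtain d where d: "pathin (subtopology X U) d" "d 0 = p 1" "\<xi> = path_class X (path_join p d)"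
          unfolding p(5) by (rule cover_basicE)
        have d': "pathin X d" using d(1) by (rule pathin_subtopology_imp_pathin)
        have j: "pathin X (path_join p d)" using p d d' by (intro pathin_path_join) auto
        have "cover_basic X (path_join p d) U \<subseteq> s"
          using cover_basic_subset[OF p(1) j, of U] \<xi> d(3) p(5) by simp
        moreover have "d 1 \<in> U" using pathin_ends(2)[OF d(1)] by simp
        ultimately show "\<exists>p U. pathin_from X x0 p \<and> openin X U \<and> p 1 \<in> U \<and> \<xi> = path_class X p \<and> cover_basic X p U \<subseteq> s"
          using j d p by (intro exI[of _ "path_join p d"] exI[of _ U]) simp
      qed
    qed
  qed
  show "openin (universal_cover X x0) A" if P: "?P A"
  proof (subst openin_subopen, intro ballI)
    fix \<xi> assume "\<xi> \<in> A"
    obtain p U where p: "pathin_from X x0 p" "openin X U" "p 1 \<in> U" "\<xi> = path_class X p" "cover_basic X p U \<subseteq> A"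
      using bspec[OF P \<open>\<xi> \<in> A\<close>] by (elim exE conjE) (rule that, simp_all)
    then show "\<exists>T. openin (universal_cover X x0) T \<and> \<xi> \<in> T \<and> T \<subseteq> A"
      using openin_cover_basic[OF p(1-3)] cover_basic_self[of X p U] by auto
  qed
qed

lemma openin_universal_coverE:
  assumes "openin (universal_cover X x0) A" "\<xi> \<in> A"
  obtains p U where "pathin_from X x0 p" "openin X U" "p 1 \<in> U" "\<xi> = path_class X p" "cover_basic X p U \<subseteq> A"
  using bspec[OF assms(1)[unfolded openin_universal_cover] assms(2)]
  by (elim exE conjE) (rule that, simp_all)

lemma topspace_universal_cover:
  "topspace (universal_cover X x0) = {path_class X p | p. pathin_from X x0 p}"
proof
  show "topspace (universal_cover X x0) \<subseteq> {path_class X p | p. pathin_from X x0 p}"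
  proof
    fix \<xi> assume "\<xi> \<in> topspace (universal_cover X x0)"
    then show "\<xi> \<in> {path_class X p | p. pathin_from X x0 p}"
      using openin_topspace[of "universal_cover X x0", unfolded openin_universal_cover] by auto
  qed
  show "{path_class X p | p. pathin_from X x0 p} \<subseteq> topspace (universal_cover X x0)"
  proof
    fix \<xi> assume "\<xi> \<in> {path_class X p | p. pathin_from X x0 p}"
    then obtain p where p: "\<xi> = path_class X p" "pathin_from X x0 p" by auto
    then have "openin (universal_cover X x0) (cover_basic X p (topspace X))" "\<xi> \<in> cover_basic X p (topspace X)"
      using pathin_ends(2)[of X p] by (auto intro: openin_cover_basic cover_basic_self)
    then show "\<xi> \<in> topspace (universal_cover X x0)"
      using openin_subset[of "universal_cover X x0"] by auto
  qed
qed

section \<open>Lifts of maps on convex sets\<close>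

definition seg :: "(nat \<Rightarrow> real) \<Rightarrow> (nat \<Rightarrow> real) \<Rightarrow> real \<Rightarrow> nat \<Rightarrow> real" where
  "seg x y s = (\<lambda>i. (1 - s) * x i + s * y i)"

definition seg_convex :: "(nat \<Rightarrow> real) set \<Rightarrow> bool" where
  "seg_convex S \<longleftrightarrow> (\<forall>x\<in>S. \<forall>y\<in>S. \<forall>s. 0 \<le> s \<and> s \<le> 1 \<longrightarrow> seg x y s \<in> S)"

lemma seg_0 [simp]: "seg x y 0 = x" and seg_1 [simp]: "seg x y 1 = y"
  by (simp_all add: seg_def)

lemma seg_convexD: "seg_convex S \<Longrightarrow> x \<in> S \<Longrightarrow> y \<in> S \<Longrightarrow> 0 \<le> s \<Longrightarrow> s \<le> 1 \<Longrightarrow> seg x y s \<in> S"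
  by (simp add: seg_convex_def)

lemma seg_convex_Int: "seg_convex S \<Longrightarrow> seg_convex T \<Longrightarrow> seg_convex (S \<inter> T)"
  by (simp add: seg_convex_def)

lemma seg_convex_standard_simplex: "seg_convex (standard_simplex k)"
  by (simp add: seg_convex_def seg_def convex_standard_simplex)

abbreviation powertop_sub :: "(nat \<Rightarrow> real) set \<Rightarrow> (nat \<Rightarrow> real) topology" where
  "powertop_sub S \<equiv> subtopology (powertop_real UNIV) S"

lemma pathin_seg:
  assumes "seg_convex S" "x \<in> S" "y \<in> S"
  shows "pathin (powertop_sub S) (seg x y)"
  unfolding pathin_def continuous_map_in_subtopology continuous_map_componentwise_UNIV
proof (intro conjI allI)
  show "continuous_map (top_of_set {0..1}) euclideanreal (\<lambda>s. seg x y s i)" for i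
    unfolding seg_def by (auto intro!: continuous_intros)
  show "seg x y \<in> topspace (top_of_set {0..1}) \<rightarrow> S"
    using assms by (auto intro: seg_convexD)
qed

lemma path_homotopic_seg_convex:
  assumes S: "seg_convex S" and a: "pathin (powertop_sub S) a" and b: "pathin (powertop_sub S) b"
    and e: "a 0 = b 0" "a 1 = b 1"
  shows "path_homotopic (powertop_sub S) a b"
proof -
  let ?I = "top_of_set {0..1::real}"
  let ?h = "\<lambda>z. seg (a (snd z)) (b (snd z)) (fst z)"
  have comp: "continuous_map (prod_topology ?I ?I) euclideanreal (\<lambda>z. c (snd z) i)"
    if "pathin (powertop_sub S) c" for c i
  proof -
    have "continuous_map ?I euclideanreal (\<lambda>t. c t i)"
      using that unfolding pathin_def continuous_map_in_subtopology continuous_map_componentwise_UNIV by simp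
    then show ?thesis
      by (rule continuous_map_compose[OF continuous_map_snd, unfolded o_def])
  qed
  have fst: "continuous_map (prod_topology ?I ?I) euclideanreal fst"
    by (rule continuous_map_into_fulltopology[OF continuous_map_fst])
  have mem: "c t \<in> S" if "pathin (powertop_sub S) c" "t \<in> {0..1}" for c t
    using pathin_in_topspace[OF that(1), of t] that(2) by simp
  have "continuous_map (prod_topology ?I ?I) (powertop_sub S) ?h"
    unfolding continuous_map_in_subtopology continuous_map_componentwise_UNIV
  proof (intro conjI allI)
    show "continuous_map (prod_topology ?I ?I) euclideanreal (\<lambda>z. ?h z i)" for i
      unfolding seg_def
      by (intro continuous_map_add continuous_map_real_mult continuous_map_diff comp[OF a] comp[OF b] fst) auto
    show "?h \<in> topspace (prod_topology ?I ?I) \<rightarrow> S"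
      using mem[OF a] mem[OF b] by (auto intro!: seg_convexD[OF S])
  qed
  moreover have "seg (a 0) (b 0) s = a 0" "seg (a 1) (b 1) s = a 1" for s
    unfolding e by (auto simp: seg_def algebra_simps)
  ultimately show ?thesis
    unfolding path_homotopic_def homotopic_with_def by (intro exI[of _ ?h]) auto
qed

lemma path_class_seg_convex:
  assumes S: "seg_convex S" and F: "continuous_map (powertop_sub S) X F"
    and a: "pathin (powertop_sub S) a" and b: "pathin (powertop_sub S) b" and e: "a 0 = b 0" "a 1 = b 1"
  shows "path_class X (F \<circ> a) = path_class X (F \<circ> b)"
  by (intro path_class_eqI pathin_image[OF a F] path_homotopic_image[OF F] path_homotopic_seg_convex[OF S a b e])

text \<open>A basic open set of the product topology is a product of open sets, all but finitely many of which are
  the whole line; the other ones can be shrunk to intervals.\<close>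

lemma powertop_convex_nbhd:
  assumes T: "openin (powertop_real UNIV) T" and v: "v \<in> T"
  obtains B where "openin (powertop_real UNIV) B" "v \<in> B" "B \<subseteq> T" "seg_convex B"
proof -
  have "\<exists>U. finite {i \<in> UNIV. U i \<noteq> topspace euclideanreal} \<and> (\<forall>i\<in>UNIV. openin euclideanreal (U i)) \<and>
      v \<in> Pi\<^sub>E UNIV U \<and> Pi\<^sub>E UNIV U \<subseteq> T"
    using T v unfolding openin_product_topology_alt by simp
  then obtain U where U: "finite {i. U i \<noteq> UNIV}" "\<And>i. open (U i)" "v \<in> Pi\<^sub>E UNIV U" "Pi\<^sub>E UNIV U \<subseteq> T"
    by auto
  have "\<exists>e. e > 0 \<and> ball (v i) e \<subseteq> U i" for i
    using U(2)[of i] U(3) by (auto simp: open_contains_ball PiE_iff)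
  then obtain e where e: "\<And>i. e i > 0" "\<And>i. ball (v i) (e i) \<subseteq> U i" by metis
  \<comment> \<open>The factors that are the whole line stay so, to keep the set open.\<close>
  define C where "C i = (if U i = UNIV then UNIV else ball (v i) (e i))" for i
  have "{i. C i \<noteq> UNIV} \<subseteq> {i. U i \<noteq> UNIV}" by (auto simp: C_def)
  then have "finite {i. C i \<noteq> UNIV}" using U(1) finite_subset by blast
  then have "openin (powertop_real UNIV) (Pi\<^sub>E UNIV C)"
    by (intro product_topology_basis) (auto simp: C_def)
  moreover have "v \<in> Pi\<^sub>E UNIV C" using e(1) by (auto simp: C_def)
  moreover have "Pi\<^sub>E UNIV C \<subseteq> T"
  proof -
    have "C i \<subseteq> U i" for i unfolding C_def using e(2)[of i] by (cases "U i = UNIV") simp_all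
    then have "Pi\<^sub>E UNIV C \<subseteq> Pi\<^sub>E UNIV U" by (rule PiE_mono)
    then show ?thesis using U(4) by (rule subset_trans)
  qed
  moreover have "seg_convex (Pi\<^sub>E UNIV C)"
    unfolding seg_convex_def
  proof (intro ballI allI impI)
    fix x y s assume x: "x \<in> Pi\<^sub>E UNIV C" and y: "y \<in> Pi\<^sub>E UNIV C" and s: "0 \<le> s \<and> s \<le> (1::real)"
    have "seg x y s i \<in> C i" for i
    proof -
      have "convex (C i)" by (simp add: C_def)
      moreover have "x i \<in> C i" "y i \<in> C i" using x y by (auto simp: PiE_iff)
      ultimately show ?thesis
        using s convexD_alt[of "C i" "x i" "y i" s] by (simp add: seg_def)
    qed
    then show "seg x y s \<in> Pi\<^sub>E UNIV C" by auto
  qed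
  ultimately show thesis by (rule that)
qed

text \<open>In a convex set, the segment from \<open>v\<close> to \<open>t\<close> is homotopic to the detour over \<open>t0\<close>.\<close>

lemma path_class_join_seg_split:
  assumes S: "seg_convex S" and F: "continuous_map (powertop_sub S) X F"
    and v: "v \<in> S" and t0: "t0 \<in> S" and t: "t \<in> S" and p: "pathin X p" and pv: "p 1 = F v"
  shows "path_class X (path_join p (F \<circ> seg v t))
           = path_class X (path_join (path_join p (F \<circ> seg v t0)) (F \<circ> seg t0 t))"
proof -
  have sg: "pathin (powertop_sub S) (seg x y)" if "x \<in> S" "y \<in> S" for x y
    by (rule pathin_seg[OF S that])
  have Fs: "pathin X (F \<circ> seg x y)" if "x \<in> S" "y \<in> S" for x y
    by (rule pathin_image[OF sg[OF that] F])
  have "path_class X (F \<circ> seg v t) = path_class X (F \<circ> path_join (seg v t0) (seg t0 t))"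
    by (intro path_class_seg_convex[OF S F] pathin_path_join sg) (use v t t0 in auto)
  then have "path_class X (F \<circ> seg v t) = path_class X (path_join (F \<circ> seg v t0) (F \<circ> seg t0 t))"
    by (simp add: path_join_comp)
  then have "path_class X (path_join p (F \<circ> seg v t))
      = path_class X (path_join p (path_join (F \<circ> seg v t0) (F \<circ> seg t0 t)))"
    by (intro path_class_join_cong) (use p pv Fs[OF v t] in auto)
  also have "\<dots> = path_class X (path_join (path_join p (F \<circ> seg v t0)) (F \<circ> seg t0 t))"
    by (intro path_class_join_assoc[symmetric]) (use p pv Fs v t t0 in auto)
  finally show ?thesis .
qed

text \<open>This is the lift of \<open>F\<close> that sends \<open>v\<close> to the class of \<open>p\<close>. It is continuous at \<open>t0\<close> because the
  segment to a nearby point \<open>t\<close> may make a detour over \<open>t0\<close>, and the image of the remaining segment from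
  \<open>t0\<close> to \<open>t\<close> stays in a given neighbourhood of \<open>F t0\<close>.\<close>

lemma continuous_map_universal_cover_lift:
  assumes S: "seg_convex S" and F: "continuous_map (powertop_sub S) X F" and v: "v \<in> S"
    and p: "pathin_from X x0 p" and pv: "p 1 = F v"
  shows "continuous_map (powertop_sub S) (universal_cover X x0) (\<lambda>t. path_class X (path_join p (F \<circ> seg v t)))"
proof -
  let ?L = "\<lambda>t. path_class X (path_join p (F \<circ> seg v t))"
  have sg: "pathin (powertop_sub S) (seg x y)" if "x \<in> S" "y \<in> S" for x y
    by (rule pathin_seg[OF S that])
  have Fs: "pathin X (F \<circ> seg x y)" if "x \<in> S" "y \<in> S" for x y
    by (rule pathin_image[OF sg[OF that] F])
  have j: "pathin_from X x0 (path_join p (F \<circ> seg v t))" if "t \<in> S" for t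
    using p pv Fs[OF v that] by (simp add: pathin_path_join)
  have split: "?L t = path_class X (path_join (path_join p (F \<circ> seg v t0)) (F \<circ> seg t0 t))"
    if "t0 \<in> S" "t \<in> S" for t0 t
    by (rule path_class_join_seg_split[OF S F v that]) (use p pv in auto)
  show ?thesis
    unfolding continuous_map_def
  proof (intro conjI allI impI)
    show "?L \<in> topspace (powertop_sub S) \<rightarrow> topspace (universal_cover X x0)"
      using j unfolding topspace_universal_cover by auto
    fix A assume A: "openin (universal_cover X x0) A"
    show "openin (powertop_sub S) {t \<in> topspace (powertop_sub S). ?L t \<in> A}"
    proof (subst openin_subopen, intro ballI)
      fix t0 assume "t0 \<in> {t \<in> topspace (powertop_sub S). ?L t \<in> A}"
      then have t0: "t0 \<in> S" "?L t0 \<in> A" by auto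
      let ?r = "path_join p (F \<circ> seg v t0)"
      obtain p' U where p': "pathin_from X x0 p'" "openin X U" "p' 1 \<in> U" "?L t0 = path_class X p'" "cover_basic X p' U \<subseteq> A"
        by (rule openin_universal_coverE[OF A t0(2)])
      have r1: "F t0 \<in> U" using path_class_eqD(4)[OF _ p'(4)] j[OF t0(1)] p'(3) by simp
      have rU: "cover_basic X ?r U \<subseteq> A"
        using cover_basic_cong[OF _ p'(4), of U] j[OF t0(1)] p'(5) by simp
      have "openin (powertop_sub S) {t \<in> topspace (powertop_sub S). F t \<in> U}"
        by (rule openin_continuous_map_preimage[OF F p'(2)])
      then obtain T where T: "openin (powertop_real UNIV) T" "{t \<in> topspace (powertop_sub S). F t \<in> U} = T \<inter> S"
        unfolding openin_subtopology by auto
      have "t0 \<in> T" using T(2) t0(1) r1 by auto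
      obtain B where B: "openin (powertop_real UNIV) B" "t0 \<in> B" "B \<subseteq> T" "seg_convex B"
        by (rule powertop_convex_nbhd[OF T(1) \<open>t0 \<in> T\<close>])
      have "?L t \<in> A" if t: "t \<in> S \<inter> B" for t
      proof -
        have "pathin (powertop_sub (S \<inter> B)) (seg t0 t)"
          by (rule pathin_seg[OF seg_convex_Int[OF S B(4)]]) (use t t0 B in auto)
        then have im: "seg t0 t s \<in> S \<inter> B" if "0 \<le> s" "s \<le> 1" for s
          using pathin_in_topspace[OF _ that] by fastforce
        have "pathin (subtopology X U) (F \<circ> seg t0 t)"
          unfolding pathin_def continuous_map_in_subtopology
        proof
          show "continuous_map (top_of_set {0..1}) X (F \<circ> seg t0 t)"
            using Fs[of t0 t] t0 t by (simp add: pathin_def)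
          show "F \<circ> seg t0 t \<in> topspace (top_of_set {0..1}) \<rightarrow> U"
          proof
            fix s assume "s \<in> topspace (top_of_set {0..1::real})"
            then have "seg t0 t s \<in> T \<inter> S" using im[of s] B(3) by auto
            then show "(F \<circ> seg t0 t) s \<in> U" using T(2) by auto
          qed
        qed
        then have "path_class X (path_join ?r (F \<circ> seg t0 t)) \<in> cover_basic X ?r U"
          by (rule cover_basicI) simp
        then show ?thesis using split[OF t0(1), of t] t rU by auto
      qed
      moreover have "openin (powertop_sub S) (S \<inter> B)"
        using B(1) by (auto simp: openin_subtopology)
      ultimately show "\<exists>T. openin (powertop_sub S) T \<and> t0 \<in> T \<and> T \<subseteq> {t \<in> topspace (powertop_sub S). ?L t \<in> A}"
        using t0 B(2) by (intro exI[of _ "S \<inter> B"]) auto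
    qed
  qed
qed

section \<open>The coverings that belong to subgroups\<close>

lemma subgroup_fundamental_groupD:
  assumes K: "subgroup K (fundamental_group X x0)" and x0: "x0 \<in> topspace X"
  shows "path_class X (\<lambda>_. x0) \<in> K"
    and "\<And>l m. loopin X x0 l \<Longrightarrow> loopin X x0 m \<Longrightarrow> path_class X l \<in> K \<Longrightarrow> path_class X m \<in> K
            \<Longrightarrow> path_class X (path_join l m) \<in> K"
    and "\<And>l. loopin X x0 l \<Longrightarrow> path_class X l \<in> K \<Longrightarrow> path_class X (path_rev l) \<in> K"
    and "\<And>h. h \<in> K \<Longrightarrow> \<exists>l. loopin X x0 l \<and> h = path_class X l"
proof -
  show "path_class X (\<lambda>_. x0) \<in> K"
    using subgroup.one_closed[OF K] by (simp add: one_fundamental_group)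
  show "path_class X (path_join l m) \<in> K"
    if "loopin X x0 l" "loopin X x0 m" "path_class X l \<in> K" "path_class X m \<in> K" for l m
    using subgroup.m_closed[OF K that(3,4)] mult_fundamental_group[OF that(1,2)] by simp
  show "path_class X (path_rev l) \<in> K" if "loopin X x0 l" "path_class X l \<in> K" for l
    using subgroup.m_inv_closed[OF K that(2)] inv_fundamental_group[OF x0 that(1)] by simp
  show "\<exists>l. loopin X x0 l \<and> h = path_class X l" if "h \<in> K" for h
    using subgroup.mem_carrier[OF K that] by (auto simp: carrier_fundamental_group)
qed

abbreviation orbit_of :: "'a topology \<Rightarrow> (real \<Rightarrow> 'a) set set \<Rightarrow> (real \<Rightarrow> 'a) \<Rightarrow> (real \<Rightarrow> 'a) set set" where
  "orbit_of X K p \<equiv> deck_orbit X K (path_class X p)"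

lemma mem_deck_orbit_iff:
  assumes K: "subgroup K (fundamental_group X x0)" and x0: "x0 \<in> topspace X" and p: "pathin_from X x0 p"
  shows "\<xi> \<in> orbit_of X K p \<longleftrightarrow>
           (\<exists>l. loopin X x0 l \<and> path_class X l \<in> K \<and> \<xi> = path_class X (path_join l p))"
proof
  assume "\<xi> \<in> orbit_of X K p"
  then obtain h where h: "h \<in> K" "\<xi> = class_join X h (path_class X p)"
    by (auto simp: deck_orbit_def)
  obtain l where l: "loopin X x0 l" "h = path_class X l"
    using subgroup_fundamental_groupD(4)[OF K x0 h(1)] by auto
  then have "\<xi> = path_class X (path_join l p)"
    using h(2) class_join_path_class[of X l p] p by simp
  then show "\<exists>l. loopin X x0 l \<and> path_class X l \<in> K \<and> \<xi> = path_class X (path_join l p)"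
    using l h(1) by auto
next
  assume "\<exists>l. loopin X x0 l \<and> path_class X l \<in> K \<and> \<xi> = path_class X (path_join l p)"
  then obtain l where l: "loopin X x0 l" "path_class X l \<in> K" "\<xi> = path_class X (path_join l p)" by auto
  then have "\<xi> = class_join X (path_class X l) (path_class X p)"
    using class_join_path_class[of X l p] p by simp
  then show "\<xi> \<in> orbit_of X K p"
    using l(2) by (auto simp: deck_orbit_def)
qed

lemma deck_orbit_self:
  assumes K: "subgroup K (fundamental_group X x0)" and x0: "x0 \<in> topspace X" and p: "pathin_from X x0 p"
  shows "path_class X p \<in> orbit_of X K p"
  unfolding mem_deck_orbit_iff[OF assms]
  using path_class_join_const_left[of X p x0] p pathin_const[OF x0] subgroup_fundamental_groupD(1)[OF K x0]
  by (intro exI[of _ "\<lambda>_. x0"]) simp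

lemma pathin_from_join: "loopin X x0 l \<Longrightarrow> pathin_from X x0 p \<Longrightarrow> pathin_from X x0 (path_join l p)"
  by (simp add: pathin_path_join)

lemma deck_orbit_join_subset:
  assumes K: "subgroup K (fundamental_group X x0)" and x0: "x0 \<in> topspace X" and p: "pathin_from X x0 p"
    and l: "loopin X x0 l" "path_class X l \<in> K"
  shows "orbit_of X K (path_join l p) \<subseteq> orbit_of X K p"
proof
  fix \<xi> assume "\<xi> \<in> orbit_of X K (path_join l p)"
  then obtain m where m: "loopin X x0 m" "path_class X m \<in> K" "\<xi> = path_class X (path_join m (path_join l p))"
    unfolding mem_deck_orbit_iff[OF K x0 pathin_from_join[OF l(1) p]] by auto
  have "\<xi> = path_class X (path_join (path_join m l) p)"
    unfolding m(3) by (intro path_class_join_assoc[symmetric]) (use l m p in auto)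
  then show "\<xi> \<in> orbit_of X K p"
    unfolding mem_deck_orbit_iff[OF K x0 p]
    using subgroup_fundamental_groupD(2)[OF K x0 m(1) l(1) m(2) l(2)] m(1) l(1)
    by (intro exI[of _ "path_join m l"]) (simp add: pathin_path_join)
qed

lemma deck_orbit_join:
  assumes K: "subgroup K (fundamental_group X x0)" and x0: "x0 \<in> topspace X" and p: "pathin_from X x0 p"
    and l: "loopin X x0 l" "path_class X l \<in> K"
  shows "orbit_of X K (path_join l p) = orbit_of X K p"
proof
  show "orbit_of X K (path_join l p) \<subseteq> orbit_of X K p"
    by (rule deck_orbit_join_subset[OF assms])
  have r: "loopin X x0 (path_rev l)" using l by (simp add: pathin_path_rev)
  have "orbit_of X K (path_join (path_rev l) (path_join l p)) \<subseteq> orbit_of X K (path_join l p)"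
    by (rule deck_orbit_join_subset[OF K x0 pathin_from_join[OF l(1) p] r subgroup_fundamental_groupD(3)[OF K x0 l]])
  then show "orbit_of X K p \<subseteq> orbit_of X K (path_join l p)"
    using path_class_cancel_left[of X l p] l p by simp
qed

lemma deck_orbit_eq_iff:
  assumes K: "subgroup K (fundamental_group X x0)" and x0: "x0 \<in> topspace X"
    and p: "pathin_from X x0 p" and p': "pathin_from X x0 p'"
  shows "orbit_of X K p' = orbit_of X K p \<longleftrightarrow>
           (\<exists>l. loopin X x0 l \<and> path_class X l \<in> K \<and> path_class X p' = path_class X (path_join l p))"
proof
  assume "orbit_of X K p' = orbit_of X K p"
  then have "path_class X p' \<in> orbit_of X K p"
    using deck_orbit_self[OF K x0 p'] by simp
  then show "\<exists>l. loopin X x0 l \<and> path_class X l \<in> K \<and> path_class X p' = path_class X (path_join l p)"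
    unfolding mem_deck_orbit_iff[OF K x0 p] .
next
  assume "\<exists>l. loopin X x0 l \<and> path_class X l \<in> K \<and> path_class X p' = path_class X (path_join l p)"
  then show "orbit_of X K p' = orbit_of X K p"
    using deck_orbit_join[OF K x0 p] by auto
qed

lemma covering_projection_deck_orbit:
  assumes K: "subgroup K (fundamental_group X x0)" and x0: "x0 \<in> topspace X" and p: "pathin_from X x0 p"
  shows "covering_projection (orbit_of X K p) = p 1"
  unfolding covering_projection_def
proof (rule the_equality)
  show "\<exists>\<xi>\<in>orbit_of X K p. \<exists>q\<in>\<xi>. q 1 = p 1"
    using deck_orbit_self[OF assms] path_class_self[of X p] p by (intro bexI[of _ "path_class X p"] bexI[of _ p]) auto
  fix z assume "\<exists>\<xi>\<in>orbit_of X K p. \<exists>q\<in>\<xi>. q 1 = z"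
  then obtain \<xi> q where q: "\<xi> \<in> orbit_of X K p" "q \<in> \<xi>" "q 1 = z" by auto
  then obtain l where "\<xi> = path_class X (path_join l p)"
    unfolding mem_deck_orbit_iff[OF assms] by auto
  then have "path_homotopic X (path_join l p) q" using q(2) by (simp add: path_class_def)
  then show "z = p 1" using path_homotopic_imp_pathin(4) q(3) by fastforce
qed

lemma quotient_map_deck_orbit:
  "quotient_map (universal_cover X x0) (covering_of_subgroup X x0 K) (deck_orbit X K)"
  unfolding covering_of_subgroup_def by (rule quotient_map_quotient_topology)

lemma topspace_covering_of_subgroup:
  "topspace (covering_of_subgroup X x0 K) = {orbit_of X K p | p. pathin_from X x0 p}"
proof -
  have "topspace (covering_of_subgroup X x0 K) = deck_orbit X K ` topspace (universal_cover X x0)"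
    using quotient_imp_surjective_map[OF quotient_map_deck_orbit] by (rule sym)
  then show ?thesis unfolding topspace_universal_cover by auto
qed

text \<open>If \<open>p' = l p\<close>, then the translation by \<open>l\<close> maps the basic set of \<open>p\<close> and \<open>U\<close> onto that of \<open>p'\<close> and \<open>U\<close>.
  So the union of the orbits that meet an open set is open.\<close>

lemma open_map_deck_orbit:
  assumes K: "subgroup K (fundamental_group X x0)" and x0: "x0 \<in> topspace X"
  shows "open_map (universal_cover X x0) (covering_of_subgroup X x0 K) (deck_orbit X K)"
  unfolding open_map_def
proof (intro allI impI)
  let ?U = "universal_cover X x0"
  fix A assume A: "openin ?U A"
  have sub: "A \<subseteq> topspace ?U" using A by (rule openin_subset)
  have "openin ?U {\<xi> \<in> topspace ?U. deck_orbit X K \<xi> \<in> deck_orbit X K ` A}"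
    unfolding openin_universal_cover
  proof
    fix \<xi> assume "\<xi> \<in> {\<xi> \<in> topspace ?U. deck_orbit X K \<xi> \<in> deck_orbit X K ` A}"
    then obtain \<eta> where \<xi>: "\<xi> \<in> topspace ?U" and \<eta>: "\<eta> \<in> A" "deck_orbit X K \<xi> = deck_orbit X K \<eta>" by auto
    obtain p' where p': "pathin_from X x0 p'" "\<xi> = path_class X p'" using \<xi> unfolding topspace_universal_cover by auto
    obtain p U where p: "pathin_from X x0 p" "openin X U" "p 1 \<in> U" "\<eta> = path_class X p" "cover_basic X p U \<subseteq> A"
      by (rule openin_universal_coverE[OF A \<eta>(1)])
    obtain l where l: "loopin X x0 l" "path_class X l \<in> K" "path_class X p' = path_class X (path_join l p)"
      using deck_orbit_eq_iff[OF K x0 p(1) p'(1)] \<eta>(2) p(4) p'(2) by auto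
    have e: "p' 1 = p 1" using path_class_eqD(4)[OF _ l(3)] p'(1) by simp
    have "cover_basic X p' U \<subseteq> {\<xi> \<in> topspace ?U. deck_orbit X K \<xi> \<in> deck_orbit X K ` A}"
    proof
      fix \<zeta> assume "\<zeta> \<in> cover_basic X p' U"
      then obtain d where d: "pathin (subtopology X U) d" "d 0 = p' 1" "\<zeta> = path_class X (path_join p' d)"
        by (rule cover_basicE)
      have d': "pathin X d" using d(1) by (rule pathin_subtopology_imp_pathin)
      have pd: "pathin_from X x0 (path_join p d)" using p d d' e by (simp add: pathin_path_join)
      have "\<zeta> = path_class X (path_join (path_join l p) d)"
        unfolding d(3) by (intro path_class_join_cong) (use p' d d' l in auto)
      also have "\<dots> = path_class X (path_join l (path_join p d))"
        by (intro path_class_join_assoc) (use p d d' l e in auto)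
      finally have \<zeta>: "\<zeta> = path_class X (path_join l (path_join p d))" .
      have "path_class X (path_join p d) \<in> A"
        using p(5) cover_basicI[OF d(1), of p] d(2) e by auto
      moreover have "deck_orbit X K \<zeta> = orbit_of X K (path_join p d)"
        unfolding \<zeta> by (rule deck_orbit_join[OF K x0 pd l(1,2)])
      moreover have "\<zeta> \<in> topspace ?U"
        unfolding \<zeta> topspace_universal_cover using pathin_from_join[OF l(1) pd] by auto
      ultimately show "\<zeta> \<in> {\<xi> \<in> topspace ?U. deck_orbit X K \<xi> \<in> deck_orbit X K ` A}" by simp
    qed
    then show "\<exists>p U. pathin_from X x0 p \<and> openin X U \<and> p 1 \<in> U \<and> \<xi> = path_class X p
        \<and> cover_basic X p U \<subseteq> {\<xi> \<in> topspace ?U. deck_orbit X K \<xi> \<in> deck_orbit X K ` A}"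
      using p' p e by (intro exI[of _ p'] exI[of _ U]) simp
  qed
  then show "openin (covering_of_subgroup X x0 K) (deck_orbit X K ` A)"
    unfolding covering_of_subgroup_def openin_quotient_topology using sub by auto
qed

text \<open>The sets that are evenly covered by the universal covering: path-connected open sets whose loops are
  null-homotopic in \<open>X\<close>.\<close>

definition simple_nbhd :: "'a topology \<Rightarrow> 'a set \<Rightarrow> bool" where
  "simple_nbhd X W \<longleftrightarrow> openin X W \<and>
     (\<forall>a\<in>W. \<forall>b\<in>W. \<exists>d. pathin (subtopology X W) d \<and> d 0 = a \<and> d 1 = b) \<and>
     (\<forall>d d'. pathin (subtopology X W) d \<and> pathin (subtopology X W) d' \<and> d 0 = d' 0 \<and> d 1 = d' 1
        \<longrightarrow> path_homotopic X d d')"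

definition locally_simple :: "'a topology \<Rightarrow> bool" where
  "locally_simple X \<longleftrightarrow> (\<forall>U x. openin X U \<and> x \<in> U \<longrightarrow> (\<exists>W. x \<in> W \<and> W \<subseteq> U \<and> simple_nbhd X W))"

lemma cover_basic_in_topspace:
  assumes "pathin_from X x0 p" "\<xi> \<in> cover_basic X p U"
  obtains r where "pathin_from X x0 r" "\<xi> = path_class X r" "r 1 \<in> U"
proof -
  obtain d where d: "pathin (subtopology X U) d" "d 0 = p 1" "\<xi> = path_class X (path_join p d)"
    using assms(2) by (rule cover_basicE)
  have 1: "pathin_from X x0 (path_join p d)"
    using assms(1) d pathin_subtopology_imp_pathin[OF d(1)] by (simp add: pathin_path_join)
  have 2: "path_join p d 1 \<in> U" using pathin_ends(2)[OF d(1)] by simp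
  show thesis by (rule that[OF 1 d(3) 2])
qed

lemma continuous_map_covering_projection:
  assumes K: "subgroup K (fundamental_group X x0)" and x0: "x0 \<in> topspace X"
  shows "continuous_map (covering_of_subgroup X x0 K) X covering_projection"
proof (rule continuous_compose_quotient_map[OF quotient_map_deck_orbit])
  let ?U = "universal_cover X x0"
  let ?e = "covering_projection \<circ> deck_orbit X K"
  have e: "?e (path_class X p) = p 1" if "pathin_from X x0 p" for p
    using covering_projection_deck_orbit[OF K x0 that] by simp
  show "continuous_map ?U X ?e"
    unfolding continuous_map_def
  proof (intro conjI allI impI)
    show "?e \<in> topspace ?U \<rightarrow> topspace X"
    proof
      fix \<xi> assume "\<xi> \<in> topspace ?U"
      then obtain p where p: "pathin_from X x0 p" "\<xi> = path_class X p" unfolding topspace_universal_cover by auto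
      show "?e \<xi> \<in> topspace X" unfolding p(2) e[OF p(1)] using p(1) pathin_ends(2)[of X p] by simp
    qed
    fix V assume V: "openin X V"
    show "openin ?U {\<xi> \<in> topspace ?U. ?e \<xi> \<in> V}"
      unfolding openin_universal_cover
    proof
      fix \<xi> assume \<xi>: "\<xi> \<in> {\<xi> \<in> topspace ?U. ?e \<xi> \<in> V}"
      then obtain p where p: "pathin_from X x0 p" "\<xi> = path_class X p" unfolding topspace_universal_cover by auto
      have pV: "p 1 \<in> V" using \<xi> e[OF p(1)] p(2) by simp
      have "cover_basic X p V \<subseteq> {\<xi> \<in> topspace ?U. ?e \<xi> \<in> V}"
      proof
        fix \<zeta> assume "\<zeta> \<in> cover_basic X p V"
        then obtain r where r: "pathin_from X x0 r" "\<zeta> = path_class X r" "r 1 \<in> V"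
          by (rule cover_basic_in_topspace[OF p(1)])
        have "\<zeta> \<in> topspace ?U" unfolding topspace_universal_cover using r by auto
        then show "\<zeta> \<in> {\<xi> \<in> topspace ?U. ?e \<xi> \<in> V}" using r(3) e[OF r(1)] r(2) by simp
      qed
      then show "\<exists>p U. pathin_from X x0 p \<and> openin X U \<and> p 1 \<in> U \<and> \<xi> = path_class X p
          \<and> cover_basic X p U \<subseteq> {\<xi> \<in> topspace ?U. ?e \<xi> \<in> V}"
        using p V pV by (intro exI[of _ p] exI[of _ V]) simp
    qed
  qed
qed

lemma chartI:
  assumes U: "openin Y U" and c: "continuous_map Y X p" and o: "open_map Y X p" and i: "inj_on p U"
  shows "chart Y X p U"
proof -
  have sU: "U \<subseteq> topspace Y" using U by (rule openin_subset)
  have pU: "openin X (p ` U)" using o U by (simp add: open_map_def)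
  have "homeomorphic_map (subtopology Y U) (subtopology X (p ` U)) p"
  proof (rule bijective_open_imp_homeomorphic_map)
    show "continuous_map (subtopology Y U) (subtopology X (p ` U)) p"
      using c sU by (auto simp: continuous_map_in_subtopology continuous_map_from_subtopology)
    show "open_map (subtopology Y U) (subtopology X (p ` U)) p"
      unfolding open_map_def
    proof (intro allI impI)
      fix V assume "openin (subtopology Y U) V"
      then have V: "openin Y V" "V \<subseteq> U" using U by (auto simp: openin_open_subtopology)
      have "openin X (p ` V)" using o V(1) by (simp add: open_map_def)
      then show "openin (subtopology X (p ` U)) (p ` V)"
        using pU V(2) by (simp add: openin_open_subtopology image_mono)
    qed
    show "p ` topspace (subtopology Y U) = topspace (subtopology X (p ` U))"
      using sU openin_subset[OF pU] by (simp add: inf.absorb2)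
    show "inj_on p (topspace (subtopology Y U))"
      using i sU by (simp add: inf.absorb2)
  qed
  then show ?thesis using U pU by (simp add: chart_def)
qed

lemma simple_nbhd_pathE:
  assumes "simple_nbhd X W" "a \<in> W" "b \<in> W"
  obtains d where "pathin (subtopology X W) d" "d 0 = a" "d 1 = b"
  using assms unfolding simple_nbhd_def by meson

lemma simple_nbhd_homotopic:
  assumes "simple_nbhd X W" "pathin (subtopology X W) d" "pathin (subtopology X W) d'" "d 0 = d' 0" "d 1 = d' 1"
  shows "path_class X d = path_class X d'"
proof (rule path_class_eqI)
  show "pathin X d" by (rule pathin_subtopology_imp_pathin[OF assms(2)])
  show "path_homotopic X d d'" using assms unfolding simple_nbhd_def by meson
qed

lemma locally_simpleE:
  assumes "locally_simple X" "openin X U" "x \<in> U"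
  obtains W where "x \<in> W" "W \<subseteq> U" "simple_nbhd X W" "openin X W"
proof -
  obtain W where W: "x \<in> W" "W \<subseteq> U" "simple_nbhd X W"
    using assms(1)[unfolded locally_simple_def, rule_format, OF conjI[OF assms(2,3)]]
    by (elim exE conjE) (rule that)
  then show thesis using that[OF W] by (simp add: simple_nbhd_def)
qed

text \<open>Paths in \<open>W\<close> with the same ends are homotopic in \<open>X\<close>; so a basic set over \<open>W\<close> is a sheet.\<close>

lemma cover_basic_endpoint_inj:
  assumes W: "simple_nbhd X W" and p: "pathin X p" and r: "pathin X r" "pathin X r'"
    and B: "path_class X r \<in> cover_basic X p W" "path_class X r' \<in> cover_basic X p W" and e: "r 1 = r' 1"
  shows "path_class X r = path_class X r'"
proof -
  obtain d where d: "pathin (subtopology X W) d" "d 0 = p 1" "path_class X r = path_class X (path_join p d)"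
    using B(1) by (rule cover_basicE)
  obtain d' where d': "pathin (subtopology X W) d'" "d' 0 = p 1" "path_class X r' = path_class X (path_join p d')"
    using B(2) by (rule cover_basicE)
  have "d 1 = d' 1" using path_class_eqD(4)[OF r(1) d(3)] path_class_eqD(4)[OF r(2) d'(3)] e by simp
  then have "path_class X d = path_class X d'"
    using simple_nbhd_homotopic[OF W d(1) d'(1)] d(2) d'(2) by simp
  then have "path_class X (path_join p d) = path_class X (path_join p d')"
    by (intro path_class_join_cong) (use p d d' pathin_subtopology_imp_pathin[OF d(1)] in auto)
  then show ?thesis using d(3) d'(3) by simp
qed

lemma cover_basic_translate:
  assumes p: "pathin_from X x0 p" and l: "loopin X x0 l" and r: "pathin X r" "path_class X r \<in> cover_basic X p U"
  shows "path_class X (path_join l r) \<in> cover_basic X (path_join l p) U"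
proof -
  obtain d where d: "pathin (subtopology X U) d" "d 0 = p 1" "path_class X r = path_class X (path_join p d)"
    using r(2) by (rule cover_basicE)
  have d': "pathin X d" using d(1) by (rule pathin_subtopology_imp_pathin)
  have r0: "r 0 = x0" using path_class_eqD(3)[OF r(1) d(3)] p by simp
  have "path_class X (path_join l r) = path_class X (path_join l (path_join p d))"
    by (intro path_class_join_cong) (use l r d r0 in auto)
  also have "\<dots> = path_class X (path_join (path_join l p) d)"
    by (intro path_class_join_assoc[symmetric]) (use l p d d' in auto)
  also have "\<dots> \<in> cover_basic X (path_join l p) U"
    by (intro cover_basicI) (use d in auto)
  finally show ?thesis .
qed

definition sheet :: "'a topology \<Rightarrow> (real \<Rightarrow> 'a) set set \<Rightarrow> (real \<Rightarrow> 'a) \<Rightarrow> 'a set \<Rightarrow> (real \<Rightarrow> 'a) set set set" where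
  "sheet X K p W = deck_orbit X K ` cover_basic X p W"

context
  fixes X :: "'a topology" and x0 :: 'a and K :: "(real \<Rightarrow> 'a) set set"
  assumes x0: "x0 \<in> topspace X" and K: "subgroup K (fundamental_group X x0)"
begin

lemma sheetE:
  assumes p: "pathin_from X x0 p" and e: "e \<in> sheet X K p W"
  obtains r where "pathin_from X x0 r" "path_class X r \<in> cover_basic X p W" "e = orbit_of X K r" "r 1 \<in> W"
proof -
  obtain \<xi> where \<xi>: "\<xi> \<in> cover_basic X p W" "e = deck_orbit X K \<xi>" using e by (auto simp: sheet_def)
  obtain r where r: "pathin_from X x0 r" "\<xi> = path_class X r" "r 1 \<in> W"
    by (rule cover_basic_in_topspace[OF p \<xi>(1)])
  show thesis
    by (rule that[OF r(1) _ _ r(3)]) (use \<xi> r(2) in auto)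
qed

lemma sheet_translate:
  assumes p: "pathin_from X x0 p" and l: "loopin X x0 l" "path_class X l \<in> K"
  shows "sheet X K (path_join l p) W = sheet X K p W"
proof -
  have sub: "sheet X K p W \<subseteq> sheet X K (path_join l p) W"
    if p: "pathin_from X x0 p" and l: "loopin X x0 l" "path_class X l \<in> K" for p l
  proof
    fix e assume "e \<in> sheet X K p W"
    then obtain r where r: "pathin_from X x0 r" "path_class X r \<in> cover_basic X p W"
      "e = orbit_of X K r" "r 1 \<in> W" by (rule sheetE[OF p])
    have "e = orbit_of X K (path_join l r)"
      unfolding r(3) by (rule deck_orbit_join[OF K x0 r(1) l, symmetric])
    moreover have "path_class X (path_join l r) \<in> cover_basic X (path_join l p) W"
      by (rule cover_basic_translate[OF p l(1) _ r(2)]) (use r in auto)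
    ultimately show "e \<in> sheet X K (path_join l p) W" by (auto simp: sheet_def)
  qed
  have r: "loopin X x0 (path_rev l)" using l by (simp add: pathin_path_rev)
  have "sheet X K (path_join l p) W \<subseteq> sheet X K (path_join (path_rev l) (path_join l p)) W"
    by (rule sub[OF pathin_from_join[OF l(1) p] r subgroup_fundamental_groupD(3)[OF K x0 l]])
  also have "\<dots> = sheet X K p W"
    using cover_basic_cong[of X "path_join (path_rev l) (path_join l p)" p W] path_class_cancel_left[of X l p] l p r
    by (simp add: sheet_def pathin_path_join)
  finally show ?thesis using sub[OF p l] by auto
qed

lemma openin_sheet:
  assumes p: "pathin_from X x0 p" and W: "openin X W" "p 1 \<in> W"
  shows "openin (covering_of_subgroup X x0 K) (sheet X K p W)"
  using open_map_deck_orbit[OF K x0] openin_cover_basic[OF p W] by (simp add: open_map_def sheet_def)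

lemma covering_projection_sheet_inj:
  assumes p: "pathin_from X x0 p" and W: "simple_nbhd X W"
  shows "inj_on covering_projection (sheet X K p W)"
proof (rule inj_onI)
  fix e e' assume e: "e \<in> sheet X K p W" "e' \<in> sheet X K p W" and eq: "covering_projection e = covering_projection e'"
  obtain r where r: "pathin_from X x0 r" "path_class X r \<in> cover_basic X p W" "e = orbit_of X K r"
    by (rule sheetE[OF p e(1)])
  obtain r' where r': "pathin_from X x0 r'" "path_class X r' \<in> cover_basic X p W" "e' = orbit_of X K r'"
    by (rule sheetE[OF p e(2)])
  have "r 1 = r' 1"
    using eq unfolding r(3) r'(3) covering_projection_deck_orbit[OF K x0 r(1)] covering_projection_deck_orbit[OF K x0 r'(1)] .
  then show "e = e'"
    unfolding r(3) r'(3) using cover_basic_endpoint_inj[OF W, of p r r'] p r r' by simp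
qed

lemma covering_projection_sheet_image:
  assumes p: "pathin_from X x0 p" and W: "simple_nbhd X W" "p 1 \<in> W"
  shows "covering_projection ` sheet X K p W = W"
proof
  show "covering_projection ` sheet X K p W \<subseteq> W"
  proof
    fix x assume "x \<in> covering_projection ` sheet X K p W"
    then obtain e where e: "e \<in> sheet X K p W" "x = covering_projection e" by auto
    obtain r where r: "pathin_from X x0 r" "path_class X r \<in> cover_basic X p W" "e = orbit_of X K r" "r 1 \<in> W"
      by (rule sheetE[OF p e(1)])
    show "x \<in> W" unfolding e(2) r(3) covering_projection_deck_orbit[OF K x0 r(1)] by (rule r(4))
  qed
  show "W \<subseteq> covering_projection ` sheet X K p W"
  proof
    fix x assume x: "x \<in> W"
    obtain d where d: "pathin (subtopology X W) d" "d 0 = p 1" "d 1 = x"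
      by (rule simple_nbhd_pathE[OF W x])
    have j: "pathin_from X x0 (path_join p d)"
      using p d pathin_subtopology_imp_pathin[OF d(1)] by (simp add: pathin_path_join)
    have "path_class X (path_join p d) \<in> cover_basic X p W" by (rule cover_basicI[of X W d p, OF d(1,2)])
    then have "orbit_of X K (path_join p d) \<in> sheet X K p W" by (auto simp: sheet_def)
    moreover have "x = covering_projection (orbit_of X K (path_join p d))"
      unfolding covering_projection_deck_orbit[OF K x0 j] using d by simp
    ultimately show "x \<in> covering_projection ` sheet X K p W" by (rule image_eqI[rotated])
  qed
qed

lemma sheet_self:
  assumes p: "pathin_from X x0 p" and W: "p 1 \<in> W"
  shows "orbit_of X K p \<in> sheet X K p W"
  using cover_basic_self[of X p W] p W by (auto simp: sheet_def)

text \<open>Both sheets are the sheet of each orbit that they have in common.\<close>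

lemma sheets_disjoint_or_equal:
  assumes p: "pathin_from X x0 p" and p': "pathin_from X x0 p'" and W: "simple_nbhd X W"
    and ne: "\<not> disjnt (sheet X K p W) (sheet X K p' W)"
  shows "sheet X K p W = sheet X K p' W"
proof -
  obtain e where e: "e \<in> sheet X K p W" "e \<in> sheet X K p' W" using ne by (auto simp: disjnt_iff)
  obtain r where r: "pathin_from X x0 r" "path_class X r \<in> cover_basic X p W" "e = orbit_of X K r"
    by (rule sheetE[OF p e(1)])
  obtain r' where r': "pathin_from X x0 r'" "path_class X r' \<in> cover_basic X p' W" "e = orbit_of X K r'"
    by (rule sheetE[OF p' e(2)])
  obtain l where l: "loopin X x0 l" "path_class X l \<in> K" "path_class X r' = path_class X (path_join l r)"
    using deck_orbit_eq_iff[OF K x0 r(1) r'(1)] r(3) r'(3) by auto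
  have "sheet X K p' W = sheet X K r' W"
    using cover_basic_eq[of X p' r' W] p' r' by (simp add: sheet_def)
  also have "\<dots> = sheet X K (path_join l r) W"
    using cover_basic_cong[of X r' "path_join l r" W] r'(1) l(3) by (simp add: sheet_def)
  also have "\<dots> = sheet X K r W" by (rule sheet_translate[OF r(1) l(1,2)])
  also have "\<dots> = sheet X K p W"
    using cover_basic_eq[of X p r W] p r by (simp add: sheet_def)
  finally show ?thesis by simp
qed

text \<open>Basic sets over simple neighbourhoods \<open>W\<close> are mapped onto \<open>W\<close>.\<close>

lemma open_map_covering_projection:
  assumes ls: "locally_simple X"
  shows "open_map (covering_of_subgroup X x0 K) X covering_projection"
  unfolding open_map_def
proof (intro allI impI)
  fix A assume A: "openin (covering_of_subgroup X x0 K) A"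
  let ?A' = "{\<xi> \<in> topspace (universal_cover X x0). deck_orbit X K \<xi> \<in> A}"
  have A': "openin (universal_cover X x0) ?A'" and AY: "A \<subseteq> topspace (covering_of_subgroup X x0 K)"
    using A openin_subset[OF A] by (auto simp: covering_of_subgroup_def openin_quotient_topology)
  show "openin X (covering_projection ` A)"
  proof (subst openin_subopen, intro ballI)
    fix x assume "x \<in> covering_projection ` A"
    then obtain e where e: "e \<in> A" "x = covering_projection e" by auto
    then obtain p0 where p0: "pathin_from X x0 p0" "e = orbit_of X K p0"
      using AY unfolding topspace_covering_of_subgroup by auto
    have "path_class X p0 \<in> ?A'"
      using e(1) p0 unfolding topspace_universal_cover by auto
    then obtain p U where p: "pathin_from X x0 p" "openin X U" "p 1 \<in> U" "path_class X p0 = path_class X p" "cover_basic X p U \<subseteq> ?A'"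
      by (rule openin_universal_coverE[OF A'])
    obtain W where W: "p 1 \<in> W" "W \<subseteq> U" "simple_nbhd X W" "openin X W"
      by (rule locally_simpleE[OF ls p(2,3)])
    have "sheet X K p W \<subseteq> A"
      using cover_basic_mono[OF W(2), of X p] p(5) by (auto simp: sheet_def)
    then have "W \<subseteq> covering_projection ` A"
      using image_mono[of "sheet X K p W" A covering_projection] covering_projection_sheet_image[OF p(1) W(3,1)] by simp
    moreover have "x \<in> W"
      unfolding e(2) p0(2) p(4) covering_projection_deck_orbit[OF K x0 p(1)] by (rule W(1))
    ultimately show "\<exists>T. openin X T \<and> x \<in> T \<and> T \<subseteq> covering_projection ` A" using W(4) by auto
  qed
qed

lemma chart_sheet:
  assumes ls: "locally_simple X" and p: "pathin_from X x0 p" and W: "simple_nbhd X W" "p 1 \<in> W"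
  shows "chart (covering_of_subgroup X x0 K) X covering_projection (sheet X K p W)"
  using W(1) openin_sheet[OF p _ W(2)] continuous_map_covering_projection[OF K x0] open_map_covering_projection[OF ls]
    covering_projection_sheet_inj[OF p W(1)] by (intro chartI) (auto simp: simple_nbhd_def)

theorem covering_map_covering_projection:
  assumes ls: "locally_simple X"
  shows "covering_map (covering_of_subgroup X x0 K) X covering_projection"
  unfolding covering_map_def
proof (intro conjI ballI)
  show "continuous_map (covering_of_subgroup X x0 K) X covering_projection"
    by (rule continuous_map_covering_projection[OF K x0])
  fix x assume x: "x \<in> topspace X"
  obtain W where W: "x \<in> W" "simple_nbhd X W" "openin X W"
    by (rule locally_simpleE[OF ls openin_topspace x])
  let ?V = "{sheet X K p W | p. pathin_from X x0 p \<and> p 1 \<in> W}"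
  have "evenly_covered (covering_of_subgroup X x0 K) X covering_projection W ?V"
    unfolding evenly_covered_def
  proof (intro conjI ballI)
    show "openin X W" by fact
    show "pairwise disjnt ?V"
      unfolding pairwise_def using sheets_disjoint_or_equal[OF _ _ W(2)] by auto
    show "\<Union>?V = {e \<in> topspace (covering_of_subgroup X x0 K). covering_projection e \<in> W}" (is "_ = ?R")
    proof
      show "\<Union>?V \<subseteq> ?R"
      proof
        fix e assume "e \<in> \<Union>?V"
        then obtain p where p: "pathin_from X x0 p" "p 1 \<in> W" "e \<in> sheet X K p W" by auto
        obtain r where r: "pathin_from X x0 r" "path_class X r \<in> cover_basic X p W" "e = orbit_of X K r" "r 1 \<in> W"
          by (rule sheetE[OF p(1,3)])
        show "e \<in> ?R"
          using r covering_projection_deck_orbit[OF K x0 r(1)] unfolding topspace_covering_of_subgroup by auto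
      qed
      show "?R \<subseteq> \<Union>?V"
      proof
        fix e assume e: "e \<in> ?R"
        then obtain p where p: "pathin_from X x0 p" "e = orbit_of X K p"
          unfolding topspace_covering_of_subgroup by auto
        have "p 1 \<in> W" using e p covering_projection_deck_orbit[OF K x0 p(1)] by simp
        then show "e \<in> \<Union>?V" using sheet_self[OF p(1)] p by auto
      qed
    qed
    fix V assume "V \<in> ?V"
    then obtain p where p: "pathin_from X x0 p" "p 1 \<in> W" "V = sheet X K p W" by auto
    show "chart (covering_of_subgroup X x0 K) X covering_projection V"
      unfolding p(3) by (rule chart_sheet[OF ls p(1) W(2) p(2)])
    show "covering_projection ` V = W"
      unfolding p(3) by (rule covering_projection_sheet_image[OF p(1) W(2) p(2)])
  qed
  then show "\<exists>U \<V>. x \<in> U \<and> evenly_covered (covering_of_subgroup X x0 K) X covering_projection U \<V>"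
    using W(1) by (intro exI[of _ W] exI[of _ ?V] conjI)
qed

end

text \<open>For \<open>K \<subseteq> H\<close>, all elements of a \<open>K\<close>-orbit have the same \<open>H\<close>-orbit, so the choice does not matter.\<close>

definition orbit_map :: "'a topology \<Rightarrow> (real \<Rightarrow> 'a) set set \<Rightarrow> (real \<Rightarrow> 'a) set set \<Rightarrow> (real \<Rightarrow> 'a) set set" where
  "orbit_map X H orb = deck_orbit X H (SOME \<xi>. \<xi> \<in> orb)"

lemma orbit_map_deck_orbit:
  assumes x0: "x0 \<in> topspace X" and K: "subgroup K (fundamental_group X x0)"
    and H: "subgroup H (fundamental_group X x0)" and KH: "K \<subseteq> H" and p: "pathin_from X x0 p"
  shows "orbit_map X H (orbit_of X K p) = orbit_of X H p"
proof -
  let ?O = "orbit_of X K p"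
  have "(SOME \<xi>. \<xi> \<in> ?O) \<in> ?O"
    by (rule someI[where P = "\<lambda>\<xi>. \<xi> \<in> ?O"]) (rule deck_orbit_self[OF K x0 p])
  then obtain l where l: "loopin X x0 l" "path_class X l \<in> K" "(SOME \<xi>. \<xi> \<in> ?O) = path_class X (path_join l p)"
    unfolding mem_deck_orbit_iff[OF K x0 p] by auto
  show ?thesis
    unfolding orbit_map_def l(3) by (rule deck_orbit_join[OF H x0 p l(1)]) (use l(2) KH in auto)
qed

text \<open>The sheets over the sheet of \<open>p\<close> in the covering of \<open>H\<close> are the sheets of the translates \<open>l p\<close> with
  \<open>l \<in> H\<close> in the covering of \<open>K\<close>. On all of these, the projections to \<open>X\<close> are injective and compatible
  with the orbit map.\<close>

theorem covering_map_orbit_map: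
  assumes x0: "x0 \<in> topspace X" and ls: "locally_simple X" and K: "subgroup K (fundamental_group X x0)"
    and H: "subgroup H (fundamental_group X x0)" and KH: "K \<subseteq> H"
  shows "covering_map (covering_of_subgroup X x0 K) (covering_of_subgroup X x0 H) (orbit_map X H)"
proof -
  let ?U = "universal_cover X x0"
  let ?E = "covering_of_subgroup X x0 K"
  let ?B = "covering_of_subgroup X x0 H"
  let ?q = "orbit_map X H"
  have q: "?q (orbit_of X K p) = orbit_of X H p" if "pathin_from X x0 p" for p
    by (rule orbit_map_deck_orbit[OF x0 K H KH that])
  have qU: "?q (deck_orbit X K \<xi>) = deck_orbit X H \<xi>" if "\<xi> \<in> topspace ?U" for \<xi>
    using that q unfolding topspace_universal_cover by auto
  have cont: "continuous_map ?E ?B ?q"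
  proof (rule continuous_compose_quotient_map[OF quotient_map_deck_orbit])
    show "continuous_map ?U ?B (?q \<circ> deck_orbit X K)"
      by (rule continuous_map_eq[OF quotient_imp_continuous_map[OF quotient_map_deck_orbit]]) (simp add: qU)
  qed
  have opn: "open_map ?E ?B ?q"
    unfolding open_map_def
  proof (intro allI impI)
    fix A assume A: "openin ?E A"
    let ?A = "{\<xi> \<in> topspace ?U. deck_orbit X K \<xi> \<in> A}"
    have 1: "openin ?U ?A" "A \<subseteq> deck_orbit X K ` topspace ?U"
      using A by (auto simp: covering_of_subgroup_def openin_quotient_topology)
    have "?q ` A = deck_orbit X H ` ?A"
    proof
      show "?q ` A \<subseteq> deck_orbit X H ` ?A"
      proof
        fix y assume "y \<in> ?q ` A"
        then obtain a where a: "a \<in> A" "y = ?q a" by auto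
        then obtain \<xi> where \<xi>: "\<xi> \<in> topspace ?U" "a = deck_orbit X K \<xi>" using 1(2) by auto
        then show "y \<in> deck_orbit X H ` ?A" using a qU[OF \<xi>(1)] by auto
      qed
      show "deck_orbit X H ` ?A \<subseteq> ?q ` A"
        using qU by (auto intro!: rev_image_eqI)
    qed
    then show "openin ?B (?q ` A)"
      using open_map_deck_orbit[OF H x0] 1(1) by (simp add: open_map_def)
  qed
  have shim: "?q ` sheet X K p W = sheet X H p W" if p: "pathin_from X x0 p" for p W
  proof -
    have "?q ` sheet X K p W = (\<lambda>\<xi>. ?q (deck_orbit X K \<xi>)) ` cover_basic X p W"
      by (simp add: sheet_def image_image)
    also have "\<dots> = deck_orbit X H ` cover_basic X p W"
    proof (rule image_cong[OF refl])
      fix \<xi> assume "\<xi> \<in> cover_basic X p W"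
      then obtain r where r: "pathin_from X x0 r" "\<xi> = path_class X r" by (rule cover_basic_in_topspace[OF p])
      show "?q (deck_orbit X K \<xi>) = deck_orbit X H \<xi>" unfolding r(2) by (rule q[OF r(1)])
    qed
    finally show ?thesis by (simp add: sheet_def)
  qed
  have inj: "inj_on ?q (sheet X K p W)" if p: "pathin_from X x0 p" and W: "simple_nbhd X W" for p W
  proof (rule inj_onI)
    fix e e' assume e: "e \<in> sheet X K p W" "e' \<in> sheet X K p W" and eq: "?q e = ?q e'"
    have pr: "covering_projection (?q a) = covering_projection a" if a: "a \<in> sheet X K p W" for a
    proof -
      obtain r where r: "pathin_from X x0 r" "a = orbit_of X K r"
        by (rule sheetE[OF x0 K p a])
      show ?thesis
        unfolding r(2) q[OF r(1)] covering_projection_deck_orbit[OF K x0 r(1)] covering_projection_deck_orbit[OF H x0 r(1)] ..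
    qed
    have "covering_projection e = covering_projection e'" using pr[OF e(1)] pr[OF e(2)] eq by simp
    then show "e = e'" using covering_projection_sheet_inj[OF x0 K p W] e by (auto dest: inj_onD)
  qed
  have "\<exists>U \<V>. b \<in> U \<and> evenly_covered ?E ?B ?q U \<V>" if b: "b \<in> topspace ?B" for b
  proof -
    obtain p where p: "pathin_from X x0 p" "b = orbit_of X H p"
      using b unfolding topspace_covering_of_subgroup by auto
    have p1: "p 1 \<in> topspace X" using p(1) by (simp add: pathin_ends(2))
    obtain W where W: "p 1 \<in> W" "simple_nbhd X W" "openin X W"
      by (rule locally_simpleE[OF ls openin_topspace p1])
    let ?V = "{sheet X K (path_join l p) W | l. loopin X x0 l \<and> path_class X l \<in> H}"
    have lp: "pathin_from X x0 (path_join l p)" if "loopin X x0 l" for l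
      by (rule pathin_from_join[OF that p(1)])
    have "evenly_covered ?E ?B ?q (sheet X H p W) ?V"
      unfolding evenly_covered_def
    proof (intro conjI ballI)
      show "openin ?B (sheet X H p W)" by (rule openin_sheet[OF x0 H p(1) W(3,1)])
      show "pairwise disjnt ?V"
        unfolding pairwise_def using sheets_disjoint_or_equal[OF x0 K lp lp W(2)] by auto
      show "\<Union>?V = {e \<in> topspace ?E. ?q e \<in> sheet X H p W}" (is "_ = ?R")
      proof
        show "\<Union>?V \<subseteq> ?R"
        proof
          fix e assume "e \<in> \<Union>?V"
          then obtain l where l: "loopin X x0 l" "path_class X l \<in> H" "e \<in> sheet X K (path_join l p) W" by auto
          obtain r where r: "pathin_from X x0 r" "e = orbit_of X K r"
            by (rule sheetE[OF x0 K lp[OF l(1)] l(3)])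
          have "?q e \<in> sheet X H (path_join l p) W" using shim[OF lp[OF l(1)]] l(3) by auto
          then have "?q e \<in> sheet X H p W" using sheet_translate[OF x0 H p(1) l(1,2)] by simp
          then show "e \<in> ?R" using r unfolding topspace_covering_of_subgroup by auto
        qed
        show "?R \<subseteq> \<Union>?V"
        proof
          fix e assume e: "e \<in> ?R"
          then obtain s where s: "pathin_from X x0 s" "e = orbit_of X K s"
            unfolding topspace_covering_of_subgroup by auto
          have "?q e \<in> sheet X H p W" using e by simp
          then obtain r where r: "pathin_from X x0 r" "path_class X r \<in> cover_basic X p W" "?q e = orbit_of X H r"
            by (rule sheetE[OF x0 H p(1)])
          obtain l where l: "loopin X x0 l" "path_class X l \<in> H" "path_class X s = path_class X (path_join l r)"
            using deck_orbit_eq_iff[OF H x0 r(1) s(1)] r(3) q[OF s(1)] s(2) by auto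
          have "path_class X s \<in> cover_basic X (path_join l p) W"
            unfolding l(3) by (rule cover_basic_translate[OF p(1) l(1) _ r(2)]) (use r in auto)
          then have "e \<in> sheet X K (path_join l p) W" using s(2) by (auto simp: sheet_def)
          then show "e \<in> \<Union>?V" using l by auto
        qed
      qed
      fix V assume "V \<in> ?V"
      then obtain l where l: "loopin X x0 l" "path_class X l \<in> H" "V = sheet X K (path_join l p) W" by auto
      show "chart ?E ?B ?q V"
        unfolding l(3) using l(1) W(1) by (intro chartI[OF _ cont opn inj[OF lp W(2)]] openin_sheet[OF x0 K lp W(3)]) auto
      show "?q ` V = sheet X H p W"
        unfolding l(3) shim[OF lp[OF l(1)]] by (rule sheet_translate[OF x0 H p(1) l(1,2)])
    qed
    moreover have "b \<in> sheet X H p W"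
      unfolding p(2) by (rule sheet_self[OF x0 H p(1) W(1)])
    ultimately show ?thesis by (intro exI[of _ "sheet X H p W"] exI[of _ ?V] conjI)
  qed
  then show ?thesis using cont by (simp add: covering_map_def)
qed

text \<open>The class of a path \<open>p\<close> is connected with the base point by the lift of \<open>p\<close>, regarded as a 1-simplex.\<close>

lemma connected_space_universal_cover:
  assumes x0: "x0 \<in> topspace X" shows "connected_space (universal_cover X x0)"
proof -
  let ?U = "universal_cover X x0"
  let ?c = "path_class X (\<lambda>_. x0)"
  let ?D = "standard_simplex 1"
  define e0 where "e0 = (\<lambda>j::nat. if j = 0 then 1 else 0 :: real)"
  define e1 where "e1 = (\<lambda>j::nat. if j = 1 then 1 else 0 :: real)"
  have e: "e0 \<in> ?D" "e1 \<in> ?D" by (simp_all add: e0_def e1_def)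
  have conn: "\<exists>S. connectedin ?U S \<and> ?c \<in> S \<and> \<xi> \<in> S" if \<xi>: "\<xi> \<in> topspace ?U" for \<xi>
  proof -
    obtain p where p: "pathin_from X x0 p" "\<xi> = path_class X p" using \<xi> unfolding topspace_universal_cover by auto
    let ?F = "\<lambda>t::nat \<Rightarrow> real. p (t 1)"
    let ?L = "\<lambda>t. path_class X (path_join (\<lambda>_. x0) (?F \<circ> seg e0 t))"
    have c1: "continuous_map (powertop_sub ?D) (top_of_set {0..1}) (\<lambda>t. t 1)"
      unfolding continuous_map_in_subtopology
      by (auto intro!: continuous_map_from_subtopology continuous_map_product_projection simp: standard_simplex_def)
    have "continuous_map (top_of_set {0..1}) X p" using p(1) by (simp add: pathin_def)
    from continuous_map_compose[OF c1 this]
    have F: "continuous_map (powertop_sub ?D) X ?F" unfolding o_def .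
    have "continuous_map (powertop_sub ?D) ?U ?L"
      by (rule continuous_map_universal_cover_lift[OF seg_convex_standard_simplex F e(1)])
        (use x0 p(1) in \<open>auto simp: pathin_const e0_def\<close>)
    moreover have "connectedin (powertop_sub ?D) ?D"
      by (simp add: connectedin_subtopology connectedin_standard_simplex)
    ultimately have "connectedin ?U (?L ` ?D)" by (rule connectedin_continuous_map_image)
    moreover have "?L e0 = ?c"
    proof -
      have "?F \<circ> seg e0 e0 = (\<lambda>_. x0)" using p(1) by (auto simp: seg_def e0_def)
      then show ?thesis using path_class_join_const_left[OF pathin_const[OF x0], of x0] by simp
    qed
    moreover have "?L e1 = \<xi>"
    proof -
      have "?F \<circ> seg e0 e1 = p" by (auto simp: seg_def e0_def e1_def)
      then show ?thesis using path_class_join_const_left[of X p x0] p by simp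
    qed
    ultimately show ?thesis
      using imageI[OF e(1), of ?L] imageI[OF e(2), of ?L] by (intro exI[of _ "?L ` ?D"] conjI) simp_all
  qed
  have "connectedin ?U (\<Union>{S. connectedin ?U S \<and> ?c \<in> S})"
    by (rule connectedin_Union) auto
  moreover have "\<Union>{S. connectedin ?U S \<and> ?c \<in> S} = topspace ?U"
  proof
    show "\<Union>{S. connectedin ?U S \<and> ?c \<in> S} \<subseteq> topspace ?U"
      using connectedin_subset_topspace by auto
    show "topspace ?U \<subseteq> \<Union>{S. connectedin ?U S \<and> ?c \<in> S}"
    proof
      fix \<xi> assume "\<xi> \<in> topspace ?U"
      from conn[OF this] show "\<xi> \<in> \<Union>{S. connectedin ?U S \<and> ?c \<in> S}" by auto
    qed
  qed
  ultimately show ?thesis by (simp add: connectedin_topspace)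
qed

lemma connected_space_covering_of_subgroup:
  assumes x0: "x0 \<in> topspace X" shows "connected_space (covering_of_subgroup X x0 K)"
  using connected_space_quotient_map_image[OF quotient_map_deck_orbit connected_space_universal_cover[OF x0]] .

text \<open>At each point the two lifts lie either in the same sheet, where they agree, or in disjoint sheets,
  where they differ; both conditions are open.\<close>

lemma covering_map_unique_lift:
  assumes cov: "covering_map E B q" and f: "continuous_map Z E f" and g: "continuous_map Z E g"
    and conn: "connected_space Z" and eq: "\<And>z. z \<in> topspace Z \<Longrightarrow> q (f z) = q (g z)"
    and z0: "z0 \<in> topspace Z" "f z0 = g z0" and z: "z \<in> topspace Z"
  shows "f z = g z"
proof -
  have cq: "continuous_map E B q" using cov by (simp add: covering_map_def)
  have loc: "\<exists>V W. chart E B q V \<and> chart E B q W \<and> f z \<in> V \<and> g z \<in> W \<and> (V = W \<or> disjnt V W)" if z: "z \<in> topspace Z" for z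
  proof -
    have fz: "f z \<in> topspace E" and gz: "g z \<in> topspace E"
      using continuous_map_image_subset_topspace[OF f] continuous_map_image_subset_topspace[OF g] z by auto
    have qb: "q (f z) \<in> topspace B" using continuous_map_image_subset_topspace[OF cq] fz by auto
    obtain U \<V> where U: "q (f z) \<in> U" "evenly_covered E B q U \<V>"
      by (rule covering_map_evenly_covered[OF cov qb])
    have "f z \<in> \<Union>\<V>" "g z \<in> \<Union>\<V>" using U fz gz eq[OF z] by (auto simp: evenly_covered_def)
    then obtain V W where VW: "V \<in> \<V>" "f z \<in> V" "W \<in> \<V>" "g z \<in> W" by auto
    have "V = W \<or> disjnt V W" using U(2) VW by (auto simp: evenly_covered_def pairwise_def)
    moreover have "chart E B q V" "chart E B q W" using U(2) VW by (auto simp: evenly_covered_def)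
    ultimately show ?thesis using VW by auto
  qed
  have op: "openin Z {x \<in> topspace Z. f x \<in> V} \<and> openin Z {x \<in> topspace Z. g x \<in> W}" if "chart E B q V" "chart E B q W" for V W
    using that openin_continuous_map_preimage[OF f] openin_continuous_map_preimage[OF g] by (simp add: chart_def)
  have opn: "openin Z {z \<in> topspace Z. (f z = g z) = b}" for b
  proof (subst openin_subopen, intro ballI)
    fix x assume "x \<in> {z \<in> topspace Z. (f z = g z) = b}"
    then have x: "x \<in> topspace Z" "(f x = g x) = b" by auto
    obtain V W where VW: "chart E B q V" "chart E B q W" "f x \<in> V" "g x \<in> W" "V = W \<or> disjnt V W"
      using loc[OF x(1)] by (elim exE conjE) (rule that)
    let ?T = "{y \<in> topspace Z. f y \<in> V} \<inter> {y \<in> topspace Z. g y \<in> W}"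
    have "(f y = g y) = (V = W)" if "y \<in> ?T" for y
      using that VW(5) chart_inj[OF VW(1)] eq by (auto simp: disjnt_iff dest: inj_onD)
    then have "?T \<subseteq> {z \<in> topspace Z. (f z = g z) = b}" using x VW(3,4) by auto
    moreover have "openin Z ?T" using op[OF VW(1,2)] by auto
    ultimately show "\<exists>T. openin Z T \<and> x \<in> T \<and> T \<subseteq> {z \<in> topspace Z. (f z = g z) = b}"
      using x VW by (intro exI[of _ ?T]) auto
  qed
  let ?A = "{z \<in> topspace Z. (f z = g z) = True}" and ?A' = "{z \<in> topspace Z. (f z = g z) = False}"
  have "?A \<inter> ?A' = {}" "topspace Z \<subseteq> ?A \<union> ?A'" "?A \<noteq> {}" using z0 by auto
  then have "?A' = {}" using conn opn[of True] opn[of False] unfolding connected_space_def by meson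
  then show ?thesis using z by auto
qed

section \<open>Lifts of simplices\<close>

lemma deck_orbit_join_right:
  assumes K: "subgroup K (fundamental_group X x0)" and x0: "x0 \<in> topspace X"
    and p: "pathin_from X x0 p" and p': "pathin_from X x0 p'"
    and eq: "orbit_of X K p' = orbit_of X K p"
    and d: "pathin X d" "d 0 = p 1"
  shows "orbit_of X K (path_join p' d) = orbit_of X K (path_join p d)"
proof -
  obtain l where l: "loopin X x0 l" "path_class X l \<in> K" "path_class X p' = path_class X (path_join l p)"
    using eq unfolding deck_orbit_eq_iff[OF K x0 p p'] by (elim exE conjE) (rule that, simp_all)
  have e: "p' 1 = p 1" using path_class_eqD(4)[OF _ l(3)] p' by simp
  have pd: "pathin_from X x0 (path_join p d)" using p d by (simp add: pathin_path_join)
  have "path_class X (path_join p' d) = path_class X (path_join (path_join l p) d)"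
    by (intro path_class_join_cong) (use p' d e l in auto)
  also have "\<dots> = path_class X (path_join l (path_join p d))"
    by (intro path_class_join_assoc) (use p d l in auto)
  finally show ?thesis using deck_orbit_join[OF K x0 pd l(1,2)] by simp
qed

text \<open>An arbitrary choice of an element in each orbit, which tells where to start the lifts of simplices.\<close>

definition base_path :: "'a topology \<Rightarrow> 'a \<Rightarrow> (real \<Rightarrow> 'a) set set \<Rightarrow> (real \<Rightarrow> 'a) set set \<Rightarrow> real \<Rightarrow> 'a" where
  "base_path X x0 H y = (SOME p. pathin_from X x0 p \<and> orbit_of X H p = y)"

lemma base_path:
  assumes "y \<in> topspace (covering_of_subgroup X x0 H)"
  shows "pathin_from X x0 (base_path X x0 H y)" "orbit_of X H (base_path X x0 H y) = y"
proof -
  have "\<exists>p. pathin_from X x0 p \<and> orbit_of X H p = y"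
    using assms unfolding topspace_covering_of_subgroup by auto
  then have "pathin_from X x0 (base_path X x0 H y) \<and> orbit_of X H (base_path X x0 H y) = y"
    unfolding base_path_def by (rule someI_ex)
  then show "pathin_from X x0 (base_path X x0 H y)" "orbit_of X H (base_path X x0 H y) = y"
    by simp_all
qed

definition vtx :: "nat \<Rightarrow> nat \<Rightarrow> real" where
  "vtx i = (\<lambda>j. if j = i then 1 else 0)"

lemma vtx_in_standard_simplex [simp]: "vtx i \<in> standard_simplex k \<longleftrightarrow> i \<le> k"
  unfolding vtx_def by (rule basis_in_standard_simplex)

lemma simplical_face_vtx:
  "1 \<le> k \<Longrightarrow> i < k \<Longrightarrow> simplical_face i (vtx (k - 1)) = vtx k"
  "1 \<le> k \<Longrightarrow> simplical_face k (vtx (k - 1)) = vtx (k - 1)"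
  by (auto simp: simplical_face_def vtx_def fun_eq_iff)

lemma simplical_face_seg: "simplical_face i (seg x y s) = seg (simplical_face i x) (simplical_face i y) s"
  by (auto simp: simplical_face_def seg_def fun_eq_iff)

lemma seg_self [simp]: "seg x x = (\<lambda>_. x)"
  by (auto simp: seg_def fun_eq_iff algebra_simps)

text \<open>The lift of \<open>\<tau>\<close> from the covering of \<open>H\<close> to that of \<open>K\<close> that starts at the last vertex, with the path
  that was chosen there.\<close>

definition lift_simplex ::
  "'a topology \<Rightarrow> 'a \<Rightarrow> (real \<Rightarrow> 'a) set set \<Rightarrow> (real \<Rightarrow> 'a) set set \<Rightarrow> nat \<Rightarrow>
     ((nat \<Rightarrow> real) \<Rightarrow> (real \<Rightarrow> 'a) set set) \<Rightarrow> (nat \<Rightarrow> real) \<Rightarrow> (real \<Rightarrow> 'a) set set" where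
  "lift_simplex X x0 H K k \<tau> = (\<lambda>t\<in>standard_simplex k. deck_orbit X K (path_class X
     (path_join (base_path X x0 H (\<tau> (vtx k))) ((covering_projection \<circ> \<tau>) \<circ> seg (vtx k) t))))"

text \<open>At the other end of the last edge, the lift arrives at the orbit of the path that was chosen there. For
  \<open>k = 0\<close> the last edge is constant, due to \<open>0 - 1 = 0\<close>, and the condition holds.\<close>

definition last_edge_closes ::
  "'a topology \<Rightarrow> 'a \<Rightarrow> (real \<Rightarrow> 'a) set set \<Rightarrow> (real \<Rightarrow> 'a) set set \<Rightarrow> nat \<Rightarrow>
     ((nat \<Rightarrow> real) \<Rightarrow> (real \<Rightarrow> 'a) set set) \<Rightarrow> bool" where
  "last_edge_closes X x0 H K k \<tau> \<longleftrightarrow>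
     orbit_of X K (path_join (base_path X x0 H (\<tau> (vtx k)))
        ((covering_projection \<circ> \<tau>) \<circ> seg (vtx k) (vtx (k - 1))))
     = orbit_of X K (base_path X x0 H (\<tau> (vtx (k - 1))))"

lemma singular_simplex_in_topspace:
  "singular_simplex k X \<tau> \<Longrightarrow> t \<in> standard_simplex k \<Longrightarrow> \<tau> t \<in> topspace X"
  using continuous_map_image_subset_topspace[of "powertop_sub (standard_simplex k)" X \<tau>]
  by (auto simp: singular_simplex_def)

context
  fixes X :: "'a topology" and x0 :: 'a and H K :: "(real \<Rightarrow> 'a) set set"
  assumes x0: "x0 \<in> topspace X"
    and H: "subgroup H (fundamental_group X x0)" and K: "subgroup K (fundamental_group X x0)"
begin

lemma simplex_projection:
  assumes \<tau>: "singular_simplex k (covering_of_subgroup X x0 H) \<tau>"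
  shows "continuous_map (powertop_sub (standard_simplex k)) X (covering_projection \<circ> \<tau>)"
    and "\<And>s t. s \<in> standard_simplex k \<Longrightarrow> t \<in> standard_simplex k \<Longrightarrow> pathin X ((covering_projection \<circ> \<tau>) \<circ> seg s t)"
    and "\<And>t. t \<in> standard_simplex k \<Longrightarrow> pathin_from X x0 (base_path X x0 H (\<tau> t))"
    and "\<And>t. t \<in> standard_simplex k \<Longrightarrow> base_path X x0 H (\<tau> t) 1 = (covering_projection \<circ> \<tau>) t"
    and "\<And>t. t \<in> standard_simplex k \<Longrightarrow> orbit_of X H (base_path X x0 H (\<tau> t)) = \<tau> t"
proof -
  show F: "continuous_map (powertop_sub (standard_simplex k)) X (covering_projection \<circ> \<tau>)"
    using \<tau> by (intro continuous_map_compose[OF _ continuous_map_covering_projection[OF H x0]])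
      (simp add: singular_simplex_def)
  show "pathin X ((covering_projection \<circ> \<tau>) \<circ> seg s t)" if "s \<in> standard_simplex k" "t \<in> standard_simplex k" for s t
    by (rule pathin_image[OF pathin_seg[OF seg_convex_standard_simplex that] F])
  fix t assume "t \<in> standard_simplex k"
  then have y: "\<tau> t \<in> topspace (covering_of_subgroup X x0 H)" by (rule singular_simplex_in_topspace[OF \<tau>])
  show b: "pathin_from X x0 (base_path X x0 H (\<tau> t))" and o: "orbit_of X H (base_path X x0 H (\<tau> t)) = \<tau> t"
    by (rule base_path[OF y])+
  show "base_path X x0 H (\<tau> t) 1 = (covering_projection \<circ> \<tau>) t"
    using covering_projection_deck_orbit[OF H x0 b] o by simp
qed

lemma singular_simplex_lift_simplex:
  assumes \<tau>: "singular_simplex k (covering_of_subgroup X x0 H) \<tau>"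
  shows "singular_simplex k (covering_of_subgroup X x0 K) (lift_simplex X x0 H K k \<tau>)"
proof -
  let ?D = "standard_simplex k"
  let ?L = "\<lambda>t. path_class X (path_join (base_path X x0 H (\<tau> (vtx k))) ((covering_projection \<circ> \<tau>) \<circ> seg (vtx k) t))"
  note sp = simplex_projection[OF \<tau>]
  have "continuous_map (powertop_sub ?D) (universal_cover X x0) ?L"
    by (rule continuous_map_universal_cover_lift[OF seg_convex_standard_simplex sp(1)]) (use sp(3,4) in auto)
  then have "continuous_map (powertop_sub ?D) (covering_of_subgroup X x0 K) (deck_orbit X K \<circ> ?L)"
    by (rule continuous_map_compose[OF _ quotient_imp_continuous_map[OF quotient_map_deck_orbit]])
  then have "continuous_map (powertop_sub ?D) (covering_of_subgroup X x0 K) (lift_simplex X x0 H K k \<tau>)"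
    by (rule continuous_map_eq) (simp add: lift_simplex_def)
  then show ?thesis
    by (simp add: singular_simplex_def lift_simplex_def)
qed

text \<open>The faces with \<open>i < k\<close> have the same last vertex as \<open>\<tau>\<close>. The last vertex of the face with \<open>i = k\<close> is the
  vertex \<open>k - 1\<close> of \<open>\<tau>\<close>; by assumption the lift of \<open>\<tau>\<close> is there what the lift of the face starts with.\<close>

lemma lift_simplex_face:
  assumes \<tau>: "singular_simplex k (covering_of_subgroup X x0 H) \<tau>" and k: "1 \<le> k" and i: "i \<le> k"
    and close: "last_edge_closes X x0 H K k \<tau>"
  shows "singular_face k i (lift_simplex X x0 H K k \<tau>) = lift_simplex X x0 H K (k - 1) (singular_face k i \<tau>)"
proof (rule extensionalityI[of _ "standard_simplex (k - 1)"])
  show "singular_face k i (lift_simplex X x0 H K k \<tau>) \<in> extensional (standard_simplex (k - 1))"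
    "lift_simplex X x0 H K (k - 1) (singular_face k i \<tau>) \<in> extensional (standard_simplex (k - 1))"
    by (simp_all add: singular_face_def lift_simplex_def)
  fix t assume t: "t \<in> standard_simplex (k - 1)"
  note sp = simplex_projection[OF \<tau>]
  let ?F = "covering_projection \<circ> \<tau>"
  let ?f = "simplical_face i"
  let ?b = "\<lambda>t. base_path X x0 H (\<tau> t)"
  let ?v = "?f (vtx (k - 1))"
  have f: "?f s \<in> standard_simplex k" if "s \<in> standard_simplex (k - 1)" for s
    using simplical_face_in_standard_simplex[OF k i] that by simp
  have v1: "vtx (k - 1) \<in> standard_simplex (k - 1)" "vtx (k - 1) \<in> standard_simplex k" "vtx k \<in> standard_simplex k" by auto
  have vk: "?v \<in> standard_simplex k" using f v1 by simp
  have ft: "?f t \<in> standard_simplex k" using f t by simp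
  have sf: "singular_face k i \<tau> s = \<tau> (?f s)" if "s \<in> standard_simplex (k - 1)" for s
    using that by (simp add: singular_face_def)
  have "path_class X ((covering_projection \<circ> singular_face k i \<tau>) \<circ> seg (vtx (k - 1)) t) = path_class X (?F \<circ> seg ?v (?f t))"
  proof (rule path_class_eqI[symmetric])
    show p: "pathin X (?F \<circ> seg ?v (?f t))" by (rule sp(2)[OF vk ft])
    show "path_homotopic X (?F \<circ> seg ?v (?f t)) ((covering_projection \<circ> singular_face k i \<tau>) \<circ> seg (vtx (k - 1)) t)"
    proof (rule path_homotopic_eqI[OF p])
      fix s :: real assume s: "0 \<le> s" "s \<le> 1"
      have "seg (vtx (k - 1)) t s \<in> standard_simplex (k - 1)"
        by (rule seg_convexD[OF seg_convex_standard_simplex v1(1) t s])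
      then show "((covering_projection \<circ> singular_face k i \<tau>) \<circ> seg (vtx (k - 1)) t) s = (?F \<circ> seg ?v (?f t)) s"
        using sf by (simp add: simplical_face_seg)
    qed
  qed
  then have R: "path_class X (path_join (?b ?v) ((covering_projection \<circ> singular_face k i \<tau>) \<circ> seg (vtx (k - 1)) t))
      = path_class X (path_join (?b ?v) (?F \<circ> seg ?v (?f t)))"
    using sp(2)[OF vk ft] sp(3,4)[OF vk] by (intro path_class_join_cong[symmetric]) auto
  have "lift_simplex X x0 H K (k - 1) (singular_face k i \<tau>) t
      = orbit_of X K (path_join (?b ?v) ((covering_projection \<circ> singular_face k i \<tau>) \<circ> seg (vtx (k - 1)) t))"
    using t sf[OF v1(1)] by (simp add: lift_simplex_def)
  also have "\<dots> = orbit_of X K (path_join (?b ?v) (?F \<circ> seg ?v (?f t)))"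
    by (simp only: R)
  also have "\<dots> = orbit_of X K (path_join (?b (vtx k)) (?F \<circ> seg (vtx k) (?f t)))"
  proof (cases "i < k")
    case True
    then show ?thesis using simplical_face_vtx(1)[OF k] by simp
  next
    case False
    then have v: "?v = vtx (k - 1)" using simplical_face_vtx(2)[OF k] i by simp
    have pb: "pathin_from X x0 (?b (vtx (k - 1)))" "pathin_from X x0 (?b (vtx k))" using sp(3) v1 by auto
    have pe: "pathin_from X x0 (path_join (?b (vtx k)) (?F \<circ> seg (vtx k) (vtx (k - 1))))"
      using pb(2) sp(2)[OF v1(3,2)] sp(4)[OF v1(3)] by (simp add: pathin_path_join)
    have "orbit_of X K (path_join (?b (vtx k)) (?F \<circ> seg (vtx k) (?f t)))
        = orbit_of X K (path_join (path_join (?b (vtx k)) (?F \<circ> seg (vtx k) (vtx (k - 1)))) (?F \<circ> seg (vtx (k - 1)) (?f t)))"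
      by (subst path_class_join_seg_split[OF seg_convex_standard_simplex sp(1) v1(3) v1(2) ft conjunct1[OF pb(2)] sp(4)[OF v1(3)]]) (rule refl)
    also have "\<dots> = orbit_of X K (path_join (?b (vtx (k - 1))) (?F \<circ> seg (vtx (k - 1)) (?f t)))"
      by (rule deck_orbit_join_right[OF K x0 pb(1) pe close[unfolded last_edge_closes_def] sp(2)[OF v1(2) ft]])
        (use sp(4)[OF v1(2)] in simp)
    finally show ?thesis unfolding v by simp
  qed
  also have "\<dots> = singular_face k i (lift_simplex X x0 H K k \<tau>) t"
    using t ft by (simp add: singular_face_def lift_simplex_def)
  finally show "singular_face k i (lift_simplex X x0 H K k \<tau>) t = lift_simplex X x0 H K (k - 1) (singular_face k i \<tau>) t"
    by simp
qed

end

text \<open>Both sides lift the same simplex of \<open>X\<close> and agree at the last vertex.\<close>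

lemma lift_simplex_same:
  assumes x0: "x0 \<in> topspace X" and ls: "locally_simple X" and H: "subgroup H (fundamental_group X x0)"
    and \<tau>: "singular_simplex k (covering_of_subgroup X x0 H) \<tau>" and t: "t \<in> standard_simplex k"
  shows "lift_simplex X x0 H H k \<tau> t = \<tau> t"
proof (rule covering_map_unique_lift[OF covering_map_covering_projection[OF x0 H ls],
      where Z = "powertop_sub (standard_simplex k)" and f = "lift_simplex X x0 H H k \<tau>" and g = \<tau> and ?z0.0 = "vtx k"])
  let ?D = "powertop_sub (standard_simplex k)"
  let ?F = "covering_projection \<circ> \<tau>"
  let ?L = "lift_simplex X x0 H H k \<tau>"
  note sp = simplex_projection[OF x0 H H \<tau>]
  have v: "vtx k \<in> standard_simplex k" by simp
  show "continuous_map ?D (covering_of_subgroup X x0 H) ?L"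
    using singular_simplex_lift_simplex[OF x0 H H \<tau>] by (simp add: singular_simplex_def)
  show "continuous_map ?D (covering_of_subgroup X x0 H) \<tau>"
    using \<tau> by (simp add: singular_simplex_def)
  show "connected_space ?D"
    using connectedin_standard_simplex[of k] by (simp add: connectedin_def)
  show "vtx k \<in> topspace ?D" "t \<in> topspace ?D" using t by simp_all
  show "covering_projection (?L z) = covering_projection (\<tau> z)" if "z \<in> topspace ?D" for z
  proof -
    have z: "z \<in> standard_simplex k" using that by simp
    have "pathin_from X x0 (path_join (base_path X x0 H (\<tau> (vtx k))) (?F \<circ> seg (vtx k) z))"
      using sp(3,4)[OF v] sp(2)[OF v z] by (simp add: pathin_path_join)
    then show ?thesis
      using covering_projection_deck_orbit[OF H x0] z by (simp add: lift_simplex_def)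
  qed
  have "path_class X (path_join (base_path X x0 H (\<tau> (vtx k))) (?F \<circ> seg (vtx k) (vtx k))) = path_class X (base_path X x0 H (\<tau> (vtx k)))"
    using path_class_join_const_right[of X "base_path X x0 H (\<tau> (vtx k))"] sp(3,4)[OF v] by (simp add: o_def)
  then show "?L (vtx k) = \<tau> (vtx k)"
    using sp(5)[OF v] by (simp add: lift_simplex_def)
qed

lemma simplex_map_orbit_map_lift_simplex:
  assumes x0: "x0 \<in> topspace X" and ls: "locally_simple X" and H: "subgroup H (fundamental_group X x0)"
    and K: "subgroup K (fundamental_group X x0)" and KH: "K \<subseteq> H"
    and \<tau>: "singular_simplex k (covering_of_subgroup X x0 H) \<tau>"
  shows "simplex_map k (orbit_map X H) (lift_simplex X x0 H K k \<tau>) = \<tau>"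
proof (rule extensionalityI[of _ "standard_simplex k"])
  show "simplex_map k (orbit_map X H) (lift_simplex X x0 H K k \<tau>) \<in> extensional (standard_simplex k)"
    by (simp add: simplex_map_def)
  show "\<tau> \<in> extensional (standard_simplex k)" using \<tau> by (simp add: singular_simplex_def)
  fix t assume t: "t \<in> standard_simplex k"
  note sp = simplex_projection[OF x0 H H \<tau>]
  have v: "vtx k \<in> standard_simplex k" by simp
  have "pathin_from X x0 (path_join (base_path X x0 H (\<tau> (vtx k))) ((covering_projection \<circ> \<tau>) \<circ> seg (vtx k) t))"
    using sp(3,4)[OF v] sp(2)[OF v t] by (simp add: pathin_path_join)
  then have "orbit_map X H (lift_simplex X x0 H K k \<tau> t) = lift_simplex X x0 H H k \<tau> t"
    using orbit_map_deck_orbit[OF x0 K H KH] t by (simp add: lift_simplex_def)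
  then show "simplex_map k (orbit_map X H) (lift_simplex X x0 H K k \<tau>) t = \<tau> t"
    using t lift_simplex_same[OF x0 ls H \<tau> t] by (simp add: simplex_map_def)
qed

section \<open>The local structure of manifolds\<close>

text \<open>The preimage under a chart of a convex open set \<open>C\<close> is simple: in \<open>C\<close>, points are joined by segments, and
  paths with the same ends are homotopic along segments.\<close>

lemma topological_manifold_locally_simple:
  assumes M: "topological_manifold n X" shows "locally_simple X"
  unfolding locally_simple_def
proof (intro allI impI, elim conjE)
  fix U x assume U: "openin X U" and x: "x \<in> U"
  have xX: "x \<in> topspace X" using U x openin_subset by auto
  have "\<exists>U0 V. openin X U0 \<and> x \<in> U0 \<and> openin (Euclidean_space n) V \<and>
        subtopology X U0 homeomorphic_space subtopology (Euclidean_space n) V"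
    using M xX by (simp add: topological_manifold_def)
  then obtain U0 V where U0: "openin X U0" "x \<in> U0" and V: "openin (Euclidean_space n) V"
    and hom: "subtopology X U0 homeomorphic_space subtopology (Euclidean_space n) V"
    by (elim exE conjE) (rule that)
  obtain f g where fg: "homeomorphic_maps (subtopology X U0) (subtopology (Euclidean_space n) V) f g"
    using hom unfolding homeomorphic_space_def by auto
  let ?XU = "subtopology X U0" and ?EV = "subtopology (Euclidean_space n) V"
  have cf: "continuous_map ?XU ?EV f" and cg: "continuous_map ?EV ?XU g"
    and gf: "\<And>a. a \<in> topspace ?XU \<Longrightarrow> g (f a) = a" and fg': "\<And>b. b \<in> topspace ?EV \<Longrightarrow> f (g b) = b"
    using fg by (auto simp: homeomorphic_maps_def)
  have tX: "topspace ?XU = U0" using U0 openin_subset[OF U0(1)] by auto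
  have tE: "topspace ?EV = V" using openin_subset[OF V] by auto
  let ?P = "{b \<in> topspace ?EV. g b \<in> U \<inter> U0}"
  have "openin ?XU (U \<inter> U0)" using U U0 by (auto simp: openin_open_subtopology)
  then have "openin ?EV ?P" by (rule openin_continuous_map_preimage[OF cg])
  then have oP: "openin (Euclidean_space n) ?P" using V openin_trans_full by blast
  then obtain T where T: "openin (powertop_real UNIV) T" "?P = T \<inter> {x. \<forall>i\<ge>n. x i = 0}"
    unfolding Euclidean_space_def openin_subtopology by auto
  have fx: "f x \<in> ?P"
    using continuous_map_image_subset_topspace[OF cf] tX U0 x gf[of x] by auto
  then have "f x \<in> T" using T(2) by auto
  then obtain B where B: "openin (powertop_real UNIV) B" "f x \<in> B" "B \<subseteq> T" "seg_convex B"
    using powertop_convex_nbhd[OF T(1)] by metis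
  define C where "C = B \<inter> {x. \<forall>i\<ge>n. x i = (0::real)}"
  have CP: "C \<subseteq> ?P" using T(2) B(3) by (auto simp: C_def)
  have CV: "C \<subseteq> V" using CP tE by auto
  have convC: "seg_convex C"
    unfolding C_def by (rule seg_convex_Int[OF B(4)]) (simp add: seg_convex_def seg_def)
  have oC: "openin (Euclidean_space n) C"
    using B(1) unfolding Euclidean_space_def C_def openin_subtopology by auto
  have subC: "subtopology ?EV C = powertop_sub C"
    using CV by (auto simp: Euclidean_space_def subtopology_subtopology C_def intro!: arg_cong[where f="subtopology (powertop_real UNIV)"])
  have cgC: "continuous_map (powertop_sub C) X g"
    using continuous_map_from_subtopology[OF cg, of C] unfolding subC continuous_map_in_subtopology by simp
  define W where "W = {a \<in> topspace ?XU. f a \<in> C}"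
  have "openin ?EV C" using oC CV V by (simp add: openin_open_subtopology)
  then have "openin ?XU W" unfolding W_def by (rule openin_continuous_map_preimage[OF cf])
  then have oW: "openin X W" using U0(1) openin_trans_full by blast
  have WU: "W \<subseteq> U"
  proof
    fix a assume a: "a \<in> W"
    then have "g (f a) = a" "f a \<in> ?P" using gf CP by (auto simp: W_def)
    then show "a \<in> U" by auto
  qed
  have gC: "g c \<in> W \<and> f (g c) = c" if "c \<in> C" for c
  proof -
    have cV: "c \<in> topspace ?EV" using that CV tE by auto
    then have "g c \<in> topspace ?XU" using continuous_map_image_subset_topspace[OF cg] by blast
    then show ?thesis using that fg'[OF cV] by (simp add: W_def)
  qed
  have paths: "\<exists>d. pathin (subtopology X W) d \<and> d 0 = a \<and> d 1 = b" if a: "a \<in> W" and b: "b \<in> W" for a b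
  proof -
    have fab: "f a \<in> C" "f b \<in> C" using a b by (auto simp: W_def)
    have p: "pathin (powertop_sub C) (seg (f a) (f b))" by (rule pathin_seg[OF convC fab])
    have "continuous_map (powertop_sub C) (subtopology X W) g"
      using cgC gC by (simp add: continuous_map_in_subtopology Pi_iff)
    then have "pathin (subtopology X W) (g \<circ> seg (f a) (f b))" by (rule pathin_image[OF p])
    moreover have "g (f a) = a" "g (f b) = b" using a b gf by (auto simp: W_def)
    ultimately show ?thesis by (intro exI[of _ "g \<circ> seg (f a) (f b)"]) simp
  qed
  have homot: "path_homotopic X d d'"
    if d: "pathin (subtopology X W) d" and d': "pathin (subtopology X W) d'" and e: "d 0 = d' 0" "d 1 = d' 1" for d d'
  proof -
    have cfW: "continuous_map (subtopology X W) (powertop_sub C) f"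
    proof -
      have "continuous_map (subtopology ?XU W) (subtopology ?EV C) f"
        using continuous_map_from_subtopology[OF cf, of W] by (auto simp: continuous_map_in_subtopology W_def)
      moreover have "subtopology ?XU W = subtopology X W"
        using tX by (auto simp: subtopology_subtopology W_def intro!: arg_cong[where f="subtopology X"])
      ultimately show ?thesis by (simp add: subC)
    qed
    have h: "path_homotopic X (g \<circ> (f \<circ> d)) (g \<circ> (f \<circ> d'))"
      by (intro path_homotopic_image[OF cgC] path_homotopic_seg_convex[OF convC] pathin_image[OF _ cfW] d d') (use e in auto)
    \<comment> \<open>\<open>g \<circ> f\<close> is the identity on \<open>W\<close> only, not on all of \<open>X\<close>.\<close>
    have rt: "path_homotopic X c (g \<circ> (f \<circ> c))" if "pathin (subtopology X W) c" for c
      using pathin_in_topspace[OF that] gf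
      by (intro path_homotopic_eqI pathin_subtopology_imp_pathin[OF that]) (auto simp: W_def)
    show ?thesis
      by (rule path_homotopic_trans[OF rt[OF d] path_homotopic_trans[OF h path_homotopic_sym[OF rt[OF d']]]])
  qed
  have "simple_nbhd X W"
    unfolding simple_nbhd_def using oW paths homot by simp
  moreover have "x \<in> W" using fx B(2) U0(2) tX T(2) by (auto simp: W_def C_def)
  ultimately show "\<exists>W. x \<in> W \<and> W \<subseteq> U \<and> simple_nbhd X W" using WU by auto
qed

text \<open>The homology relative to the complement of a point does not depend on the point, and passing to a
  higher-dimensional space shifts the degree. This leads to the homology of a point in degree 0.\<close>

lemma infinite_local_homology_Euclidean_space:
  assumes v: "v \<in> topspace (Euclidean_space n)"
  shows "infinite (carrier (local_homology n (Euclidean_space n) v))"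
proof -
  let ?E = Euclidean_space
  define zr where "zr = (\<lambda>i::nat. 0::real)"
  have zr: "zr \<in> topspace (?E k)" for k by (simp add: topspace_Euclidean_space zr_def)
  have cl: "closedin (?E k) {x}" if "x \<in> topspace (?E k)" for k x
    using Hausdorff_imp_t1_space[OF Hausdorff_Euclidean_space] that by (simp add: t1_space_closedin_singleton)
  have "subtopology (?E n) {v} homeomorphic_space subtopology (?E n) {zr}"
    using v zr by (intro homeomorphic_maps_imp_homeomorphic_space[of _ _ "\<lambda>_. zr" "\<lambda>_. v"]) (auto simp: homeomorphic_maps_def)
  then have 1: "local_homology n (?E n) v \<cong> local_homology n (?E n) zr"
    by (rule isomorphic_relative_homology_groups_Euclidean_complements[OF cl[OF v] cl[OF zr]])
  have t0: "topspace (?E 0) = {zr}" by (auto simp: topspace_Euclidean_space zr_def)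
  have 2: "relative_homology_group 0 (?E 0) (topspace (?E 0) - {zr}) \<cong> relative_homology_group (0 + int n) (?E (0 + n)) (topspace (?E (0 + n)) - {zr})"
    by (rule relative_homology_group_Euclidean_complement_step[OF cl[OF zr]])
  have 3: "homology_group 0 (?E 0) \<cong> integer_group"
    by (rule homology_coefficients[OF t0])
  have "infinite (carrier (homology_group 0 (?E 0)))"
    using infinite_UNIV_int iso_finite[OF 3] by simp
  then have "infinite (carrier (relative_homology_group 0 (?E 0) (topspace (?E 0) - {zr})))"
    by (simp add: t0)
  then have "infinite (carrier (local_homology n (?E n) zr))"
    using iso_finite[OF 2] by simp
  then show ?thesis
    using iso_finite[OF 1] by simp
qed

lemma infinite_local_homology_manifold:
  assumes M: "topological_manifold n X" and x: "x \<in> topspace X"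
  shows "infinite (carrier (local_homology n X x))"
proof -
  let ?E = "Euclidean_space n"
  have HX: "Hausdorff_space X" using M by (simp add: topological_manifold_def)
  have "\<exists>U V. openin X U \<and> x \<in> U \<and> openin ?E V \<and> subtopology X U homeomorphic_space subtopology ?E V"
    using M x by (simp add: topological_manifold_def)
  then obtain U V where U: "openin X U" "x \<in> U" and V: "openin ?E V"
    and hom: "subtopology X U homeomorphic_space subtopology ?E V"
    by (elim exE conjE) (rule that)
  obtain f where f: "homeomorphic_map (subtopology X U) (subtopology ?E V) f"
    using hom homeomorphic_space by metis
  have tU: "topspace (subtopology X U) = U" and tV: "topspace (subtopology ?E V) = V"
    using openin_subset[OF U(1)] openin_subset[OF V] by auto
  have "f ` U = V"
    using homeomorphic_imp_surjective_map[OF f] tU tV by simp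
  then have ch: "chart X ?E f U"
    using U(1) V f by (simp add: chart_def)
  have "f x \<in> topspace ?E" using \<open>f ` U = V\<close> U(2) openin_subset[OF V] by auto
  then show ?thesis
    using iso_finite[OF local_homology_iso_chart[OF HX Hausdorff_Euclidean_space ch U(2), of n]]
      infinite_local_homology_Euclidean_space by simp
qed

section \<open>Rank and integral simplicial volume\<close>

text \<open>By the compatibility with faces, the linear extension of the lift commutes with the boundary.\<close>

lemma lift_fundamental_cycle:
  assumes x0: "x0 \<in> topspace X" and ls: "locally_simple X" and H: "subgroup H (fundamental_group X x0)"
    and K: "subgroup K (fundamental_group X x0)" and KH: "K \<subseteq> H"
    and z: "singular_relcycle n (covering_of_subgroup X x0 H) {} z"
    and close: "\<And>\<sigma>. \<sigma> \<in> Poly_Mapping.keys z \<Longrightarrow> last_edge_closes X x0 H K n \<sigma>"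
  obtains w where "singular_relcycle n (covering_of_subgroup X x0 K) {} w"
    "chain_map n (orbit_map X H) w = z"
proof -
  let ?B = "covering_of_subgroup X x0 H"
  let ?L = "\<lambda>k. frag_extend (frag_of \<circ> lift_simplex X x0 H K k)"
  let ?S = "{\<sigma>. singular_simplex n ?B \<sigma> \<and> last_edge_closes X x0 H K n \<sigma>}"
  have zS: "Poly_Mapping.keys z \<subseteq> ?S"
    using z close by (auto simp: singular_cycle singular_chain_def)
  have bd: "chain_boundary n (?L n c) = ?L (n - 1) (chain_boundary n c)"
    if n: "n \<noteq> 0" and c: "Poly_Mapping.keys c \<subseteq> ?S" for c
    using c
  proof (induction c rule: frag_induction)
    case (one \<sigma>)
    have "chain_boundary n (?L n (frag_of \<sigma>)) = (\<Sum>i\<le>n. frag_cmul ((-1) ^ i) (frag_of (singular_face n i (lift_simplex X x0 H K n \<sigma>))))"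
      using n by (simp add: chain_boundary_of)
    also have "\<dots> = (\<Sum>i\<le>n. frag_cmul ((-1) ^ i) (frag_of (lift_simplex X x0 H K (n - 1) (singular_face n i \<sigma>))))"
      using lift_simplex_face[OF x0 H K, of n \<sigma>] one n by (intro sum.cong) auto
    also have "\<dots> = ?L (n - 1) (chain_boundary n (frag_of \<sigma>))"
      using n by (simp add: chain_boundary_of frag_extend_sum frag_extend_cmul o_def)
    finally show ?case .
  qed (simp_all add: frag_extend_diff chain_boundary_diff)
  have "singular_chain n (covering_of_subgroup X x0 K) (?L n z)"
    using zS singular_simplex_lift_simplex[OF x0 H K]
    by (intro singular_chain_extend) (auto simp: singular_chain_of)
  moreover have "chain_boundary n (?L n z) = 0"
  proof (cases "n = 0")
    case True
    then show ?thesis by (simp add: chain_boundary_def)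
  next
    case False
    have "chain_boundary n z = 0" using z by (simp add: singular_cycle)
    then show ?thesis using bd[OF False zS] by simp
  qed
  ultimately have "singular_relcycle n (covering_of_subgroup X x0 K) {} (?L n z)"
    by (simp add: singular_cycle)
  moreover have "chain_map n (orbit_map X H) (?L n z) = z"
    using zS
  proof (induction z rule: frag_induction)
    case (one \<sigma>)
    then show ?case using simplex_map_orbit_map_lift_simplex[OF x0 ls H K KH, of n \<sigma>] by simp
  qed (simp_all add: frag_extend_diff chain_map_diff)
  ultimately show thesis by (rule that)
qed

text \<open>The lift of \<open>\<sigma>\<close> to the covering of \<open>H\<close> is \<open>\<sigma>\<close> itself, so that the lift of the last edge arrives at the
  \<open>H\<close>-orbit of the path chosen at its end. The element of \<open>H\<close> that relates the two paths is the required one.\<close>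

lemma exists_closing_deck_transformation:
  assumes x0: "x0 \<in> topspace X" and ls: "locally_simple X" and H: "subgroup H (fundamental_group X x0)"
    and \<sigma>: "singular_simplex n (covering_of_subgroup X x0 H) \<sigma>"
  shows "\<exists>g\<in>H. \<forall>K. subgroup K (fundamental_group X x0) \<longrightarrow> g \<in> K \<longrightarrow> last_edge_closes X x0 H K n \<sigma>"
proof -
  note sp = simplex_projection[OF x0 H H \<sigma>]
  have v: "vtx n \<in> standard_simplex n" "vtx (n - 1) \<in> standard_simplex n" by auto
  let ?b = "\<lambda>i. base_path X x0 H (\<sigma> (vtx i))"
  let ?r = "path_join (?b n) ((covering_projection \<circ> \<sigma>) \<circ> seg (vtx n) (vtx (n - 1)))"
  have b: "pathin_from X x0 (?b (n - 1))" using sp(3) v by simp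
  have r: "pathin_from X x0 ?r"
    using sp(3,4)[OF v(1)] sp(2)[OF v] by (simp add: pathin_path_join)
  have "orbit_of X H ?r = lift_simplex X x0 H H n \<sigma> (vtx (n - 1))"
    by (simp add: lift_simplex_def)
  also have "\<dots> = orbit_of X H (?b (n - 1))"
    using lift_simplex_same[OF x0 ls H \<sigma> v(2)] sp(5)[OF v(2)] by simp
  finally obtain l where l: "loopin X x0 l" "path_class X l \<in> H" "path_class X ?r = path_class X (path_join l (?b (n - 1)))"
    unfolding deck_orbit_eq_iff[OF H x0 b r] by (elim exE conjE) (rule that, simp_all)
  have "last_edge_closes X x0 H K n \<sigma>" if K: "subgroup K (fundamental_group X x0)" "path_class X l \<in> K" for K
    unfolding last_edge_closes_def l(3) by (rule deck_orbit_join[OF K(1) x0 b l(1) K(2)])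
  then show ?thesis using l(2) by auto
qed

text \<open>The subgroup \<open>K\<close> generated by the closing elements of the simplices of \<open>z\<close> is all of \<open>H\<close>, since \<open>z\<close> lifts to the
  covering of \<open>K\<close>.\<close>

theorem group_rank_le_card_keys_fundamental_cycle:
  assumes x0: "x0 \<in> topspace X" and ls: "locally_simple X" and HX: "Hausdorff_space X"
    and \<mu>: "orientation n X \<mu>" and inf: "\<And>x. x \<in> topspace X \<Longrightarrow> infinite (carrier (local_homology n X x))"
    and H: "subgroup H (fundamental_group X x0)"
    and z: "fundamental_cycle n (covering_of_subgroup X x0 H)
              (induced_orientation n (covering_of_subgroup X x0 H) X covering_projection \<mu>) z"
  shows "group_rank (fundamental_group X x0\<lparr>carrier := H\<rparr>) \<le> enat (card (Poly_Mapping.keys z))"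
proof -
  let ?G = "fundamental_group X x0"
  let ?B = "covering_of_subgroup X x0 H"
  let ?\<nu> = "induced_orientation n ?B X covering_projection \<mu>"
  let ?keys = "Poly_Mapping.keys z"
  have G: "group ?G" by (rule group_fundamental_group[OF x0])
  have zc: "singular_relcycle n ?B {} z" using z by (simp add: fundamental_cycle_def)
  have "\<exists>g\<in>H. \<forall>K. subgroup K ?G \<longrightarrow> g \<in> K \<longrightarrow> last_edge_closes X x0 H K n \<sigma>" if "\<sigma> \<in> ?keys" for \<sigma>
    using zc that by (intro exists_closing_deck_transformation[OF x0 ls H]) (auto simp: singular_cycle singular_chain_def)
  then have "\<forall>\<sigma>\<in>?keys. \<exists>g. g \<in> H \<and> (\<forall>K. subgroup K ?G \<longrightarrow> g \<in> K \<longrightarrow> last_edge_closes X x0 H K n \<sigma>)"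
    by blast
  then obtain g where g: "\<forall>\<sigma>\<in>?keys. g \<sigma> \<in> H \<and> (\<forall>K. subgroup K ?G \<longrightarrow> g \<sigma> \<in> K \<longrightarrow> last_edge_closes X x0 H K n \<sigma>)"
    by (rule bchoice[THEN exE])
  let ?S = "g ` ?keys"
  let ?K = "generate ?G ?S"
  have SH: "?S \<subseteq> H" using g by auto
  have SG: "?S \<subseteq> carrier ?G" using SH subgroup.subset[OF H] by (rule subset_trans)
  have K: "subgroup ?K ?G" by (rule group.generate_is_subgroup[OF G SG])
  have KH: "?K \<subseteq> H" by (rule group.generate_subgroup_incl[OF G SH H])
  have close: "last_edge_closes X x0 H ?K n \<sigma>" if "\<sigma> \<in> ?keys" for \<sigma>
    using g K that generate.incl[of "g \<sigma>" ?S ?G] by simp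
  let ?E = "covering_of_subgroup X x0 ?K"
  obtain w where w: "singular_relcycle n ?E {} w" "chain_map n (orbit_map X H) w = z"
    by (rule lift_fundamental_cycle[OF x0 ls H K KH zc close]) (assumption, (rule that; assumption))
  have covB: "covering_map ?B X covering_projection" by (rule covering_map_covering_projection[OF x0 H ls])
  have HB: "Hausdorff_space ?B" by (rule covering_map_Hausdorff[OF covB HX])
  have lhB: "local_homeomorphism ?B X covering_projection" by (rule covering_map_local_homeomorphism[OF covB])
  have \<nu>: "orientation n ?B ?\<nu>" by (rule orientation_induced_orientation[OF HB HX \<mu> lhB])
  have infB: "infinite (carrier (local_homology n ?B b))" if b: "b \<in> topspace ?B" for b
    by (rule infinite_local_homology_local_homeomorphism[OF HB HX lhB inf b])
  have inj: "inj_on (orbit_map X H) (topspace ?E)"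
    by (rule covering_map_inj_on_if_fundamental_cycle_lifts[OF covering_map_orbit_map[OF x0 ls K H KH] HB
          connected_space_covering_of_subgroup[OF x0] \<nu> infB w(1)]) (use z w(2) in simp_all)
  \<comment> \<open>The \<open>K\<close>-orbits of the elements of \<open>H\<close> have the same image under the injective orbit map.\<close>
  have "H \<subseteq> ?K"
  proof
    fix h assume h: "h \<in> H"
    obtain l where l: "loopin X x0 l" "h = path_class X l"
      using subgroup_fundamental_groupD(4)[OF H x0 h] by auto
    have c: "pathin_from X x0 (\<lambda>_. x0)" using x0 by (simp add: pathin_const)
    have l': "pathin_from X x0 l" using l by simp
    have lc: "path_class X (path_join m (\<lambda>_. x0)) = path_class X m" if "loopin X x0 m" for m
      using path_class_join_const_right[of X m x0] that by simp
    have "orbit_of X H l = orbit_of X H (\<lambda>_. x0)"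
      using deck_orbit_join[OF H x0 c l(1)] h l(2) lc[OF l(1)] by simp
    then have "orbit_map X H (orbit_of X ?K l) = orbit_map X H (orbit_of X ?K (\<lambda>_. x0))"
      using orbit_map_deck_orbit[OF x0 K H KH] l' c by simp
    moreover have "orbit_of X ?K l \<in> topspace ?E" "orbit_of X ?K (\<lambda>_. x0) \<in> topspace ?E"
      unfolding topspace_covering_of_subgroup using l' c by auto
    ultimately have "orbit_of X ?K l = orbit_of X ?K (\<lambda>_. x0)"
      by (rule inj_onD[OF inj])
    then obtain m where m: "loopin X x0 m" "path_class X m \<in> ?K" "path_class X l = path_class X (path_join m (\<lambda>_. x0))"
      unfolding deck_orbit_eq_iff[OF K x0 c l'] by (elim exE conjE) (rule that, simp_all)
    then show "h \<in> ?K" using lc[OF m(1)] l(2) by simp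
  qed
  then have KeqH: "?K = H" using KH by auto
  have "?S \<in> {S. finite S \<and> S \<subseteq> carrier (?G\<lparr>carrier := H\<rparr>) \<and> generate (?G\<lparr>carrier := H\<rparr>) S = carrier (?G\<lparr>carrier := H\<rparr>)}"
    using SH KeqH group.generate_consistent[OF G SH H] by simp
  then have "group_rank (?G\<lparr>carrier := H\<rparr>) \<le> enat (card ?S)"
    unfolding group_rank_def by (rule INF_lower)
  also have "\<dots> \<le> enat (card ?keys)" by (simp add: card_image_le)
  finally show ?thesis .
qed

lemma card_keys_le_chain_norm: "card (Poly_Mapping.keys z) \<le> chain_norm z"
proof -
  have "1 \<le> nat \<bar>Poly_Mapping.lookup z \<sigma>\<bar>" if "\<sigma> \<in> Poly_Mapping.keys z" for \<sigma>
    using that by (simp add: in_keys_iff)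
  then have "(\<Sum>\<sigma>\<in>Poly_Mapping.keys z. 1) \<le> chain_norm z"
    unfolding chain_norm_def by (intro sum_mono) auto
  then show ?thesis by simp
qed

lemma rank_quotient_le_volume_quotient:
  assumes M: "topological_manifold n M" and \<mu>: "orientation n M \<mu>" and x0: "x0 \<in> topspace M"
    and H: "H \<in> finite_index_subgroups (fundamental_group M x0)"
  shows "rank_quotient (fundamental_group M x0) H \<le> volume_quotient n M \<mu> x0 H"
proof -
  let ?G = "fundamental_group M x0"
  let ?r = "group_rank (?G\<lparr>carrier := H\<rparr>)"
  let ?v = "integral_simplicial_volume n (covering_of_subgroup M x0 H)
       (induced_orientation n (covering_of_subgroup M x0 H) M covering_projection \<mu>)"
  have sub: "subgroup H ?G" and fin: "finite (rcosets\<^bsub>?G\<^esub> H)"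
    using H by (auto simp: finite_index_subgroups_def)
  have HM: "Hausdorff_space M" using M by (simp add: topological_manifold_def)
  have "?r \<le> ?v"
    unfolding integral_simplicial_volume_def
  proof (rule INF_greatest)
    fix z assume "z \<in> {z. fundamental_cycle n (covering_of_subgroup M x0 H)
       (induced_orientation n (covering_of_subgroup M x0 H) M covering_projection \<mu>) z}"
    then have "?r \<le> enat (card (Poly_Mapping.keys z))"
      by (intro group_rank_le_card_keys_fundamental_cycle[OF x0 topological_manifold_locally_simple[OF M] HM \<mu>
            infinite_local_homology_manifold[OF M] sub]) simp_all
    also have "\<dots> \<le> enat (chain_norm z)" by (simp add: card_keys_le_chain_norm)
    finally show "?r \<le> enat (chain_norm z)" .
  qed
  then have "ereal_of_enat ?r \<le> ereal_of_enat ?v" by simp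
  moreover have "ereal_of_enat ?r - 1 \<le> ereal_of_enat ?r" by (cases ?r) (auto simp: one_ereal_def)
  ultimately have le: "ereal_of_enat ?r - 1 \<le> ereal_of_enat ?v" by (meson order_trans)
  have "H \<in> rcosets\<^bsub>?G\<^esub> H"
    by (rule subgroup.subgroup_in_rcosets[OF sub group_fundamental_group[OF x0]])
  then have "0 < group_index ?G H"
    unfolding group_index_def using fin by (auto simp: card_gt_0_iff)
  then show ?thesis
    unfolding rank_quotient_def volume_quotient_def by (intro ereal_divide_right_mono le) simp
qed

theorem theorem1p1:
  fixes n :: nat
    and M :: "'a topology"
    and \<mu> :: "'a \<Rightarrow> 'a chain set"
    and x0 :: 'a
    and \<Gamma>s :: "nat \<Rightarrow> (real \<Rightarrow> 'a) set set"
  assumes "closed_connected_manifold n M"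
    and "orientation n M \<mu>"
    and "x0 \<in> topspace M"
    and "finite_index_chain (fundamental_group M x0) \<Gamma>s"
  shows "rank_gradient_wrt (fundamental_group M x0) \<Gamma>s
           \<le> stable_integral_simplicial_volume_wrt n M \<mu> x0 \<Gamma>s
       \<and> rank_gradient (fundamental_group M x0)
           \<le> stable_integral_simplicial_volume n M \<mu> x0"
proof
  have M: "topological_manifold n M"
    using assms(1) by (simp add: closed_connected_manifold_def)
  note le = rank_quotient_le_volume_quotient[OF M assms(2,3)]
  show "rank_gradient_wrt (fundamental_group M x0) \<Gamma>s \<le> stable_integral_simplicial_volume_wrt n M \<mu> x0 \<Gamma>s"
    unfolding rank_gradient_wrt_def stable_integral_simplicial_volume_wrt_def
    using assms(4) by (intro INF_mono' le) (simp add: finite_index_chain_def)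
  show "rank_gradient (fundamental_group M x0) \<le> stable_integral_simplicial_volume n M \<mu> x0"
    unfolding rank_gradient_def stable_integral_simplicial_volume_def
    by (intro INF_superset_mono subset_refl le)
qed

end
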